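(* Let $T:\mathbb{T}\to\mathbb{T}$ be a map of the circle $\mathbb{T}=\mathbb{R}/\mathbb{Z}$ and $V$ a space of potentials, as in one of the following three situations. (1) $T=T_q$ with $q>0$, where $T_q(x)=(1+(2x)^q)x$ for $x\in[0,\frac12]$ and $T_q(x)=2x-1$ for $x\in[\frac12,1)$; and either $q<1$ and $V=\mathcal{C}^\gamma(\mathbb{T})$ where $\alpha,\gamma\in(0,1)$ satisfy $\gamma-\alpha\ge q$; or $q\ge1$, $\gamma>q$, $\alpha\in(0,1]$, $\gamma+1-\alpha\ge q$, and $V$ is the space of $A\in\mathcal{C}^\alpha(\mathbb{T})$ that are continuously differentiable near $0$ with $A'(r)=O(|r|^\gamma)$ as $r\to0$. (2) $T=T_{q\log}$ with $q>0$, where $T_{q\log}(0)=0$, $T_{q\log}(x)=(1+(1-\log 2x)^{-q})x$ for $x\in(0,\frac12]$ and $T_{q\log}(x)=2x-1$ for $x\in[\frac12,1)$; $\alpha\in(0,1)$ and $V=\mathcal{C}^{\alpha+q\log}(\mathbb{T})$. (3) $T$ is a degree $k$ self-covering of the circle with a neutral fixed point $0$, uniformly expanding outside each neighborhood of $0$; $\alpha\in(0,1]$ and $V$ is the space of $A\in\mathcal{C}^\alpha(\mathbb{T})$ which are constant near $0$. Then for all $A\in V$ the RPF measure $\mu_A$ (obtained from the transfer operator $\mathscr{L}_{T,A}$ acting on $\mathcal{C}^\alpha(\mathbb{T})$) is the unique equilibrium state of the potential $A$, i.e. it uniquely maximizes $h(\mu)+\int A\,d\mu$ among $T$-invariant probability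 measures $\mu$, where $h$ is the Kolmogorov–Sinai entropy.
   Context: All circle maps are parametrized by $[0,1)$ with values modulo $1$, $d$ is the usual distance. In (3), the hypotheses mean: $T$ is a $k$-to-$1$ covering map ($k\ge2$); $T(0)=0$ and $0$ is neutral (at least one one-sided derivative of $T$ at $0$ exists and has absolute value $1$); and for every neighborhood $N$ of $0$ there is $\lambda(N)>1$ such that $|T'|\ge\lambda$ outside $N$ (if $T$ is not differentiable everywhere, this is required at the points outside $N$ where $T$ is differentiable). Function spaces: for a modulus of continuity $\omega$ (continuous, increasing, concave $[0,\infty)\to[0,\infty)$, $\omega(0)=0$), $\mathcal{C}^\omega(\mathbb{T})$ is the Banach space of $f:\mathbb{T}\to\mathbb{R}$ with $|f(x)-f(y)|\le C\omega(d(x,y))$ for some $C$ (least $C$ denoted $\mathrm{Hol}_\omega(f)$), with norm $\|f\|_\infty+\mathrm{Hol}_\omega(f)$. $\mathcal{C}^\alpha$ is for $\omega(r)=r^\alpha$ ($\mathcal{C}^1$ means Lipschitz). $\mathcal{C}^{\alpha+\beta\log}$ is for a modulus equal to $r^\alpha/(\log\frac{r_0}{r})^\beta$ on $(0,1]$, with $r_0$ large enough to make it increasing and concave on $[0,1]$. Transfer operator: $\mathscr{L}_{T,A}f(x)=\sum_{T(y)=x}e^{A(y)}f(y)$. In these situations there exist a positive $h_A\in\mathcal{C}^\alpha(\mathbb{T})$, a constant $\rho>0$ and a nonzero positive finite measure $\nu_A$ with $\mathscr{L}_{T,A}h_A=\rho h_A$ and $\mathscr{L}_{T,A}^*\nu_A=\rho\nu_A$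 (i.e. $\int\mathscr{L}_{T,A}f\,d\nu_A=\rho\int f\,d\nu_A$ for all $f\in\mathcal{C}^\alpha(\mathbb{T})$); the RPF measure is the probability $\mu_A$ with $d\mu_A=h_A\,d\nu_A$, $h_A$ suitably scaled. *)

theory Defs
  imports "HOL-Probability.Probability"
begin

text \<open>The circle \<open>\<real>/\<int>\<close>, represented by the fundamental domain \<open>[0,1)\<close>.\<close>

typedef circle = "{0..<1::real}"
  morphisms coord Abs_circle
  by (rule exI[of _ 0]) simp

definition to_circle :: "real \<Rightarrow> circle" where
  "to_circle r = Abs_circle (frac r)"

lemma coord_bounds: "0 \<le> coord x" "coord x < 1"
  using coord[of x] by auto

lemma coord_to_circle [simp]: "coord (to_circle r) = frac r"
  unfolding to_circle_def by (rule Abs_circle_inverse) (simp add: frac_lt_1)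

lemma to_circle_coord [simp]: "to_circle (coord x) = x"
proof -
  have "frac (coord x) = coord x"
    using coord_bounds[of x] by (simp add: frac_eq)
  then show ?thesis
    by (simp add: to_circle_def coord_inverse)
qed

lemma to_circle_eq_iff: "to_circle r = to_circle s \<longleftrightarrow> r - s \<in> \<int>"
proof
  assume "to_circle r = to_circle s"
  then have "frac r = frac s" by (metis coord_to_circle)
  then have "r - s = of_int (\<lfloor>r\<rfloor> - \<lfloor>s\<rfloor>)" by (simp add: frac_def)
  then show "r - s \<in> \<int>" by (metis Ints_of_int)
next
  assume "r - s \<in> \<int>"
  then obtain k where "r = s + of_int k" by (metis Ints_cases add.commute diff_add_cancel)
  then have "frac r = frac s" by (simp add: frac_def)
  then show "to_circle r = to_circle s" by (simp add: to_circle_def)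
qed

instantiation circle :: metric_space
begin

definition dist_circle :: "circle \<Rightarrow> circle \<Rightarrow> real" where
  "dist_circle x y = min \<bar>coord x - coord y\<bar> (1 - \<bar>coord x - coord y\<bar>)"

definition uniformity_circle :: "(circle \<times> circle) filter" where
  "uniformity_circle = (INF e\<in>{0<..}. principal {(x, y). dist x y < e})"

definition open_circle :: "circle set \<Rightarrow> bool" where
  "open_circle U \<longleftrightarrow> (\<forall>x\<in>U. \<forall>\<^sub>F (x', y) in uniformity. x' = x \<longrightarrow> y \<in> U)"

instance
proof
  fix x y z :: circle
  show "dist x y = 0 \<longleftrightarrow> x = y"
    using coord_bounds[of x] coord_bounds[of y] coord_inject[of x y]
    by (auto simp: dist_circle_def min_def abs_if split: if_splits)
  show "dist x y \<le> dist x z + dist y z"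
    using coord_bounds[of x] coord_bounds[of y] coord_bounds[of z]
    by (auto simp: dist_circle_def min_def abs_if split: if_splits)
qed (rule uniformity_circle_def open_circle_def)+

end

definition modulus_of_continuity :: "(real \<Rightarrow> real) \<Rightarrow> bool" where
  "modulus_of_continuity \<omega> \<longleftrightarrow>
     continuous_on {0..} \<omega> \<and> strict_mono_on {0..} \<omega> \<and> concave_on {0..} \<omega> \<and> \<omega> 0 = 0"

definition modulus_space :: "(real \<Rightarrow> real) \<Rightarrow> (circle \<Rightarrow> real) set" where
  "modulus_space \<omega> = {f. \<exists>C. \<forall>x y. \<bar>f x - f y\<bar> \<le> C * \<omega> (dist x y)}"

definition holder_space :: "real \<Rightarrow> (circle \<Rightarrow> real) set" where
  "holder_space \<alpha> = modulus_space (\<lambda>r. r powr \<alpha>)"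

text \<open>
  Any two values of \<open>r\<^sub>0\<close> large enough give comparable moduli on \<open>[0,1]\<close>, and distances on the
  circle are at most \<open>1/2\<close>; hence all such \<open>\<omega>\<close> have the same \<open>modulus_space\<close>.
\<close>
definition log_holder_modulus :: "real \<Rightarrow> real \<Rightarrow> (real \<Rightarrow> real) \<Rightarrow> bool" where
  "log_holder_modulus \<alpha> \<beta> \<omega> \<longleftrightarrow> modulus_of_continuity \<omega> \<and>
     (\<exists>r\<^sub>0>1. \<forall>r\<in>{0<..1}. \<omega> r = r powr \<alpha> / (ln (r\<^sub>0 / r)) powr \<beta>)"

definition flat_at_zero :: "real \<Rightarrow> (circle \<Rightarrow> real) \<Rightarrow> bool" where
  "flat_at_zero \<gamma> A \<longleftrightarrow> (\<exists>\<epsilon>>0. \<exists>A'.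
     (\<forall>r\<in>{-\<epsilon><..<\<epsilon>}. ((\<lambda>s. A (to_circle s)) has_real_derivative A' r) (at r)) \<and>
     continuous_on {-\<epsilon><..<\<epsilon>} A' \<and> A' \<in> O[at 0](\<lambda>r. \<bar>r\<bar> powr \<gamma>))"

definition T_pow :: "real \<Rightarrow> circle \<Rightarrow> circle" where
  "T_pow q x = to_circle
     (if coord x \<le> 1/2 then (1 + (2 * coord x) powr q) * coord x else 2 * coord x - 1)"

definition T_log :: "real \<Rightarrow> circle \<Rightarrow> circle" where
  "T_log q x = to_circle
     (if coord x = 0 then 0
      else if coord x \<le> 1/2 then (1 + (1 - ln (2 * coord x)) powr (- q)) * coord x
      else 2 * coord x - 1)"

text \<open>
  \<open>F\<close> is a lift of \<open>t \<mapsto> T (x + t)\<close>, not required to be continuous away from \<open>0\<close>.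
  \<open>S = UNIV\<close> gives the derivative of \<open>T\<close> at \<open>x\<close>, \<open>S = {0..}\<close> and \<open>S = {..0}\<close> the one-sided ones.
\<close>
definition circle_deriv_within :: "(circle \<Rightarrow> circle) \<Rightarrow> circle \<Rightarrow> real set \<Rightarrow> real \<Rightarrow> bool" where
  "circle_deriv_within T x S D \<longleftrightarrow>
     (\<exists>F. (\<forall>t. to_circle (F t) = T (to_circle (coord x + t))) \<and>
          (F has_real_derivative D) (at 0 within S))"

definition self_covering :: "nat \<Rightarrow> (circle \<Rightarrow> circle) \<Rightarrow> bool" where
  "self_covering k T \<longleftrightarrow> covering_space UNIV T UNIV \<and> (\<forall>y. card (T -` {y}) = k)"

definition neutral_fixed_point :: "(circle \<Rightarrow> circle) \<Rightarrow> circle \<Rightarrow> bool" where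
  "neutral_fixed_point T p \<longleftrightarrow> T p = p \<and>
     (\<exists>D. \<bar>D\<bar> = 1 \<and> (circle_deriv_within T p {0..} D \<or> circle_deriv_within T p {..0} D))"

definition expanding_away_from :: "(circle \<Rightarrow> circle) \<Rightarrow> circle \<Rightarrow> bool" where
  "expanding_away_from T p \<longleftrightarrow>
     (\<forall>N. open N \<and> p \<in> N \<longrightarrow>
        (\<exists>l>1. \<forall>x D. x \<notin> N \<and> circle_deriv_within T x UNIV D \<longrightarrow> \<bar>D\<bar> \<ge> l))"

definition transfer_operator ::
    "(circle \<Rightarrow> circle) \<Rightarrow> (circle \<Rightarrow> real) \<Rightarrow> (circle \<Rightarrow> real) \<Rightarrow> circle \<Rightarrow> real" where
  "transfer_operator T A f x = (\<Sum>y\<in>T -` {x}. exp (A y) * f y)"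

definition RPF_measure ::
    "real \<Rightarrow> (circle \<Rightarrow> circle) \<Rightarrow> (circle \<Rightarrow> real) \<Rightarrow> circle measure \<Rightarrow> bool" where
  "RPF_measure \<alpha> T A \<mu> \<longleftrightarrow> (\<exists>h \<rho> \<nu>.
     h \<in> holder_space \<alpha> \<and> (\<forall>x. h x > 0) \<and> \<rho> > 0 \<and>
     sets \<nu> = sets borel \<and> finite_measure \<nu> \<and> emeasure \<nu> (space \<nu>) \<noteq> 0 \<and>
     (\<forall>x. transfer_operator T A h x = \<rho> * h x) \<and>
     (\<forall>f\<in>holder_space \<alpha>. (\<integral>x. transfer_operator T A f x \<partial>\<nu>) = \<rho> * (\<integral>x. f x \<partial>\<nu>)) \<and>
     \<mu> = density \<nu> (\<lambda>x. ennreal (h x)) \<and> prob_space \<mu>)"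

definition finite_measurable_partition :: "'a measure \<Rightarrow> 'a set set \<Rightarrow> bool" where
  "finite_measurable_partition M P \<longleftrightarrow> finite P \<and> P \<subseteq> sets M \<and> partition_on (space M) P"

definition partition_entropy :: "'a measure \<Rightarrow> 'a set set \<Rightarrow> real" where
  "partition_entropy M P = - (\<Sum>E\<in>P. measure M E * ln (measure M E))"

text \<open>The join of \<open>P, T\<^sup>-\<^sup>1P, \<dots>, T\<^sup>-\<^sup>(\<^sup>n\<^sup>-\<^sup>1\<^sup>)P\<close>; empty cells are discarded.\<close>
definition refined_partition :: "'a measure \<Rightarrow> ('a \<Rightarrow> 'a) \<Rightarrow> 'a set set \<Rightarrow> nat \<Rightarrow> 'a set set" where
  "refined_partition M T P n =
     {space M \<inter> (\<Inter>i<n. (T ^^ i) -` c i) | c. \<forall>i<n. c i \<in> P} - {{}}"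

text \<open>For a \<open>T\<close>-invariant probability measure the limit exists, by subadditivity.\<close>
definition entropy_of_partition :: "'a measure \<Rightarrow> ('a \<Rightarrow> 'a) \<Rightarrow> 'a set set \<Rightarrow> real" where
  "entropy_of_partition M T P = lim (\<lambda>n. partition_entropy M (refined_partition M T P n) / real n)"

definition KS_entropy :: "'a measure \<Rightarrow> ('a \<Rightarrow> 'a) \<Rightarrow> ereal" where
  "KS_entropy M T =
     (SUP P\<in>{P. finite_measurable_partition M P}. ereal (entropy_of_partition M T P))"

definition invariant_prob :: "(circle \<Rightarrow> circle) \<Rightarrow> circle measure \<Rightarrow> bool" where
  "invariant_prob T \<mu> \<longleftrightarrow>
     prob_space \<mu> \<and> sets \<mu> = sets borel \<and> T \<in> measurable \<mu> \<mu> \<and> distr \<mu> \<mu> T = \<mu>"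

definition free_energy :: "(circle \<Rightarrow> circle) \<Rightarrow> (circle \<Rightarrow> real) \<Rightarrow> circle measure \<Rightarrow> ereal" where
  "free_energy T A \<mu> = KS_entropy \<mu> T + ereal (\<integral>x. A x \<partial>\<mu>)"

definition equilibrium_state :: "(circle \<Rightarrow> circle) \<Rightarrow> (circle \<Rightarrow> real) \<Rightarrow> circle measure \<Rightarrow> bool" where
  "equilibrium_state T A \<mu> \<longleftrightarrow> invariant_prob T \<mu> \<and>
     (\<forall>\<nu>. invariant_prob T \<nu> \<longrightarrow> free_energy T A \<nu> \<le> free_energy T A \<mu>)"

end

theory Submission
  imports Defs "HOL-Real_Asymp.Real_Asymp"
begin

text \<open>
  In all three situations the inverse branches of \<open>T\<close> pull back to a nonexpanding map \<open>G\<close> of the line,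
  and the potential is \<^emph>\<open>flat\<close>: along inverse branches,
  \<open>\<bar>A y - A y'\<bar> \<le> C (d(T y, T y')\<^sup>\<alpha> - d(y, y')\<^sup>\<alpha>)\<close>. These bounds telescope, so that the transfer
  operator preserves the cone \<open>f x \<le> f y exp (D d(x, y)\<^sup>\<alpha>)\<close> for every \<open>D \<ge> C\<close>. Growth rates of the
  iterates of 1, a limes superior and a monotone limit give a positive eigenfunction in this cone.
  After normalization by an eigenfunction, the operator \<open>Q\<close> with weight \<open>g\<close> has equicontinuous
  iterates, and \<open>Q\<^sup>n f\<close> converges to a constant; hence the \<open>Q\<close>-invariant probability exists and is
  unique, and it is the RPF measure.

  For every positive continuous weight \<open>w\<close> with fibre sums at most 1, every invariant measure \<open>\<nu>\<close>
  satisfies \<open>h(\<nu>) \<le> - \<integral> ln w d\<nu>\<close>, and equality holds for \<open>w = g\<close> and the RPF measure. Since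
  \<open>ln g\<close> is \<open>A\<close> up to a coboundary and a constant, the RPF measure is an equilibrium state; applying
  the bound to perturbations of \<open>g\<close> shows that every equilibrium state is \<open>Q\<close>-invariant.
\<close>

section \<open>Entropy of a finite partition\<close>

text \<open>At a neutral fixed point the inverse branches have no uniform contraction rate, so
  Holder constants do not shrink geometrically under the transfer operator. Flatness replaces this:
  a branch may distort \<open>A\<close> only in proportion to the loss of
  \<open>d powr \<alpha>\<close> along it. In the examples this loss is computed: if an interval of
  length \<open>l\<close> grows by at least \<open>l / 2 * \<eta>\<close> under the lift, the loss
  is at least \<open>\<alpha> / 4 * l powr \<alpha> * \<eta>\<close>, and the potentials have
  oscillation bounded by a multiple of this. In the third situation the derivative is bounded only
  where it exists; since the lift is monotone, differentiation almost everywhere turns this into a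
  bound for slopes.

  The upper entropy bound is shown for all continuous weights, because the perturbations of
  \<open>g\<close> are merely continuous. Indicators of cells cannot be compared along nearby
  orbits; continuous kernels that imitate them can. The lower bound asks for a single partition,
  fine enough for \<open>T\<close> to be injective and \<open>g\<close> nearly constant near each
  cell.\<close>

lemma gibbs_inequality:
  fixes p q :: "'a \<Rightarrow> real"
  assumes "finite I" "\<And>i. i \<in> I \<Longrightarrow> 0 \<le> p i" "sum p I = 1"
    and "\<And>i. i \<in> I \<Longrightarrow> 0 \<le> q i" "sum q I \<le> 1" "\<And>i. i \<in> I \<Longrightarrow> 0 < p i \<Longrightarrow> 0 < q i"
  shows "- (\<Sum>i\<in>I. p i * ln (p i)) \<le> - (\<Sum>i\<in>I. p i * ln (q i))"
proof -
  have "p i * ln (q i) - p i * ln (p i) \<le> q i - p i" if "i \<in> I" for i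
  proof (cases "p i = 0")
    case True
    then show ?thesis using assms(4)[OF that] by simp
  next
    case False
    then have pos: "0 < p i" "0 < q i"
      using assms(2)[OF that] assms(6)[OF that] by auto
    have "p i * (ln (q i / p i)) \<le> p i * (q i / p i - 1)"
      using pos by (intro mult_left_mono ln_le_minus_one) auto
    then show ?thesis
      using pos by (simp add: ln_div algebra_simps)
  qed
  then have "(\<Sum>i\<in>I. p i * ln (q i) - p i * ln (p i)) \<le> (\<Sum>i\<in>I. q i - p i)"
    by (rule sum_mono)
  then show ?thesis
    using assms(3,5) by (simp add: sum_subtractf)
qed

lemma fekete:
  fixes a :: "nat \<Rightarrow> real"
  assumes sub: "\<And>m n. a (m + n) \<le> a m + a n" and nonneg: "\<And>n. 0 \<le> a n"
  shows "convergent (\<lambda>n. a n / n)"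
proof -
  define L where "L = (INF n\<in>{1..}. a n / real n)"
  have bdd: "bdd_below ((\<lambda>n. a n / real n) ` {1..})"
    by (rule bdd_belowI[of _ 0]) (auto simp: nonneg)
  have lower: "L \<le> a n / n" if "n \<ge> 1" for n
    unfolding L_def using that by (intro cINF_lower bdd) auto
  have mult: "a (k * m) \<le> k * a m" if "k \<ge> 1" for k m
    using that
  proof (induction k rule: dec_induct)
    case (step k)
    then show ?case using sub[of m "k * m"] by (simp add: algebra_simps)
  qed simp
  have "(\<lambda>n. a n / n) \<longlonglongrightarrow> L"
  proof (rule LIMSEQ_I)
    fix e :: real assume "e > 0"
    have "\<exists>n\<in>{1..}. a n / n < L + e/2"
      using \<open>e > 0\<close> bdd unfolding L_def by (subst cINF_less_iff[symmetric]) auto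
    then obtain m where m: "m \<ge> 1" "a m / m < L + e/2" by auto
    \<comment> \<open>Division with remainder by an \<open>m\<close> that nearly attains the
      infimum: the remainder block costs at most \<open>B\<close>, which disappears after division
      by \<open>n\<close>.\<close>
    define B where "B = (\<Sum>i<m. a i)"
    have B: "a i \<le> B" if "i < m" for i
      unfolding B_def using that by (intro member_le_sum) (auto simp: nonneg)
    have B0: "0 \<le> B" unfolding B_def by (intro sum_nonneg nonneg)
    obtain N0 :: nat where N0: "real N0 > 2 * B / e" using reals_Archimedean2 by blast
    show "\<exists>no. \<forall>n\<ge>no. norm (a n / real n - L) < e"
    proof (intro exI allI impI)
      fix n assume n: "n \<ge> max (N0 + 1) m"
      have "n div m \<ge> 1" using n m by (simp add: Suc_leI div_greater_zero_iff)
      have "a n = a (n div m * m + n mod m)" by simp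
      also have "\<dots> \<le> a (n div m * m) + a (n mod m)" by (rule sub)
      also have "\<dots> \<le> (n div m) * a m + B"
        using mult[OF \<open>n div m \<ge> 1\<close>] B[of "n mod m"] m by (intro add_mono) auto
      finally have 1: "a n \<le> (n div m) * a m + B" .
      have "real (n div m) * a m = real (n div m * m) * (a m / m)" using m by simp
      also have "\<dots> \<le> real n * (a m / m)"
        by (intro mult_right_mono) (auto simp: nonneg simp del: of_nat_mult)
      finally have "a n \<le> n * (a m / m) + B" using 1 by simp
      then have "a n / n \<le> a m / m + B / n"
        using n by (simp add: field_simps)
      moreover have "B / n < e / 2"
      proof -
        have "2 * B / e < real n" using N0 n by linarith
        then show ?thesis using \<open>e > 0\<close> n by (simp add: field_simps)
      qed
      ultimately have "a n / n < L + e" using m by linarith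
      moreover have "L \<le> a n / n" using lower n by auto
      ultimately show "norm (a n / real n - L) < e" by simp
    qed
  qed
  then show ?thesis by (rule convergentI)
qed

section \<open>Itineraries and block entropies of an invariant measure\<close>

locale partitioned_system = prob_space M for M :: "'a measure" +
  fixes T :: "'a \<Rightarrow> 'a" and P :: "'a set set"
  assumes T_measurable [measurable]: "T \<in> measurable M M"
    and invariant: "distr M M T = M"
    and partition: "finite_measurable_partition M P"
begin

definition cell :: "'a \<Rightarrow> 'a set" where
  "cell x = (THE c. c \<in> P \<and> x \<in> c)"

text \<open>The itinerary with the most recent letter first. A further time step is then a
  \<open>Cons\<close>, which the entropy bound matches by one more transfer operator applied on the
  outside.\<close>

primrec word :: "nat \<Rightarrow> 'a \<Rightarrow> 'a set list" where
  "word 0 x = []"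
| "word (Suc n) x = cell ((T ^^ n) x) # word n x"

definition words :: "nat \<Rightarrow> 'a set list set" where
  "words n = {ws. set ws \<subseteq> P \<and> length ws = n}"

definition cylinder :: "nat \<Rightarrow> 'a set list \<Rightarrow> 'a set" where
  "cylinder n ws = {x \<in> space M. word n x = ws}"

text \<open>Summation runs over all words rather than over the nonempty cells of the refinement.
  Words with empty cylinder contribute \<open>0\<close>, and the index set depends on nothing but
  \<open>P\<close> and \<open>n\<close>.\<close>

definition block_entropy :: "nat \<Rightarrow> real" where
  "block_entropy n = - (\<Sum>ws\<in>words n. prob (cylinder n ws) * ln (prob (cylinder n ws)))"

lemma finite_P: "finite P" and P_sets: "c \<in> P \<Longrightarrow> c \<in> sets M"
  and P_part: "partition_on (space M) P"
  using partition by (auto simp: finite_measurable_partition_def)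

lemma cell_eqI:
  assumes "c \<in> P" "x \<in> c"
  shows "cell x = c"
  unfolding cell_def
proof (rule the_equality)
  show "c' = c" if "c' \<in> P \<and> x \<in> c'" for c'
    using that assms P_part by (auto simp: partition_on_def disjoint_def)
qed (use assms in auto)

lemma cell:
  assumes "x \<in> space M"
  shows "cell x \<in> P" "x \<in> cell x"
proof -
  obtain c where "c \<in> P" "x \<in> c" using assms P_part by (auto simp: partition_on_def)
  then show "cell x \<in> P" "x \<in> cell x" using cell_eqI by auto
qed

lemma funpow_measurable [measurable]: "T ^^ n \<in> measurable M M"
  by (induction n) auto

lemma funpow_space: "x \<in> space M \<Longrightarrow> (T ^^ n) x \<in> space M"
  using measurable_space[OF funpow_measurable] .

lemma invariant_funpow: "distr M M (T ^^ n) = M"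
proof (induction n)
  case 0
  then show ?case by (simp add: distr_id2 id_def)
next
  case (Suc n)
  have "distr M M (T ^^ Suc n) = distr (distr M M (T ^^ n)) M T"
    by (subst distr_distr) (auto simp: o_def)
  then show ?case using Suc invariant by (simp add: o_def)
qed

lemma prob_vimage_funpow:
  assumes "E \<in> sets M"
  shows "prob ((T ^^ n) -` E \<inter> space M) = prob E"
  using measure_distr[OF funpow_measurable assms, of n] by (simp add: invariant_funpow)

lemma integral_funpow:
  fixes f :: "'a \<Rightarrow> real"
  assumes "f \<in> borel_measurable M"
  shows "(\<integral>x. f ((T ^^ n) x) \<partial>M) = (\<integral>x. f x \<partial>M)"
  using integral_distr[OF funpow_measurable assms, of n] by (simp add: invariant_funpow)

lemma length_word [simp]: "length (word n x) = n"
  by (induction n) auto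

lemma word_in_words: "x \<in> space M \<Longrightarrow> word n x \<in> words n"
  by (induction n) (auto simp: words_def cell(1) funpow_space)

lemma finite_words: "finite (words n)"
  unfolding words_def using finite_lists_length_eq[OF finite_P] by simp

lemma cylinder_0: "cylinder 0 ws = (if ws = [] then space M else {})"
  by (auto simp: cylinder_def)

lemma cylinder_Suc:
  assumes "c \<in> P"
  shows "cylinder (Suc n) (c # ws) = {x \<in> space M. (T ^^ n) x \<in> c} \<inter> cylinder n ws"
  using assms cell_eqI cell(2)[OF funpow_space] by (auto simp: cylinder_def)

lemma words_Suc: "words (Suc n) = (\<lambda>(c, ws). c # ws) ` (P \<times> words n)"
  by (auto simp: words_def length_Suc_conv image_iff)

lemma sets_cylinder:
  assumes "ws \<in> words n"
  shows "cylinder n ws \<in> sets M"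
  using assms
proof (induction n arbitrary: ws)
  case 0
  then show ?case by (auto simp: cylinder_0)
next
  case (Suc n)
  then obtain c vs where [simp]: "ws = c # vs" and c: "c \<in> P" "vs \<in> words n"
    by (auto simp: words_Suc)
  have "{x \<in> space M. (T ^^ n) x \<in> c} = (T ^^ n) -` c \<inter> space M" by auto
  then have "{x \<in> space M. (T ^^ n) x \<in> c} \<in> sets M"
    using measurable_sets[OF funpow_measurable P_sets[OF c(1)]] by simp
  then show ?case using Suc.IH[OF c(2)] by (simp add: cylinder_Suc[OF c(1)])
qed

lemma word_sum:
  fixes \<phi> :: "'a set list \<Rightarrow> real"
  assumes "x \<in> space M"
  shows "\<phi> (word n x) = (\<Sum>ws\<in>words n. \<phi> ws * indicator (cylinder n ws) x)"
proof -
  have "(\<Sum>ws\<in>words n. \<phi> ws * indicator (cylinder n ws) x)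
      = (\<Sum>ws\<in>words n. if ws = word n x then \<phi> ws else 0)"
    using assms by (intro sum.cong) (auto simp: cylinder_def)
  also have "\<dots> = \<phi> (word n x)"
    using word_in_words[OF assms, of n] finite_words by simp
  finally show ?thesis by simp
qed

text \<open>Functions of the itinerary are simple functions, so the value of the integral,
  measurability and integrability all come from \<open>word_sum\<close>.\<close>

lemma integral_word:
  fixes \<phi> :: "'a set list \<Rightarrow> real"
  shows "(\<integral>x. \<phi> (word n x) \<partial>M) = (\<Sum>ws\<in>words n. prob (cylinder n ws) * \<phi> ws)"
    and "(\<lambda>x. \<phi> (word n x)) \<in> borel_measurable M"
    and "integrable M (\<lambda>x. \<phi> (word n x))"
proof -
  note [measurable] = sets_cylinder
  have eq: "x \<in> space M \<Longrightarrow> \<phi> (word n x) = (\<Sum>ws\<in>words n. \<phi> ws * indicator (cylinder n ws) x)" for x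
    by (rule word_sum)
  have int: "integrable M (\<lambda>x. \<Sum>ws\<in>words n. \<phi> ws * indicator (cylinder n ws) x)"
    by (intro Bochner_Integration.integrable_sum integrable_mult_right integrable_real_indicator)
       (auto simp: sets_cylinder emeasure_eq_measure)
  have "(\<integral>x. \<phi> (word n x) \<partial>M) = (\<integral>x. (\<Sum>ws\<in>words n. \<phi> ws * indicator (cylinder n ws) x) \<partial>M)"
    by (rule Bochner_Integration.integral_cong) (use eq in auto)
  also have "\<dots> = (\<Sum>ws\<in>words n. \<integral>x. \<phi> ws * indicator (cylinder n ws) x \<partial>M)"
    by (intro Bochner_Integration.integral_sum integrable_mult_right integrable_real_indicator)
       (auto simp: sets_cylinder emeasure_eq_measure)
  also have "\<dots> = (\<Sum>ws\<in>words n. prob (cylinder n ws) * \<phi> ws)"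
    by (intro sum.cong) (auto simp: sets_cylinder)
  finally show "(\<integral>x. \<phi> (word n x) \<partial>M) = (\<Sum>ws\<in>words n. prob (cylinder n ws) * \<phi> ws)" .
  show "(\<lambda>x. \<phi> (word n x)) \<in> borel_measurable M"
    using borel_measurable_integrable[OF int] by (subst measurable_cong[OF eq]) auto
  show "integrable M (\<lambda>x. \<phi> (word n x))"
    using int by (subst Bochner_Integration.integrable_cong[OF refl eq]) auto
qed

lemma cylinder_eq_Inter:
  assumes "\<forall>i<n. c i \<in> P"
  shows "cylinder n (map c (rev [0..<n])) = space M \<inter> (\<Inter>i<n. (T ^^ i) -` c i)"
  using assms
proof (induction n)
  case 0
  then show ?case by (auto simp: cylinder_0)
next
  case (Suc n)
  then have "cylinder (Suc n) (map c (rev [0..<Suc n]))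
     = {x \<in> space M. (T ^^ n) x \<in> c n} \<inter> (space M \<inter> (\<Inter>i<n. (T ^^ i) -` c i))"
    by (simp add: cylinder_Suc)
  also have "\<dots> = space M \<inter> (\<Inter>i<Suc n. (T ^^ i) -` c i)"
    by (auto simp: lessThan_Suc)
  finally show ?case .
qed

lemma refined_partition_eq: "refined_partition M T P n = cylinder n ` words n - {{}}"
proof -
  have "E \<in> cylinder n ` words n" if "\<forall>i<n. c i \<in> P"
    "E = space M \<inter> (\<Inter>i<n. (T ^^ i) -` c i)" for E c
    by (rule image_eqI[of _ _ "map c (rev [0..<n])"])
       (use that cylinder_eq_Inter[of n c] in \<open>auto simp: words_def\<close>)
  moreover have "\<exists>c. cylinder n ws = space M \<inter> (\<Inter>i<n. (T ^^ i) -` c i) \<and> (\<forall>i<n. c i \<in> P)"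
    if ws: "ws \<in> words n" for ws
  proof -
    define c where "c i = rev ws ! i" for i
    have "rev ws ! i \<in> set ws" if "i < n" for i
      using that ws by (metis (mono_tags, lifting) length_rev mem_Collect_eq nth_mem set_rev words_def)
    then have c: "\<forall>i<n. c i \<in> P"
      using ws by (auto simp: words_def c_def)
    have "map c [0..<n] = rev ws"
      using ws by (intro nth_equalityI) (auto simp: words_def c_def)
    then have "map c (rev [0..<n]) = ws" by (metis rev_map rev_rev_ident)
    then show ?thesis using cylinder_eq_Inter[OF c] c by (intro exI[of _ c]) simp
  qed
  ultimately have "{space M \<inter> (\<Inter>i<n. (T ^^ i) -` c i) | c. \<forall>i<n. c i \<in> P} = cylinder n ` words n"
    by (intro subset_antisym subsetI) (blast, blast)
  then show ?thesis unfolding refined_partition_def by simp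
qed

lemma partition_entropy_refined:
  "partition_entropy M (refined_partition M T P n) = block_entropy n"
proof -
  define W where "W = {ws \<in> words n. cylinder n ws \<noteq> {}}"
  have ref: "refined_partition M T P n = cylinder n ` W"
    unfolding refined_partition_eq W_def by auto
  have inj: "inj_on (cylinder n) W"
    by (rule inj_onI) (auto simp: W_def cylinder_def)
  have "(\<Sum>ws\<in>words n. prob (cylinder n ws) * ln (prob (cylinder n ws)))
      = (\<Sum>ws\<in>W. prob (cylinder n ws) * ln (prob (cylinder n ws)))"
    by (rule sum.mono_neutral_right) (auto simp: W_def finite_words)
  then show ?thesis
    unfolding partition_entropy_def block_entropy_def ref
    by (simp add: sum.reindex[OF inj])
qed

lemma sum_prob_cylinder: "(\<Sum>ws\<in>words n. prob (cylinder n ws)) = 1"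
  using integral_word(1)[of "\<lambda>_. 1" n] by (simp add: prob_space)

lemma block_entropy_integral:
  "block_entropy n = - (\<integral>x. ln (prob (cylinder n (word n x))) \<partial>M)"
  by (simp add: block_entropy_def integral_word(1)[of "\<lambda>ws. ln (prob (cylinder n ws))" n])

text \<open>Every subprobability on words bounds the entropy from above, by Gibbs' inequality. Two
  choices matter later: the product of two block distributions (subadditivity) and iterated weighted
  transfers evaluated at one point (the entropy bound for weights).\<close>

lemma block_entropy_le:
  assumes "\<And>ws. ws \<in> words n \<Longrightarrow> 0 \<le> q ws" "sum q (words n) \<le> 1"
    and "\<And>ws. ws \<in> words n \<Longrightarrow> 0 < prob (cylinder n ws) \<Longrightarrow> 0 < q ws"
  shows "block_entropy n \<le> - (\<integral>x. ln (q (word n x)) \<partial>M)"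
  unfolding block_entropy_def integral_word(1)[of "\<lambda>ws. ln (q ws)" n]
  by (rule gibbs_inequality) (use assms finite_words sum_prob_cylinder in auto)

lemma block_entropy_nonneg: "0 \<le> block_entropy n"
proof -
  have "prob (cylinder n ws) * ln (prob (cylinder n ws)) \<le> 0" for ws
    by (cases "prob (cylinder n ws) = 0")
       (auto simp: mult_le_0_iff measure_nonneg less_le)
  then show ?thesis
    unfolding block_entropy_def by (simp add: sum_nonpos)
qed

lemma word_add: "word (n + m) x = word m ((T ^^ n) x) @ word n x"
proof (induction m)
  case (Suc m)
  have "(T ^^ (n + m)) x = (T ^^ m) ((T ^^ n) x)"
    by (metis add.commute comp_apply funpow_add)
  then show ?case using Suc by simp
qed simp

lemma cylinder_add:
  assumes "length vs = m"
  shows "cylinder (n + m) (vs @ ws) = ((T ^^ n) -` cylinder m vs \<inter> space M) \<inter> cylinder n ws"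
  using assms by (auto simp: cylinder_def word_add funpow_space)

lemma words_add: "words (n + m) = (\<lambda>(vs, ws). vs @ ws) ` (words m \<times> words n)"
proof -
  have "ws \<in> (\<lambda>(vs, ws). vs @ ws) ` (words m \<times> words n)" if "ws \<in> words (n + m)" for ws
    using that set_take_subset[of m ws] set_drop_subset[of m ws]
    by (intro image_eqI[of _ _ "(take m ws, drop m ws)"]) (auto simp: words_def)
  then show ?thesis by (auto simp: words_def)
qed

text \<open>Gibbs' inequality against the product of the two block distributions. Its logarithm
  splits into two terms, and invariance of the measure removes the shift by \<open>n\<close> in one
  of them.\<close>

lemma block_entropy_subadditive: "block_entropy (n + m) \<le> block_entropy n + block_entropy m"
proof -
  let ?p = "\<lambda>n ws. prob (cylinder n ws)"
  define q where "q ws = ?p m (take m ws) * ?p n (drop m ws)" for ws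
  have inj: "inj_on (\<lambda>(vs, ws). vs @ ws) (words m \<times> words n)"
    by (auto simp: inj_on_def words_def)
  have pos: "0 < ?p m (take m ws) \<and> 0 < ?p n (drop m ws)"
    if ws_in: "ws \<in> words (n + m)" and p_pos: "0 < ?p (n + m) ws" for ws
  proof -
    obtain us vs where ws: "ws = us @ vs" "us \<in> words m" "vs \<in> words n"
      using ws_in unfolding words_add by auto
    then have len: "length us = m" by (auto simp: words_def)
    have "?p (n + m) ws \<le> ?p n vs"
      unfolding ws(1) cylinder_add[OF len] using ws by (intro finite_measure_mono) (auto simp: sets_cylinder)
    moreover have "?p (n + m) ws \<le> prob ((T ^^ n) -` cylinder m us \<inter> space M)"
      unfolding ws(1) cylinder_add[OF len] using ws
      by (intro finite_measure_mono measurable_sets[OF funpow_measurable]) (auto simp: sets_cylinder)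
    ultimately show ?thesis
      using p_pos ws len by (simp add: prob_vimage_funpow sets_cylinder)
  qed
  have "sum q (words (n + m)) = (\<Sum>(us, vs)\<in>words m \<times> words n. ?p m us * ?p n vs)"
    unfolding words_add by (subst sum.reindex[OF inj]) (auto simp: q_def words_def intro!: sum.cong)
  also have "\<dots> = (\<Sum>us\<in>words m. ?p m us) * (\<Sum>vs\<in>words n. ?p n vs)"
    by (simp add: sum_product sum.cartesian_product)
  finally have "sum q (words (n + m)) = 1" by (simp add: sum_prob_cylinder)
  then have "block_entropy (n + m) \<le> - (\<integral>x. ln (q (word (n + m) x)) \<partial>M)"
    by (intro block_entropy_le) (use pos in \<open>auto simp: q_def\<close>)
  also have "\<dots> = - (\<Sum>ws\<in>words (n + m). ?p (n + m) ws * ln (q ws))"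
    by (simp add: integral_word(1)[of "\<lambda>ws. ln (q ws)" "n + m"])
  also have "\<dots> = - (\<Sum>ws\<in>words (n + m). ?p (n + m) ws * (ln (?p m (take m ws)) + ln (?p n (drop m ws))))"
  proof -
    have "?p (n + m) ws * ln (q ws) = ?p (n + m) ws * (ln (?p m (take m ws)) + ln (?p n (drop m ws)))"
      if "ws \<in> words (n + m)" for ws
      using pos[OF that] by (cases "?p (n + m) ws = 0")
        (auto simp: q_def ln_mult zero_less_measure_iff less_le)
    then show ?thesis by (intro arg_cong[of _ _ uminus] sum.cong refl)
  qed
  also have "\<dots> = - (\<integral>x. ln (?p m (take m (word (n + m) x))) + ln (?p n (drop m (word (n + m) x))) \<partial>M)"
    by (simp add: integral_word(1)[of "\<lambda>ws. ln (?p m (take m ws)) + ln (?p n (drop m ws))" "n + m"])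
  also have "\<dots> = - (\<integral>x. ln (?p m (word m ((T ^^ n) x))) + ln (?p n (word n x)) \<partial>M)"
    by (simp add: word_add)
  also have "\<dots> = - ((\<integral>x. ln (?p m (word m ((T ^^ n) x))) \<partial>M) + (\<integral>x. ln (?p n (word n x)) \<partial>M))"
  proof -
    have "integrable (distr M M (T ^^ n)) (\<lambda>x. ln (?p m (word m x)))"
      unfolding invariant_funpow by (rule integral_word(3))
    then have "integrable M (\<lambda>x. ln (?p m (word m ((T ^^ n) x))))"
      by (subst (asm) integrable_distr_eq) (auto intro: integral_word(2))
    moreover have "integrable M (\<lambda>x. ln (?p n (word n x)))"
      by (rule integral_word(3))
    ultimately show ?thesis by simp
  qed
  also have "\<dots> = block_entropy m + block_entropy n"
    using integral_funpow[OF integral_word(2)[of "\<lambda>ws. ln (?p m ws)" m], of n]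
    by (simp add: block_entropy_integral)
  finally show ?thesis by simp
qed

lemma entropy_of_partition_tendsto:
  "(\<lambda>n. block_entropy n / n) \<longlonglongrightarrow> entropy_of_partition M T P"
proof -
  have "convergent (\<lambda>n. block_entropy n / n)"
    by (rule fekete) (auto simp: block_entropy_subadditive block_entropy_nonneg)
  then show ?thesis
    by (simp add: entropy_of_partition_def partition_entropy_refined convergent_LIMSEQ_iff)
qed

lemma entropy_of_partition_le:
  fixes a B :: real
  assumes "\<And>n. block_entropy n \<le> real n * a + B"
  shows "entropy_of_partition M T P \<le> a"
proof (rule LIMSEQ_le[OF entropy_of_partition_tendsto])
  show "(\<lambda>n. a + B / real n) \<longlonglongrightarrow> a"
    using tendsto_add[OF tendsto_const lim_const_over_n[of B], of a] by simp
  have "block_entropy n / n \<le> a + B / real n" if "n \<ge> 1" for n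
    using assms[of n] that by (simp add: field_simps)
  then show "\<exists>N. \<forall>n\<ge>N. block_entropy n / n \<le> a + B / real n" by blast
qed

lemma le_entropy_of_partition:
  fixes a :: real
  assumes "\<And>n. real n * a \<le> block_entropy n"
  shows "a \<le> entropy_of_partition M T P"
proof (rule LIMSEQ_le[OF tendsto_const entropy_of_partition_tendsto])
  have "a \<le> block_entropy n / n" if "n \<ge> 1" for n
    using assms[of n] that by (simp add: field_simps)
  then show "\<exists>N. \<forall>n\<ge>N. a \<le> block_entropy n / n" by blast
qed

end

section \<open>The circle\<close>

lemma dist_to_circle_le: "dist (to_circle s) (to_circle t) \<le> \<bar>s - t\<bar>"
proof -
  have *: "min \<bar>frac s - frac t\<bar> (1 - \<bar>frac s - frac t\<bar>) \<le> \<bar>s - t\<bar>"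
  proof (cases "\<lfloor>s\<rfloor> = \<lfloor>t\<rfloor>")
    case True
    then show ?thesis by (simp add: frac_def)
  next
    case False
    then have "\<lfloor>s\<rfloor> - \<lfloor>t\<rfloor> \<ge> 1 \<or> \<lfloor>t\<rfloor> - \<lfloor>s\<rfloor> \<ge> 1" by linarith
    then have "of_int \<lfloor>s\<rfloor> - of_int \<lfloor>t\<rfloor> \<ge> (1::real) \<or> of_int \<lfloor>t\<rfloor> - of_int \<lfloor>s\<rfloor> \<ge> (1::real)"
      by linarith
    moreover have "s = of_int \<lfloor>s\<rfloor> + frac s" "t = of_int \<lfloor>t\<rfloor> + frac t" by (simp_all add: frac_def)
    ultimately show ?thesis
      using frac_lt_1[of s] frac_lt_1[of t] frac_ge_0[of s] frac_ge_0[of t]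
      by (auto simp: min_def abs_if split: if_splits)
  qed
  then show ?thesis by (simp add: dist_circle_def)
qed

lemma continuous_on_to_circle [continuous_intros]:
  assumes "continuous_on S f"
  shows "continuous_on S (\<lambda>x. to_circle (f x))"
proof -
  have "continuous_on UNIV to_circle"
    unfolding continuous_on_iff
    by (metis dist_real_def dist_to_circle_le order_le_less_trans)
  then show ?thesis
    using continuous_on_compose2[OF _ assms, of UNIV to_circle] by auto
qed

lemma to_circle_measurable [measurable]: "to_circle \<in> borel_measurable borel"
  by (intro borel_measurable_continuous_onI continuous_intros)

lemma to_circle_image: "to_circle ` {0..1} = UNIV"
  by (metis UNIV_eq_I atLeastAtMost_iff coord_bounds imageI less_imp_le to_circle_coord)

lemma compact_circle: "compact (UNIV :: circle set)"
  unfolding to_circle_image[symmetric]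
  by (intro compact_continuous_image continuous_intros) auto

lemma to_circle_add_int [simp]: "to_circle (t + of_int n) = to_circle t"
  by (simp add: to_circle_eq_iff)

lemma dist_circle_le_half: "dist (x::circle) y \<le> 1/2"
  by (auto simp: dist_circle_def min_def)

text \<open>Moves estimates from the circle to the line: given any lift \<open>t\<close> of one
  point, the other point has a lift at exactly the circle distance from \<open>t\<close>.\<close>

lemma lift_near:
  obtains s where "to_circle s = y" "\<bar>t - s\<bar> = dist (to_circle t) y"
proof -
  define d where "d = coord y - frac t"
  have b: "\<bar>d\<bar> < 1"
    using coord_bounds[of y] frac_lt_1[of t] frac_ge_0[of t] unfolding d_def by linarith
  \<comment> \<open>Selects the translate along the shorter of the two arcs; a tie is resolved by
    \<open>0\<close>.\<close>
  define k :: int where "k = (if \<bar>d\<bar> \<le> 1 - \<bar>d\<bar> then 0 else if d > 0 then -1 else 1)"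
  define s where "s = coord y + of_int (\<lfloor>t\<rfloor> + k)"
  have "to_circle s = y" unfolding s_def by (simp only: to_circle_add_int to_circle_coord)
  moreover have "s - t = d + of_int k" by (simp add: s_def d_def frac_def)
  then have "\<bar>t - s\<bar> = dist (to_circle t) y"
    using b by (auto simp: dist_circle_def k_def d_def min_def abs_if split: if_splits)
  ultimately show ?thesis using that by blast
qed

text \<open>\<open>coord\<close> jumps at the origin, but its sublevel sets are images of the
  compact sets \<open>{0..a}\<close> under a continuous map, hence closed.\<close>

lemma coord_measurable [measurable]: "coord \<in> borel_measurable borel"
proof (rule borel_measurableI_le)
  fix a :: real
  consider "a < 0" | "a \<ge> 1" | "0 \<le> a" "a < 1" by linarith
  then show "{x \<in> space borel. coord x \<le> a} \<in> sets borel"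
  proof cases
    case 1
    then have "{x \<in> space borel. coord x \<le> a} = {}" using coord_bounds(1) by (auto simp: not_le intro: less_le_trans)
    then show ?thesis by simp
  next
    case 2
    then have "{x \<in> space borel. coord x \<le> a} = UNIV" using coord_bounds(2) by (auto intro: less_imp_le less_le_trans)
    then show ?thesis by simp
  next
    case 3
    have "x \<in> to_circle ` {0..a}" if "coord x \<le> a" for x
      using that coord_bounds[of x] by (intro image_eqI[of _ _ "coord x"]) auto
    moreover have "coord (to_circle t) \<le> a" if "0 \<le> t" "t \<le> a" for t
      using that 3 frac_eq[of t] by simp
    ultimately have "{x \<in> space borel. coord x \<le> a} = to_circle ` {0..a}" by auto
    moreover have "compact (to_circle ` {0..a})"
      by (intro compact_continuous_image continuous_intros) auto
    then have "closed (to_circle ` {0..a})" by (rule compact_imp_closed)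
    ultimately show ?thesis by simp
  qed
qed

text \<open>The measure is pushed to the line by the measurable \<open>coord\<close>, where inner
  regularity is known; the compact set found there returns through the continuous
  \<open>to_circle\<close>.\<close>

lemma circle_inner_regular:
  fixes \<mu> :: "circle measure"
  assumes "finite_measure \<mu>" and sets: "sets \<mu> = sets borel" and E: "E \<in> sets borel" and e: "e > 0"
  obtains K where "compact K" "K \<subseteq> E" "measure \<mu> (E - K) < e"
proof -
  interpret finite_measure \<mu> by fact
  have [measurable_cong, simp]: "sets \<mu> = sets borel" by (rule sets)
  define \<nu> where "\<nu> = distr \<mu> borel coord"
  interpret \<nu>: finite_measure \<nu> unfolding \<nu>_def by (rule finite_measure_distr) simp
  define E' where "E' = to_circle -` E \<inter> {0..<1}"
  have "to_circle -` E \<inter> space borel \<in> sets borel"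
    using measurable_sets[OF to_circle_measurable E] .
  then have E': "E' \<in> sets borel" by (auto simp: E'_def)
  have SUP: "emeasure \<nu> E' = (SUP K \<in> {K. K \<subseteq> E' \<and> compact K}. emeasure \<nu> K)"
    by (rule inner_regular) (use E' \<nu>.emeasure_finite in \<open>auto simp: \<nu>_def\<close>)
  have "\<exists>K. K \<subseteq> E' \<and> compact K \<and> measure \<nu> E' < measure \<nu> K + e"
  proof (cases "measure \<nu> E' = 0")
    case True
    then show ?thesis using e by (intro exI[of _ "{}"]) auto
  next
    case False
    then have "measure \<nu> E' > 0" by (simp add: zero_less_measure_iff)
    then have "ennreal (measure \<nu> E' - e) < emeasure \<nu> E'"
      using e by (simp add: \<nu>.emeasure_eq_measure ennreal_lessI)
    then obtain K where "K \<subseteq> E'" "compact K" "ennreal (measure \<nu> E' - e) < emeasure \<nu> K"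
      unfolding SUP less_SUP_iff by auto
    moreover have "measure \<nu> E' - e < measure \<nu> K"
    proof (rule ccontr)
      assume "\<not> measure \<nu> E' - e < measure \<nu> K"
      then have "emeasure \<nu> K \<le> ennreal (measure \<nu> E' - e)"
        by (simp add: \<nu>.emeasure_eq_measure ennreal_leI)
      with \<open>ennreal (measure \<nu> E' - e) < emeasure \<nu> K\<close> show False by (simp add: leD)
    qed
    ultimately show ?thesis by (intro exI[of _ K]) auto
  qed
  then obtain K where K: "K \<subseteq> E'" "compact K" "measure \<nu> E' < measure \<nu> K + e" by blast
  have "coord -` E' = E"
    using coord_bounds by (auto simp: E'_def)
  then have mE: "measure \<nu> E' = measure \<mu> E"
    using E' by (simp add: \<nu>_def measure_distr sets_eq_imp_space_eq[OF sets])
  have KE: "to_circle ` K \<subseteq> E" using K(1) by (auto simp: E'_def)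
  have comp: "compact (to_circle ` K)"
    by (intro compact_continuous_image continuous_intros K(2))
  have "measure \<nu> K = measure \<mu> (coord -` K)"
    using borel_compact[OF K(2)] by (simp add: \<nu>_def measure_distr sets_eq_imp_space_eq[OF sets])
  also have "\<dots> \<le> measure \<mu> (to_circle ` K)"
    using borel_compact[OF comp] by (intro finite_measure_mono) (auto simp: image_iff intro!: bexI[of _ "coord _"])
  finally have "measure \<mu> (E - to_circle ` K) < e"
    using finite_measure_Diff[of E "to_circle ` K"] E borel_compact[OF comp] KE K(3) mE by simp
  then show ?thesis using that comp KE by blast
qed

section \<open>Lipschitz functions on compact metric spaces\<close>

text \<open>The infimal convolution of \<open>f\<close> with a large multiple of the distance is
  Lipschitz and lies below \<open>f\<close>.\<close>

lemma lipschitz_approximation: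
  fixes f :: "'a::metric_space \<Rightarrow> real"
  assumes comp: "compact (UNIV :: 'a set)" and cont: "continuous_on UNIV f" and e: "e > 0"
  obtains g L where "\<And>x y. \<bar>g x - g y\<bar> \<le> L * dist x y" "\<And>x. \<bar>f x - g x\<bar> \<le> e"
proof -
  obtain M where M: "\<And>x. \<bar>f x\<bar> \<le> M"
    using compact_imp_bounded[OF compact_continuous_image[OF cont comp]]
    by (auto simp: bounded_iff)
  have "uniformly_continuous_on UNIV f"
    by (rule compact_uniformly_continuous[OF cont comp])
  then obtain d where d: "d > 0" "\<And>x y. dist x y < d \<Longrightarrow> \<bar>f x - f y\<bar> < e"
    using e unfolding uniformly_continuous_on_def dist_real_def by (metis UNIV_I)
  \<comment> \<open>With this slope the penalty for moving by at least \<open>d\<close> exceeds the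
    total oscillation of \<open>f\<close>, so only points within \<open>d\<close> matter, and there
    \<open>f\<close> varies by less than \<open>e\<close>.\<close>
  define n where "n = 2 * \<bar>M\<bar> / d"
  have n0: "n \<ge> 0" using d by (simp add: n_def)
  define g where "g x = (INF y. f y + n * dist x y)" for x
  have bdd: "bdd_below (range (\<lambda>y. f y + n * dist x y))" for x
  proof (rule bdd_belowI[of _ "- M"])
    fix z assume "z \<in> range (\<lambda>y. f y + n * dist x y)"
    then obtain y where "z = f y + n * dist x y" by auto
    then show "- M \<le> z" using M[of y] mult_nonneg_nonneg[OF n0 zero_le_dist[of x y]] by linarith
  qed
  have lip: "g x \<le> g z + n * dist x z" for x z
  proof -
    have "g x - n * dist x z \<le> f y + n * dist z y" for y
    proof -
      have "g x \<le> f y + n * dist x y" unfolding g_def by (intro cINF_lower bdd) auto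
      also have "\<dots> \<le> f y + n * (dist x z + dist z y)"
        using n0 by (intro add_left_mono mult_left_mono dist_triangle) auto
      finally show ?thesis by (simp add: algebra_simps)
    qed
    then have "g x - n * dist x z \<le> g z" unfolding g_def[of z] by (intro cINF_greatest) auto
    then show ?thesis by simp
  qed
  have "\<bar>g x - g y\<bar> \<le> n * dist x y" for x y
    using lip[of x y] lip[of y x] by (simp add: dist_commute abs_le_iff)
  moreover have "\<bar>f x - g x\<bar> \<le> e" for x
  proof -
    have "g x \<le> f x" unfolding g_def by (rule cINF_lower2[OF bdd, of x]) auto
    moreover have "f x - e \<le> f y + n * dist x y" for y
    proof (cases "dist x y < d")
      case True
      then show ?thesis using d(2)[of x y] mult_nonneg_nonneg[OF n0 zero_le_dist[of x y]] by linarith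
    next
      case False
      then have "n * d \<le> n * dist x y" using n0 by (intro mult_left_mono) auto
      then have "2 * \<bar>M\<bar> \<le> n * dist x y" using d by (simp add: n_def)
      then show ?thesis using M[of x] M[of y] e by linarith
    qed
    then have "f x - e \<le> g x" unfolding g_def by (intro cINF_greatest) auto
    ultimately show ?thesis by auto
  qed
  ultimately show ?thesis using that by blast
qed

text \<open>Closed sets form a generator stable under intersection, and the indicator of a closed
  set is the bounded pointwise limit of Lipschitz cutoffs of the distance to it.\<close>

lemma finite_measure_eqI_lipschitz:
  fixes M N :: "'a::metric_space measure"
  assumes "finite_measure M" "finite_measure N"
    and sets: "sets M = sets borel" "sets N = sets borel"
    and eq: "\<And>f L. (\<And>x y. \<bar>f x - f y\<bar> \<le> L * dist x y) \<Longrightarrow> (\<And>x. 0 \<le> f x \<and> f x \<le> (1::real))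
      \<Longrightarrow> integral\<^sup>L M f = integral\<^sup>L N f"
  shows "M = N"
proof (rule measure_eqI_generator_eq[of "Collect closed" UNIV M N "\<lambda>_. UNIV"])
  show "sets M = sigma_sets UNIV (Collect closed)" "sets N = sigma_sets UNIV (Collect closed)"
    unfolding sets borel_eq_closed by simp_all
  interpret M: finite_measure M by fact
  interpret N: finite_measure N by fact
  note [measurable_cong] = sets
  show "emeasure M C = emeasure N C" if "C \<in> Collect closed" for C
  proof (cases "C = {}")
    case False
    have C: "closed C" using that by simp
    have [measurable]: "C \<in> sets borel" using C by simp
    define f where "f n x = max 0 (1 - real n * infdist x C)" for n x
    have lip: "\<bar>f n x - f n y\<bar> \<le> n * dist x y" for n x y
    proof -
      have "\<bar>f n x - f n y\<bar> \<le> \<bar>real n * infdist x C - real n * infdist y C\<bar>"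
        by (auto simp: f_def)
      also have "\<dots> = n * \<bar>infdist x C - infdist y C\<bar>"
        by (simp add: right_diff_distrib[symmetric] abs_mult)
      also have "\<dots> \<le> n * dist x y"
        by (intro mult_left_mono infdist_triangle_abs) auto
      finally show ?thesis .
    qed
    have f01: "0 \<le> f n x \<and> f n x \<le> 1" for n x by (auto simp: f_def infdist_nonneg)
    have fm: "f n \<in> borel_measurable borel" for n
      unfolding f_def by (intro borel_measurable_continuous_onI continuous_intros)
    have lim: "(\<lambda>n. f n x) \<longlonglongrightarrow> indicator C x" for x
    proof (cases "x \<in> C")
      case False
      then have pos: "infdist x C > 0" using infdist_pos_not_in_closed C \<open>C \<noteq> {}\<close> by blast
      obtain N :: nat where N: "real N > 1 / infdist x C" using reals_Archimedean2 by blast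
      have "f n x = 0" if "n \<ge> N" for n
      proof -
        have "1 / infdist x C \<le> real n" using N that by linarith
        then have "1 \<le> real n * infdist x C" using pos by (simp add: field_simps)
        then show ?thesis by (simp add: f_def)
      qed
      then show ?thesis using False
        by (intro tendsto_eventually) (auto simp: eventually_sequentially)
    qed (simp add: f_def)
    have conv: "(\<lambda>n. integral\<^sup>L Q (f n)) \<longlonglongrightarrow> integral\<^sup>L Q (indicator C)"
      if "finite_measure Q" "sets Q = sets borel" for Q :: "'a measure"
    proof -
      interpret Q: finite_measure Q by fact
      have [measurable_cong]: "sets Q = sets borel" by fact
      show ?thesis
        by (rule integral_dominated_convergence[where w = "\<lambda>_. 1"])
           (use lim f01 fm in \<open>auto simp: measurable_cong_sets[OF that(2) refl]\<close>)
    qed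
    have "integral\<^sup>L M (indicator C) = (integral\<^sup>L N (indicator C) :: real)"
      by (rule LIMSEQ_unique[OF conv[OF assms(1) sets(1)]])
         (use eq[OF lip f01] conv[OF assms(2) sets(2)] in simp)
    then show ?thesis
      using sets_eq_imp_space_eq[OF sets(1)] sets_eq_imp_space_eq[OF sets(2)]
      by (simp add: M.emeasure_eq_measure N.emeasure_eq_measure)
  qed simp
  show "emeasure M UNIV \<noteq> \<infinity>" using \<open>finite_measure M\<close> by (simp add: finite_measure.emeasure_finite)
qed (auto simp: Int_stable_def)

lemma disjoint_compacts_separated:
  fixes K :: "'i \<Rightarrow> 'a::metric_space set"
  assumes "finite I" "\<And>i. i \<in> I \<Longrightarrow> compact (K i)"
    and "\<And>i j. i \<in> I \<Longrightarrow> j \<in> I \<Longrightarrow> i \<noteq> j \<Longrightarrow> K i \<inter> K j = {}"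
  obtains r where "r > 0"
    "\<And>i j x y. i \<in> I \<Longrightarrow> j \<in> I \<Longrightarrow> i \<noteq> j \<Longrightarrow> x \<in> K i \<Longrightarrow> y \<in> K j \<Longrightarrow> r \<le> dist x y"
proof -
  have "\<exists>d>0. \<forall>x\<in>K i. \<forall>y\<in>K j. d \<le> dist x y" if ij: "i \<in> I" "j \<in> I" "i \<noteq> j" for i j
  proof (cases "K i = {} \<or> K j = {}")
    case True
    then show ?thesis by (intro exI[of _ 1]) auto
  next
    case False
    have "continuous_on (K i) (\<lambda>x. infdist x (K j))" by (intro continuous_intros)
    then obtain x where x: "x \<in> K i" "\<And>y. y \<in> K i \<Longrightarrow> infdist x (K j) \<le> infdist y (K j)"
      using continuous_attains_inf[of "K i" "\<lambda>x. infdist x (K j)"] assms(2)[OF ij(1)] False by blast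
    have "infdist x (K j) > 0"
      using x(1) False assms(3)[OF ij] compact_imp_closed[OF assms(2)[OF ij(2)]]
      by (intro infdist_pos_not_in_closed) auto
    then show ?thesis using x(2) infdist_le by (meson order_trans)
  qed
  then have "\<exists>d>0. i \<noteq> j \<longrightarrow> (\<forall>x\<in>K i. \<forall>y\<in>K j. d \<le> dist x y)" if "i \<in> I" "j \<in> I" for i j
    using that zero_less_one by (cases "i = j") blast+
  then obtain d where d: "\<And>i j. i \<in> I \<Longrightarrow> j \<in> I \<Longrightarrow> d i j > (0::real)"
    "\<And>i j x y. i \<in> I \<Longrightarrow> j \<in> I \<Longrightarrow> i \<noteq> j \<Longrightarrow> x \<in> K i \<Longrightarrow> y \<in> K j \<Longrightarrow> d i j \<le> dist x y"
    by metis
  define r where "r = Min (insert 1 ((\<lambda>(i, j). d i j) ` (I \<times> I)))"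
  have "r > 0" unfolding r_def using assms(1) d(1) by (subst Min_gr_iff) auto
  moreover have "r \<le> d i j" if "i \<in> I" "j \<in> I" for i j
    unfolding r_def using assms(1) that by (intro Min_le) auto
  ultimately show ?thesis using that d(2) by (meson order_trans)
qed

section \<open>Smoothing a partition of the circle\<close>

locale circle_system = partitioned_system M T P
  for M :: "circle measure" and T P +
  assumes sets_M: "sets M = sets borel"
begin

lemma space_M [simp]: "space M = UNIV"
  using sets_eq_imp_space_eq[OF sets_M] by simp

lemma continuous_measurable: "continuous_on UNIV f \<Longrightarrow> f \<in> borel_measurable M" for f :: "circle \<Rightarrow> real"
  by (simp add: measurable_cong_sets[OF sets_M refl] borel_measurable_continuous_onI)

lemma continuous_integrable:
  fixes f :: "circle \<Rightarrow> real"
  assumes "continuous_on UNIV f"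
  shows "integrable M f"
proof -
  obtain B where "\<And>x. \<bar>f x\<bar> \<le> B"
    using compact_imp_bounded[OF compact_continuous_image[OF assms compact_circle]]
    by (auto simp: bounded_iff)
  then show ?thesis
    by (intro integrable_const_bound[of _ B] continuous_measurable assms) auto
qed

lemma cell_choice_measurable:
  fixes k :: "circle set \<Rightarrow> circle \<Rightarrow> real"
  assumes "\<And>c. c \<in> P \<Longrightarrow> k c \<in> borel_measurable M"
  shows "(\<lambda>x. k (cell x) x) \<in> borel_measurable M"
proof -
  have "k (cell x) x = (\<Sum>c\<in>P. k c x * indicator c x)" for x
  proof -
    have "x \<in> c \<longleftrightarrow> c = cell x" if "c \<in> P" for c
      using cell_eqI[OF that, of x] cell(2)[of x] by auto
    then have "(\<Sum>c\<in>P. k c x * indicator c x) = (\<Sum>c\<in>P. if c = cell x then k c x else 0)"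
      by (intro sum.cong) (simp_all add: indicator_def)
    then show ?thesis using cell(1)[of x] finite_P by simp
  qed
  then show ?thesis using assms P_sets by simp
qed

text \<open>Continuous substitutes for the indicator functions of the cells, at a small cost in entropy.\<close>

lemma continuous_kernels:
  assumes "\<eta> > 0"
  obtains k :: "circle set \<Rightarrow> circle \<Rightarrow> real"
  where "\<And>c. c \<in> P \<Longrightarrow> continuous_on UNIV (k c)" "\<And>c x. c \<in> P \<Longrightarrow> 0 < k c x"
    "\<And>x. (\<Sum>c\<in>P. k c x) \<le> 1"
    "integrable M (\<lambda>x. ln (k (cell x) x))" "- \<eta> \<le> (\<integral>x. ln (k (cell x) x) \<partial>M)"
proof -
  define N where "N = real (card P)"
  have "P \<noteq> {}" using cell(1)[of undefined] by auto
  then have N: "N \<ge> 1" using finite_P by (simp add: N_def Suc_leI card_gt_0_iff)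
  \<comment> \<open>Mixing in the uniform weight \<open>\<kappa> / N\<close> keeps every kernel
    positive. Where the bump equals 1 this costs
    \<open>- ln (1 - \<kappa>) = \<eta> / 2\<close>.\<close>
  define \<kappa> where "\<kappa> = 1 - exp (- \<eta> / 2)"
  have \<kappa>: "0 < \<kappa>" "\<kappa> < 1" using assms by (auto simp: \<kappa>_def)
  define l where "l = - ln (\<kappa> / N)"
  have "\<kappa> / N < 1" using \<kappa> N by (simp add: divide_simps)
  then have l: "l > 0" using \<kappa> N by (simp add: l_def)
  \<comment> \<open>Outside the compact cores the logarithmic loss is at most \<open>l\<close>; this
    exceptional set has measure at most \<open>N * e\<close>, and
    \<open>l * N * e = \<eta> / 2\<close> is the other half of the allowance.\<close>
  define e where "e = \<eta> / (2 * l * N)"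
  have e: "e > 0" using assms l N by (simp add: e_def)
  have "\<exists>K. compact K \<and> K \<subseteq> c \<and> measure M (c - K) < e" if "c \<in> P" for c
    by (rule circle_inner_regular[OF finite_measure_axioms sets_M _ e, of c])
       (use P_sets[OF that] sets_M in auto)
  then obtain K where K: "\<And>c. c \<in> P \<Longrightarrow> compact (K c)" "\<And>c. c \<in> P \<Longrightarrow> K c \<subseteq> c"
    "\<And>c. c \<in> P \<Longrightarrow> measure M (c - K c) < e" by metis
  have disj: "c \<inter> c' = {}" if "c \<in> P" "c' \<in> P" "c \<noteq> c'" for c c'
    using that P_part by (auto simp: partition_on_def disjoint_def)
  have disjK: "K c \<inter> K c' = {}" if "c \<in> P" "c' \<in> P" "c \<noteq> c'" for c c'
    using disj[OF that] K(2)[OF that(1)] K(2)[OF that(2)] by blast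
  obtain r where r: "r > 0"
    "\<And>c c' x y. c \<in> P \<Longrightarrow> c' \<in> P \<Longrightarrow> c \<noteq> c' \<Longrightarrow> x \<in> K c \<Longrightarrow> y \<in> K c' \<Longrightarrow> r \<le> dist x y"
    using disjoint_compacts_separated[of P K, OF finite_P K(1) disjK] by metis
  \<comment> \<open>Bumps supported within \<open>r / 2\<close> of cores that are \<open>r\<close>
    apart: at each point at most one of them is positive, so their sum stays at most 1.\<close>
  define \<phi> where "\<phi> c x = (if K c = {} then 0 else max 0 (1 - 2 / r * infdist x (K c)))" for c x
  define k where "k c x = (1 - \<kappa>) * \<phi> c x + \<kappa> / N" for c x
  have \<phi>0: "0 \<le> \<phi> c x" for c x by (simp add: \<phi>_def)
  have \<phi>1: "\<phi> c x \<le> 1" for c x using r(1) by (simp add: \<phi>_def infdist_nonneg)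
  have near: "\<exists>y\<in>K c. dist x y < r / 2" if "\<phi> c x > 0" for c x
  proof -
    have "K c \<noteq> {}" "infdist x (K c) < r / 2"
      using that r(1) by (auto simp: \<phi>_def max_def field_simps split: if_splits)
    then show ?thesis using infdist_attains_inf
      by (metis (no_types, lifting) cINF_less_iff bdd_below_image_dist infdist_notempty)
  qed
  have sum\<phi>: "(\<Sum>c\<in>P. \<phi> c x) \<le> 1" for x
  proof (cases "\<exists>c\<in>P. \<phi> c x > 0")
    case True
    then obtain c where c: "c \<in> P" "\<phi> c x > 0" by auto
    have "\<phi> c' x = 0" if "c' \<in> P" "c' \<noteq> c" for c'
    proof (rule ccontr)
      assume "\<phi> c' x \<noteq> 0"
      then have "\<phi> c' x > 0" using \<phi>0[of c' x] by simp
      then obtain y y' where y: "y \<in> K c" "y' \<in> K c'" "dist x y < r / 2" "dist x y' < r / 2"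
        using near c(2) by meson
      then show False
        using r(2)[OF c(1) that(1) that(2)[symmetric] y(1,2)] dist_triangle[of y y' x] y(3,4)
        by (simp add: dist_commute)
    qed
    then have "(\<Sum>c'\<in>P. \<phi> c' x) = (\<Sum>c'\<in>P. if c' = c then \<phi> c x else 0)" by (intro sum.cong) auto
    then show ?thesis using c(1) finite_P \<phi>1 by simp
  next
    case False
    then have "(\<Sum>c\<in>P. \<phi> c x) \<le> 0" by (intro sum_nonpos) (auto simp: not_less)
    then show ?thesis by simp
  qed
  have cont: "continuous_on UNIV (k c)" for c
    unfolding k_def \<phi>_def using r(1) by (cases "K c = {}") (auto intro!: continuous_intros)
  have kpos: "\<kappa> / N \<le> k c x" for c x using \<phi>0[of c x] \<kappa> by (simp add: k_def)
  have kpos': "0 < k c x" for c x using kpos[of c x] \<kappa> N by (meson less_le_trans divide_pos_pos zero_less_one)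
  have ksum: "(\<Sum>c\<in>P. k c x) \<le> 1" for x
  proof -
    have "(\<Sum>c\<in>P. k c x) = (1 - \<kappa>) * (\<Sum>c\<in>P. \<phi> c x) + N * (\<kappa> / N)"
      by (simp add: k_def sum.distrib sum_distrib_left N_def)
    also have "\<dots> \<le> (1 - \<kappa>) * 1 + \<kappa>"
      using sum\<phi>[of x] \<kappa> N by (intro add_mono mult_left_mono) auto
    finally show ?thesis by simp
  qed
  have k1: "k c x \<le> 1" if "c \<in> P" for c x
    using order_trans[OF member_le_sum[OF that _ finite_P, of "\<lambda>c. k c x"] ksum[of x]] kpos' less_imp_le
    by auto
  define B where "B = (\<Union>c\<in>P. c - K c)"
  have Ksets: "c - K c \<in> sets M" if "c \<in> P" for c
    using P_sets[OF that] borel_compact[OF K(1)[OF that]] sets_M by auto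
  have B: "B \<in> sets M" unfolding B_def using Ksets finite_P by auto
  have "measure M B \<le> (\<Sum>c\<in>P. measure M (c - K c))"
    unfolding B_def by (rule finite_measure_subadditive_finite) (use finite_P Ksets in auto)
  also have "\<dots> \<le> (\<Sum>c\<in>P. e)" by (intro sum_mono) (use K(3) less_imp_le in auto)
  finally have mB: "measure M B \<le> N * e" by (simp add: N_def)
  have lower: "- \<eta> / 2 - l * indicator B x \<le> ln (k (cell x) x)" for x
  proof (cases "x \<in> B")
    case True
    have "- l \<le> ln (k (cell x) x)" using kpos[of "cell x" x] kpos'[of "cell x" x] \<kappa> N
      by (simp add: l_def)
    then show ?thesis using True assms by simp
  next
    case False
    then have "x \<in> K (cell x)" using cell[of x] by (auto simp: B_def)
    then have "\<phi> (cell x) x = 1" by (auto simp: \<phi>_def)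
    then have "1 - \<kappa> \<le> k (cell x) x" using \<kappa> N by (simp add: k_def)
    then have "ln (1 - \<kappa>) \<le> ln (k (cell x) x)" using \<kappa> kpos'[of "cell x" x] by simp
    then show ?thesis using False by (simp add: \<kappa>_def)
  qed
  have meas: "(\<lambda>x. ln (k (cell x) x)) \<in> borel_measurable M"
    using cell_choice_measurable[of "\<lambda>c x. ln (k c x)"] cont
    by (intro cell_choice_measurable[of "\<lambda>c x. ln (k c x)"] borel_measurable_ln continuous_measurable)
  have upper: "ln (k (cell x) x) \<le> 0" for x
    using k1[OF cell(1), of x] kpos'[of "cell x" x] by simp
  have int: "integrable M (\<lambda>x. ln (k (cell x) x))"
  proof (rule integrable_const_bound[OF _ meas, of "\<eta> / 2 + l"])
    have "norm (ln (k (cell x) x)) \<le> \<eta> / 2 + l" for x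
      using lower[of x] upper[of x] assms l by (cases "x \<in> B") auto
    then show "AE x in M. norm (ln (k (cell x) x)) \<le> \<eta> / 2 + l" by simp
  qed
  have intB: "integrable M (\<lambda>x. - \<eta> / 2 - l * indicator B x)"
    using B by (intro Bochner_Integration.integrable_diff integrable_mult_right integrable_real_indicator)
       (auto simp: emeasure_eq_measure)
  have "(\<integral>x. - \<eta> / 2 - l * indicator B x \<partial>M) = - \<eta> / 2 - l * measure M B"
    using B prob_space by (subst Bochner_Integration.integral_diff)
      (auto intro!: integrable_mult_right integrable_real_indicator simp: emeasure_eq_measure)
  moreover have "l * measure M B \<le> \<eta> / 2"
  proof -
    have "l * measure M B \<le> l * (N * e)" using mB l by (intro mult_left_mono) auto
    also have "\<dots> = \<eta> / 2" using l N by (simp add: e_def field_simps)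
    finally show ?thesis .
  qed
  moreover have "(\<integral>x. - \<eta> / 2 - l * indicator B x \<partial>M) \<le> (\<integral>x. ln (k (cell x) x) \<partial>M)"
    by (rule integral_mono[OF intB int]) (rule lower)
  ultimately have "- \<eta> \<le> (\<integral>x. ln (k (cell x) x) \<partial>M)" by linarith
  then show ?thesis using that[of k] cont kpos' ksum int by blast
qed

end

section \<open>Lifts of expanding circle maps\<close>

lemma continuous_on_circleI:
  fixes f :: "circle \<Rightarrow> 'a::metric_space"
  assumes "continuous_on UNIV (\<lambda>t. f (to_circle t))"
  shows "continuous_on UNIV f"
  unfolding continuous_on_iff
proof (intro ballI allI impI)
  fix x :: circle and e :: real assume "e > 0"
  then obtain d where d: "d > 0"
    "\<And>s. dist s (coord x) < d \<Longrightarrow> dist (f (to_circle s)) (f (to_circle (coord x))) < e"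
    using assms unfolding continuous_on_iff by (metis UNIV_I)
  have "dist (f y) (f x) < e" if "dist y x < d" for y
  proof -
    obtain s where "to_circle s = y" "\<bar>coord x - s\<bar> = dist (to_circle (coord x)) y" by (rule lift_near)
    then show ?thesis using d(2)[of s] that by (simp add: dist_real_def abs_minus_commute dist_commute)
  qed
  then show "\<exists>d>0. \<forall>y\<in>UNIV. dist y x < d \<longrightarrow> dist (f y) (f x) < e" using d(1) by blast
qed

lemma shift_by_int:
  fixes F :: "real \<Rightarrow> real"
  assumes "\<And>t. F (t + 1) = F t + c"
  shows "F (t + of_int i) = F t + c * of_int i"
proof (induction i arbitrary: t rule: int_induct[of _ 0])
  case (step1 i)
  have "F (t + of_int (i + 1)) = F ((t + of_int i) + 1)" by (simp add: algebra_simps)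
  also have "\<dots> = F (t + of_int i) + c" by (rule assms)
  finally show ?case by (simp add: step1.IH algebra_simps)
next
  case (step2 i)
  have "F (t + of_int i) = F ((t + of_int (i - 1)) + 1)" by (simp add: algebra_simps)
  also have "\<dots> = F (t + of_int (i - 1)) + c" by (rule assms)
  finally show ?case by (simp add: step2.IH algebra_simps)
qed simp

text \<open>A negative \<open>m\<close> describes an orientation-reversing map. Expansion is strict
  but without a rate, which is all that a neutral fixed point permits; periodicity and compactness
  recover a rate for pairs that are not too close, in \<open>contraction\<close>.\<close>

locale circle_lift =
  fixes T :: "circle \<Rightarrow> circle" and F :: "real \<Rightarrow> real" and m :: int
  assumes bij_F: "bij F" and continuous_F: "continuous_on UNIV F"
    and lift: "T (to_circle s) = to_circle (F s)"
    and shift: "F (s + 1) = F s + of_int m"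
    and degree: "2 \<le> \<bar>m\<bar>"
    and expand: "s \<noteq> t \<Longrightarrow> \<bar>s - t\<bar> < \<bar>F s - F t\<bar>"
begin

definition G :: "real \<Rightarrow> real" where "G = inv F"

definition weighted_transfer :: "(circle \<Rightarrow> real) \<Rightarrow> (circle \<Rightarrow> real) \<Rightarrow> circle \<Rightarrow> real" where
  "weighted_transfer w f x = (\<Sum>y\<in>T -` {x}. w y * f y)"

lemma FG [simp]: "F (G t) = t" and GF [simp]: "G (F t) = t"
  using bij_F by (simp_all add: G_def bij_is_surj surj_f_inv_f bij_is_inj inv_f_f)

lemma T_G: "T (to_circle (G t)) = to_circle t"
  by (simp add: lift)

lemma G_less: "t \<noteq> s \<Longrightarrow> \<bar>G t - G s\<bar> < \<bar>t - s\<bar>"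
  using expand[of "G t" "G s"] by (metis FG)

lemma G_le: "\<bar>G t - G s\<bar> \<le> \<bar>t - s\<bar>"
  using G_less[of t s] by (cases "t = s") auto

lemma G_eq_iff: "G t = G s \<longleftrightarrow> t = s"
  by (metis FG)

lemma continuous_G: "continuous_on S G"
  unfolding continuous_on_iff dist_real_def using G_le by (meson le_less_trans)

lemma shift_int: "F (s + of_int i) = F s + of_int m * of_int i"
  by (rule shift_by_int[of F, OF shift])

lemma G_shift: "G (t + of_int m * of_int i) = G t + of_int i"
  by (metis FG GF shift_int)

text \<open>All inverse branches come from the single function \<open>G\<close>, evaluated at the
  lifts \<open>t + j\<close> of the point. Moving the argument by \<open>m\<close> moves the value
  by an integer, so \<open>\<bar>m\<bar>\<close> consecutive lifts exhaust the fibre without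
  repetition.\<close>

lemma fibre:
  "T -` {to_circle t} = (\<lambda>j. to_circle (G (t + real j))) ` {..<nat \<bar>m\<bar>}"
  "inj_on (\<lambda>j. to_circle (G (t + real j))) {..<nat \<bar>m\<bar>}"
proof -
  have m0: "m \<noteq> 0" using degree by auto
  have "y \<in> (\<lambda>j. to_circle (G (t + real j))) ` {..<nat \<bar>m\<bar>}" if "T y = to_circle t" for y
  proof -
    have "to_circle (F (coord y)) = to_circle t" using lift[of "coord y"] that by simp
    then obtain i :: int where i: "F (coord y) = t + of_int i"
      unfolding to_circle_eq_iff by (metis Ints_cases add.commute diff_eq_eq)
    define j where "j = nat (i mod \<bar>m\<bar>)"
    have "i mod \<bar>m\<bar> \<ge> 0" "i mod \<bar>m\<bar> < \<bar>m\<bar>" using m0 by simp_all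
    then have j: "j < nat \<bar>m\<bar>" "int j = i mod \<bar>m\<bar>" by (auto simp: j_def)
    obtain l where l: "i = int j + m * l"
      using j(2) by (metis abs_eq_iff mult_minus_left mult_minus_right mod_mult_div_eq minus_minus abs_if)
    have "t + of_int i = (t + real j) + of_int m * of_int l" by (simp add: l)
    then have "coord y = G (t + real j) + of_int l"
      using i G_shift by (metis GF)
    then have "y = to_circle (G (t + real j))"
      by (metis to_circle_add_int to_circle_coord)
    then show ?thesis using j(1) by blast
  qed
  moreover have "T (to_circle (G (t + real j))) = to_circle t" for j
    using T_G[of "t + real j"] to_circle_add_int[of t "int j"] by simp
  ultimately show "T -` {to_circle t} = (\<lambda>j. to_circle (G (t + real j))) ` {..<nat \<bar>m\<bar>}" by auto
  show "inj_on (\<lambda>j. to_circle (G (t + real j))) {..<nat \<bar>m\<bar>}"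
  proof (rule inj_onI)
    fix i j assume ij: "i \<in> {..<nat \<bar>m\<bar>}" "j \<in> {..<nat \<bar>m\<bar>}"
      "to_circle (G (t + real i)) = to_circle (G (t + real j))"
    then obtain l :: int where "G (t + real i) = G (t + real j) + of_int l"
      unfolding to_circle_eq_iff by (metis Ints_cases add.commute diff_eq_eq)
    then have "real i = real j + of_int m * of_int l"
      using G_shift[of "t + real j" l] G_eq_iff by (metis add.assoc add_left_cancel)
    then have "of_int (int i - int j) = (of_int (m * l) :: real)" by simp
    then have eq: "int i - int j = m * l" by (simp only: of_int_eq_iff)
    moreover have "\<bar>int i - int j\<bar> < \<bar>m\<bar>" using ij by auto
    ultimately have "\<bar>m\<bar> * \<bar>l\<bar> < \<bar>m\<bar> * 1" by (simp add: abs_mult)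
    then have "l = 0" using mult_less_cancel_left_pos[of "\<bar>m\<bar>" "\<bar>l\<bar>" 1] degree by simp
    then show "i = j" using eq by simp
  qed
qed

lemma card_fibre: "card (T -` {x}) = nat \<bar>m\<bar>"
  using fibre[of "coord x"] by (simp add: card_image)

lemma finite_fibre: "finite (T -` {x})"
  using fibre(1)[of "coord x"] by simp

lemma weighted_transfer_lift:
  "weighted_transfer w f (to_circle t)
   = (\<Sum>j<nat \<bar>m\<bar>. w (to_circle (G (t + real j))) * f (to_circle (G (t + real j))))"
  unfolding weighted_transfer_def fibre(1) by (rule sum.reindex[OF fibre(2), unfolded o_def])

lemma transfer_operator_eq: "transfer_operator T A = weighted_transfer (\<lambda>y. exp (A y))"
  by (intro ext) (simp add: transfer_operator_def weighted_transfer_def)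

lemma weighted_transfer_mono:
  assumes "\<And>y. 0 \<le> w y" "\<And>y. f y \<le> f' y"
  shows "weighted_transfer w f x \<le> weighted_transfer w f' x"
  unfolding weighted_transfer_def by (intro sum_mono mult_left_mono assms)

lemma weighted_transfer_ge:
  assumes "\<And>y. 0 \<le> w y" "\<And>y. 0 \<le> f y"
  shows "w y * f y \<le> weighted_transfer w f (T y)"
  unfolding weighted_transfer_def by (rule member_le_sum) (use assms finite_fibre in auto)

lemma weighted_transfer_pos:
  assumes "\<And>y. 0 < w y" "\<And>y. 0 < f y"
  shows "0 < weighted_transfer w f x"
proof -
  have "card (T -` {x}) \<noteq> 0" using degree by (simp add: card_fibre)
  then have "T -` {x} \<noteq> {}" by force
  then show ?thesis unfolding weighted_transfer_def
    by (intro sum_pos finite_fibre) (auto simp: assms)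
qed

lemma weighted_transfer_linear:
  "weighted_transfer w (\<lambda>y. a * f y + b * f' y) x
   = a * weighted_transfer w f x + b * weighted_transfer w f' x"
  by (simp add: weighted_transfer_def sum.distrib sum_distrib_left algebra_simps)

lemma weighted_transfer_cmult: "weighted_transfer w (\<lambda>y. a * f y) x = a * weighted_transfer w f x"
  using weighted_transfer_linear[of w a f 0 "\<lambda>_. 0"] by simp

text \<open>Functions that factor through \<open>T\<close> are constant on fibres. This is behind
  the duality \<open>Q_invariant_distr\<close> and behind the normalization of the perturbed
  weights.\<close>

lemma weighted_transfer_compose:
  "weighted_transfer w (\<lambda>y. f (T y) * f' y) x = f x * weighted_transfer w f' x"
  by (auto simp: weighted_transfer_def sum_distrib_left intro!: sum.cong)

lemma weighted_transfer_tendsto: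
  assumes "\<And>y. (\<lambda>n. f n y) \<longlonglongrightarrow> f' y"
  shows "(\<lambda>n. weighted_transfer w (f n) x) \<longlonglongrightarrow> weighted_transfer w f' x"
  unfolding weighted_transfer_def by (intro tendsto_sum tendsto_mult tendsto_const assms)

lemma continuous_weighted_transfer:
  assumes "continuous_on UNIV w" "continuous_on UNIV f"
  shows "continuous_on UNIV (weighted_transfer w f)"
proof (rule continuous_on_circleI)
  have c: "continuous_on UNIV (\<lambda>t. to_circle (G (t + real j)))" for j
    by (intro continuous_on_to_circle continuous_on_compose2[OF continuous_G[of UNIV]] continuous_intros) auto
  show "continuous_on UNIV (\<lambda>t. weighted_transfer w f (to_circle t))"
    unfolding weighted_transfer_lift
    by (intro continuous_on_sum continuous_on_mult
        continuous_on_compose2[OF assms(1) c] continuous_on_compose2[OF assms(2) c]) auto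
qed

lemma continuous_T: "continuous_on UNIV T"
  by (rule continuous_on_circleI) (simp add: lift continuous_on_to_circle continuous_F)

lemma T_borel [measurable]: "T \<in> measurable borel borel"
  by (intro borel_measurable_continuous_onI continuous_T)

text \<open>Two points with the same image have lifts whose values under \<open>F\<close> differ by
  an integer; uniform continuity makes this integer less than 1 in absolute value when the lifts are
  close.\<close>

lemma locally_injective:
  obtains \<delta> where "\<delta> > 0" "\<And>x y. T x = T y \<Longrightarrow> dist x y < \<delta> \<Longrightarrow> x = y"
proof -
  have "uniformly_continuous_on {-1..2} F"
    by (rule compact_uniformly_continuous[OF continuous_on_subset[OF continuous_F]]) auto
  then obtain d where d: "d > 0"
    "\<And>s t. s \<in> {-1..2} \<Longrightarrow> t \<in> {-1..2} \<Longrightarrow> dist t s < d \<Longrightarrow> dist (F t) (F s) < 1"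
    unfolding uniformly_continuous_on_def by (metis zero_less_one)
  have "x = y" if "T x = T y" "dist x y < d" for x y
  proof -
    obtain s where s: "to_circle s = y" "\<bar>coord x - s\<bar> = dist (to_circle (coord x)) y" by (rule lift_near)
    then have "\<bar>coord x - s\<bar> \<le> 1/2" using dist_circle_le_half by simp
    then have "-1 \<le> s" "s \<le> 2" using coord_bounds[of x] by linarith+
    then have "s \<in> {-1..2}" "coord x \<in> {-1..2}" using coord_bounds[of x] by auto
    then have "\<bar>F (coord x) - F s\<bar> < 1" using d(2) s that by (simp add: dist_real_def)
    moreover have "F (coord x) - F s \<in> \<int>"
      using that(1) lift[of "coord x"] lift[of s] s(1) by (simp add: to_circle_eq_iff)
    then obtain i :: int where i: "F (coord x) - F s = of_int i" by (auto elim: Ints_cases)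
    ultimately have "\<bar>of_int i :: real\<bar> < 1" by simp
    then have "of_int \<bar>i\<bar> < (1::real)" by simp
    then have "\<bar>i\<bar> < 1" by (simp only: of_int_less_1_iff)
    then have "F (coord x) = F s" using i by simp
    then have "coord x = s" by (metis GF)
    then show ?thesis using s(1) by auto
  qed
  then show ?thesis using that d(1) by blast
qed

text \<open>The ratio of distances under \<open>G\<close> is continuous and less than 1 off the
  diagonal, so compactness bounds it away from 1 as long as the distance is between
  \<open>\<epsilon>\<close> and 1. Below \<open>\<epsilon>\<close> there is only nonexpansion, hence
  the maximum.\<close>

lemma contraction:
  assumes "\<epsilon> > 0"
  obtains \<theta> where "0 < \<theta>" "\<theta> < 1" "\<And>t s. \<bar>t - s\<bar> \<le> 1 \<Longrightarrow> \<bar>G t - G s\<bar> \<le> max \<epsilon> (\<theta> * \<bar>t - s\<bar>)"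
proof -
  \<comment> \<open>A compact set of representatives: translating both arguments by a multiple of
    \<open>m\<close> changes both values of \<open>G\<close> by the same integer, so the first
    coordinate may be taken in a bounded interval.\<close>
  define K where "K = {p::real \<times> real. \<bar>fst p\<bar> \<le> \<bar>of_int m\<bar> \<and> \<epsilon> \<le> \<bar>fst p - snd p\<bar> \<and> \<bar>fst p - snd p\<bar> \<le> 1}"
  have "compact K"
  proof -
    have "K \<subseteq> {-\<bar>of_int m\<bar>..\<bar>of_int m\<bar>} \<times> {-\<bar>of_int m\<bar> - 1..\<bar>of_int m\<bar> + 1}"
      by (auto simp: K_def)
    moreover have "compact ({-\<bar>of_int m\<bar>..\<bar>of_int m\<bar>::real} \<times> {-\<bar>of_int m\<bar> - 1..\<bar>of_int m\<bar> + 1::real})"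
      by (intro compact_Times compact_Icc)
    moreover have "closed K" unfolding K_def
      by (intro closed_Collect_conj closed_Collect_le continuous_intros)
    ultimately show ?thesis using compact_Int_closed by (metis inf.absorb_iff2)
  qed
  define q where "q p = \<bar>G (fst p) - G (snd p)\<bar> / \<bar>fst p - snd p\<bar>" for p :: "real \<times> real"
  have q1: "q p < 1" if "p \<in> K" for p
    using that assms G_less[of "fst p" "snd p"] by (auto simp: K_def q_def)
  have "\<exists>\<theta>. 0 < \<theta> \<and> \<theta> < 1 \<and> (\<forall>p\<in>K. q p \<le> \<theta>)"
  proof (cases "K = {}")
    case True
    then show ?thesis by (intro exI[of _ "1/2"]) auto
  next
    case False
    have "continuous_on K q" unfolding q_def
      by (intro continuous_intros continuous_on_compose2[OF continuous_G[of UNIV]]) (use assms in \<open>auto simp: K_def\<close>)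
    then obtain p0 where "p0 \<in> K" "\<And>p. p \<in> K \<Longrightarrow> q p \<le> q p0"
      using continuous_attains_sup[OF \<open>compact K\<close> False] by blast
    then show ?thesis using q1[of p0]
      by (intro exI[of _ "max (1/2) (q p0)"]) (auto simp: le_max_iff_disj)
  qed
  then obtain \<theta> where \<theta>: "0 < \<theta>" "\<theta> < 1" "\<And>p. p \<in> K \<Longrightarrow> q p \<le> \<theta>" by blast
  have "\<bar>G t - G s\<bar> \<le> max \<epsilon> (\<theta> * \<bar>t - s\<bar>)" if ts: "\<bar>t - s\<bar> \<le> 1" for t s
  proof (cases "\<bar>t - s\<bar> \<le> \<epsilon>")
    case True
    then show ?thesis using G_le[of t s] by (simp add: le_max_iff_disj)
  next
    case False
    define i where "i = - \<lfloor>t / of_int m\<rfloor>"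
    have "t + of_int m * of_int i = of_int m * frac (t / of_int m)"
      using degree by (simp add: i_def frac_def algebra_simps)
    then have "\<bar>t + of_int m * of_int i\<bar> \<le> \<bar>of_int m\<bar>"
      using frac_lt_1[of "t / of_int m"] frac_ge_0[of "t / of_int m"]
      by (simp add: abs_mult mult_left_le)
    then have "(t + of_int m * of_int i, s + of_int m * of_int i) \<in> K"
      using False ts by (auto simp: K_def)
    from \<theta>(3)[OF this] have "\<bar>G t - G s\<bar> / \<bar>t - s\<bar> \<le> \<theta>" by (simp add: q_def G_shift)
    then have "\<bar>G t - G s\<bar> \<le> \<theta> * \<bar>t - s\<bar>"
      using False assms by (simp add: field_simps)
    then show ?thesis by simp
  qed
  then show ?thesis using that \<theta> by blast
qed

lemma G_iterate_le:
  assumes "0 < \<epsilon>" "\<epsilon> \<le> 1" "0 < \<theta>" "\<theta> < 1" "\<And>t s. \<bar>t - s\<bar> \<le> 1 \<Longrightarrow> \<bar>G t - G s\<bar> \<le> max \<epsilon> (\<theta> * \<bar>t - s\<bar>)"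
    and ts: "\<bar>t - s\<bar> \<le> max \<epsilon> (\<theta> ^ n)"
  shows "\<bar>G t - G s\<bar> \<le> max \<epsilon> (\<theta> ^ Suc n)"
proof -
  have "\<theta> ^ n \<le> 1" using assms by (simp add: power_le_one)
  then have "\<bar>t - s\<bar> \<le> 1" using ts assms(2) by linarith
  then have "\<bar>G t - G s\<bar> \<le> max \<epsilon> (\<theta> * \<bar>t - s\<bar>)" by (rule assms(5))
  also have "\<dots> \<le> max \<epsilon> (\<theta> * max \<epsilon> (\<theta> ^ n))"
    using ts assms(3) by (intro max.mono mult_left_mono) auto
  also have "\<dots> \<le> max \<epsilon> (\<theta> ^ Suc n)"
  proof -
    have "\<theta> * \<epsilon> \<le> 1 * \<epsilon>" using assms by (intro mult_right_mono) auto
    then show ?thesis by (cases "\<epsilon> \<le> \<theta> ^ n") (auto simp: max_def)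
  qed
  finally show ?thesis .
qed

text \<open>Lift \<open>x\<close>, push it forward by \<open>F ^^ N\<close>, choose a lift of
  \<open>y\<close> within distance 1 of the result, and pull back: \<open>G ^^ N\<close> shrinks
  distances up to 1 below \<open>\<delta>\<close>, for an \<open>N\<close> independent of both
  points.\<close>

lemma preimages_dense:
  assumes "\<delta> > 0"
  obtains N where "\<And>x y. \<exists>z. (T ^^ N) z = y \<and> dist z x \<le> \<delta>"
proof -
  define \<epsilon> where "\<epsilon> = min \<delta> 1"
  have \<epsilon>: "0 < \<epsilon>" "\<epsilon> \<le> 1" using assms by (auto simp: \<epsilon>_def)
  obtain \<theta> where \<theta>: "0 < \<theta>" "\<theta> < 1" "\<And>t s. \<bar>t - s\<bar> \<le> 1 \<Longrightarrow> \<bar>G t - G s\<bar> \<le> max \<epsilon> (\<theta> * \<bar>t - s\<bar>)"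
    using contraction[OF \<epsilon>(1)] by blast
  have iter: "\<bar>(G ^^ n) t - (G ^^ n) s\<bar> \<le> max \<epsilon> (\<theta> ^ n)" if "\<bar>t - s\<bar> \<le> 1" for n t s
    using that by (induction n) (auto intro!: G_iterate_le[OF \<epsilon> \<theta>] simp del: power_Suc)
  obtain N where N: "\<theta> ^ N < \<epsilon>" using real_arch_pow_inv[OF \<epsilon>(1) \<theta>(2)] by blast
  have TG: "(T ^^ n) (to_circle ((G ^^ n) t)) = to_circle t" for n t
  proof (induction n arbitrary: t)
    case (Suc n)
    have "(G ^^ Suc n) t = (G ^^ n) (G t)" by (simp add: funpow_swap1)
    then show ?case using Suc.IH[of "G t"] by (simp add: T_G)
  qed simp
  have GFn: "(G ^^ n) ((F ^^ n) t) = t" for n t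
    by (induction n arbitrary: t) (auto simp: funpow_swap1)
  have "\<exists>z. (T ^^ N) z = y \<and> dist z x \<le> \<delta>" for x y
  proof -
    obtain t where t: "to_circle t = y" "\<bar>(F ^^ N) (coord x) - t\<bar> = dist (to_circle ((F ^^ N) (coord x))) y"
      by (rule lift_near)
    have "\<bar>(F ^^ N) (coord x) - t\<bar> \<le> 1"
      unfolding t(2) by (rule order_trans[OF dist_circle_le_half]) simp
    from iter[OF this, of N] have "\<bar>coord x - (G ^^ N) t\<bar> \<le> \<epsilon>" using N by (simp add: GFn)
    then have "dist (to_circle (coord x)) (to_circle ((G ^^ N) t)) \<le> \<delta>"
      using dist_to_circle_le[of "coord x" "(G ^^ N) t"] by (simp add: \<epsilon>_def)
    then show ?thesis using TG[of N t] t(1) by (intro exI[of _ "to_circle ((G ^^ N) t)"]) (simp add: dist_commute)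
  qed
  then show ?thesis using that by blast
qed

end

section \<open>Hoelder functions and the cone condition\<close>

lemma holder_spaceI: "(\<And>x y. \<bar>f x - f y\<bar> \<le> C * dist x y powr \<alpha>) \<Longrightarrow> f \<in> holder_space \<alpha>"
  unfolding holder_space_def modulus_space_def by blast

lemma holder_spaceE:
  assumes "f \<in> holder_space \<alpha>"
  obtains C where "C \<ge> 0" "\<And>x y. \<bar>f x - f y\<bar> \<le> C * dist x y powr \<alpha>"
proof -
  obtain C where C: "\<And>x y. \<bar>f x - f y\<bar> \<le> C * dist x y powr \<alpha>"
    using assms unfolding holder_space_def modulus_space_def by blast
  have "\<bar>f x - f y\<bar> \<le> \<bar>C\<bar> * dist x y powr \<alpha>" for x y
    using order_trans[OF C[of x y] mult_right_mono[OF abs_ge_self[of C]]] by simp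
  then show ?thesis using that[of "\<bar>C\<bar>"] by simp
qed

lemma dist_powr_le_1: "\<alpha> \<ge> 0 \<Longrightarrow> dist (x::circle) y powr \<alpha> \<le> 1"
  using dist_circle_le_half[of x y] by (intro powr_le1) auto

lemma powr_tendsto_0:
  assumes "\<alpha> > 0" "e > 0"
  obtains d where "d > 0" "\<And>r. 0 \<le> r \<Longrightarrow> r < d \<Longrightarrow> r powr \<alpha> < (e::real)"
proof
  show "e powr (1 / \<alpha>) > 0" using assms by simp
  fix r :: real assume "0 \<le> r" "r < e powr (1 / \<alpha>)"
  then have "r powr \<alpha> < (e powr (1 / \<alpha>)) powr \<alpha>" using assms by (intro powr_less_mono2) auto
  then show "r powr \<alpha> < e" using assms by (simp add: powr_powr)
qed

lemma holder_continuous: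
  assumes "f \<in> holder_space \<alpha>" "\<alpha> > 0"
  shows "continuous_on UNIV f"
proof -
  obtain C where C: "C \<ge> 0" "\<And>x y. \<bar>f x - f y\<bar> \<le> C * dist x y powr \<alpha>"
    by (rule holder_spaceE[OF assms(1)]) auto
  show ?thesis unfolding continuous_on_iff
  proof (intro ballI allI impI)
    fix x and e :: real assume "e > 0"
    obtain d where d: "d > 0" "\<And>r. 0 \<le> r \<Longrightarrow> r < d \<Longrightarrow> r powr \<alpha> < e / (C + 1)"
      using powr_tendsto_0[OF assms(2), of "e / (C + 1)"] \<open>e > 0\<close> C(1) by auto
    have "dist (f y) (f x) < e" if "dist y x < d" for y
    proof -
      have "C * dist y x powr \<alpha> \<le> (C + 1) * dist y x powr \<alpha>" by (simp add: algebra_simps)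
      also have "\<dots> < (C + 1) * (e / (C + 1))"
        using d(2)[OF _ that] C(1) by (intro mult_strict_left_mono) auto
      finally show ?thesis using C(2)[of y x] C(1) by (simp add: dist_real_def)
    qed
    then show "\<exists>d>0. \<forall>y\<in>UNIV. dist y x < d \<longrightarrow> dist (f y) (f x) < e" using d(1) by blast
  qed
qed

lemma continuous_circle_bounded:
  fixes f :: "circle \<Rightarrow> real"
  assumes "continuous_on UNIV f"
  obtains B where "B > 0" "\<And>x. \<bar>f x\<bar> \<le> B"
proof -
  obtain B where B: "\<And>x. \<bar>f x\<bar> \<le> B"
    using compact_imp_bounded[OF compact_continuous_image[OF assms compact_circle]]
    by (auto simp: bounded_iff)
  have "\<bar>f x\<bar> \<le> \<bar>B\<bar> + 1" for x using B[of x] by linarith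
  then show ?thesis using that[of "\<bar>B\<bar> + 1"] by simp
qed

lemma continuous_circle_bounded_below:
  fixes f :: "circle \<Rightarrow> real"
  assumes "continuous_on UNIV f" "\<And>x. 0 < f x"
  obtains c where "c > 0" "\<And>x. c \<le> f x"
  using continuous_attains_inf[OF compact_circle _ assms(1)] assms(2) by auto

lemma lipschitz_imp_holder:
  assumes "\<And>x y. \<bar>f x - f y\<bar> \<le> L * dist (x::circle) y" "\<alpha> \<le> 1"
  shows "f \<in> holder_space \<alpha>"
proof (rule holder_spaceI)
  fix x y :: circle
  have "dist x y \<le> dist x y powr \<alpha>"
  proof (cases "dist x y = 0")
    case False
    then have "dist x y powr 1 \<le> dist x y powr \<alpha>"
      using dist_circle_le_half[of x y] assms(2) by (intro powr_mono') auto
    then show ?thesis using False by simp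
  qed simp
  then have "\<bar>L\<bar> * dist x y \<le> \<bar>L\<bar> * dist x y powr \<alpha>" by (intro mult_left_mono) auto
  moreover have "L * dist x y \<le> \<bar>L\<bar> * dist x y" by (intro mult_right_mono) auto
  ultimately show "\<bar>f x - f y\<bar> \<le> \<bar>L\<bar> * dist x y powr \<alpha>" using assms(1)[of x y] by linarith
qed

lemma holder_mult:
  assumes "f \<in> holder_space \<alpha>" "g \<in> holder_space \<alpha>" "\<alpha> > 0"
  shows "(\<lambda>x. f x * g x) \<in> holder_space \<alpha>"
proof -
  obtain C where C: "\<And>x y. \<bar>f x - f y\<bar> \<le> C * dist x y powr \<alpha>"
    by (rule holder_spaceE[OF assms(1)]) auto
  obtain D where D: "\<And>x y. \<bar>g x - g y\<bar> \<le> D * dist x y powr \<alpha>"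
    by (rule holder_spaceE[OF assms(2)]) auto
  obtain B where B: "B > 0" "\<And>x. \<bar>f x\<bar> \<le> B"
    using continuous_circle_bounded[OF holder_continuous[OF assms(1,3)]] by blast
  obtain B' where B': "B' > 0" "\<And>x. \<bar>g x\<bar> \<le> B'"
    using continuous_circle_bounded[OF holder_continuous[OF assms(2,3)]] by blast
  show ?thesis
  proof (rule holder_spaceI)
    fix x y
    have "\<bar>f x * g x - f y * g y\<bar> = \<bar>f x * (g x - g y) + (f x - f y) * g y\<bar>" by (simp add: algebra_simps)
    also have "\<dots> \<le> \<bar>f x\<bar> * \<bar>g x - g y\<bar> + \<bar>f x - f y\<bar> * \<bar>g y\<bar>"
      by (rule order_trans[OF abs_triangle_ineq]) (simp add: abs_mult)
    also have "\<dots> \<le> B * (D * dist x y powr \<alpha>) + (C * dist x y powr \<alpha>) * B'"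
      using B B' C D order_trans[OF abs_ge_zero C[of x y]] by (intro add_mono mult_mono) auto
    finally show "\<bar>f x * g x - f y * g y\<bar> \<le> (B * D + C * B') * dist x y powr \<alpha>" by (simp add: algebra_simps)
  qed
qed

text \<open>Positive functions whose logarithm is \<open>\<alpha>\<close>-Holder with constant
  \<open>D\<close>. The multiplicative form is invariant under scaling and survives sums with
  positive coefficients, suprema and positive limits.\<close>

definition holder_cone :: "real \<Rightarrow> real \<Rightarrow> (circle \<Rightarrow> real) set" where
  "holder_cone \<alpha> D = {f. (\<forall>x. 0 < f x) \<and> (\<forall>x y. f x \<le> f y * exp (D * dist x y powr \<alpha>))}"

lemma holder_cone_pos: "f \<in> holder_cone \<alpha> D \<Longrightarrow> 0 < f x"
  and holder_coneD: "f \<in> holder_cone \<alpha> D \<Longrightarrow> f x \<le> f y * exp (D * dist x y powr \<alpha>)"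
  by (auto simp: holder_cone_def)

lemma holder_cone_mono:
  assumes "f \<in> holder_cone \<alpha> D" "D \<le> D'"
  shows "f \<in> holder_cone \<alpha> D'"
proof -
  have "f y * exp (D * dist x y powr \<alpha>) \<le> f y * exp (D' * dist x y powr \<alpha>)" for x y
    using holder_cone_pos[OF assms(1), of y] assms(2)
    by (intro mult_left_mono) (simp_all add: mult_right_mono)
  then show ?thesis
    using assms(1) unfolding holder_cone_def by (blast intro: order_trans)
qed

lemma holder_coneI:
  assumes "f \<in> holder_space \<alpha>" "\<And>x. 0 < f x" "\<alpha> > 0"
  obtains D where "f \<in> holder_cone \<alpha> D"
proof -
  obtain C where C: "C \<ge> 0" "\<And>x y. \<bar>f x - f y\<bar> \<le> C * dist x y powr \<alpha>"
    by (rule holder_spaceE[OF assms(1)]) auto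
  obtain c where c: "c > 0" "\<And>x. c \<le> f x"
    using continuous_circle_bounded_below[OF holder_continuous[OF assms(1,3)] assms(2)] by blast
  have "f x \<le> f y * exp (C / c * dist x y powr \<alpha>)" for x y
  proof -
    have "f x \<le> f y + C * dist x y powr \<alpha>" using C(2)[of x y] by linarith
    also have "\<dots> = f y + c * (C / c * dist x y powr \<alpha>)" using c by simp
    also have "\<dots> \<le> f y + f y * (C / c * dist x y powr \<alpha>)"
      using c C(1) by (intro add_left_mono mult_right_mono) auto
    also have "\<dots> = f y * (1 + C / c * dist x y powr \<alpha>)" by (simp add: algebra_simps)
    also have "\<dots> \<le> f y * exp (C / c * dist x y powr \<alpha>)"
      using assms(2)[of y] exp_ge_add_one_self by (intro mult_left_mono) auto
    finally show ?thesis .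
  qed
  then show ?thesis using that[of "C / c"] assms(2) by (auto simp: holder_cone_def)
qed

lemma exp_minus_one_le:
  fixes u :: real
  assumes "0 \<le> u" "u \<le> D"
  shows "exp u - 1 \<le> exp D * u"
proof -
  have "1 - u \<le> exp (- u)" using exp_ge_add_one_self[of "- u"] by simp
  then have "exp u * (1 - u) \<le> exp u * exp (- u)" by (intro mult_left_mono) auto
  then have "exp u - 1 \<le> exp u * u" by (simp add: algebra_simps exp_minus)
  also have "\<dots> \<le> exp D * u" using assms by (intro mult_right_mono) auto
  finally show ?thesis .
qed

lemma holder_cone_abs_diff:
  assumes f: "f \<in> holder_cone \<alpha> D" and "D \<ge> 0" "\<alpha> \<ge> 0" "\<And>x. f x \<le> B"
  shows "\<bar>f x - f y\<bar> \<le> B * exp D * D * dist x y powr \<alpha>"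
proof -
  have "f x - f y \<le> B * exp D * D * dist x y powr \<alpha>" for x y
  proof -
    let ?u = "D * dist x y powr \<alpha>"
    have u: "0 \<le> ?u" "?u \<le> D" using assms dist_powr_le_1[of \<alpha> x y] by (auto intro: mult_left_le)
    have "f x - f y \<le> f y * (exp ?u - 1)" using holder_coneD[OF f, of x y] by (simp add: algebra_simps)
    also have "\<dots> \<le> B * (exp D * ?u)"
      using assms(4)[of y] holder_cone_pos[OF f, of y] u exp_minus_one_le[OF u]
      by (intro mult_mono) (auto simp: one_le_exp_iff intro: order_trans[OF less_imp_le])
    finally show ?thesis by (simp add: algebra_simps)
  qed
  from this[of x y] this[of y x] show ?thesis by (simp add: dist_commute abs_le_iff)
qed

lemma holder_cone_ratio:
  assumes "f \<in> holder_cone \<alpha> D" "D \<ge> 0" "\<alpha> \<ge> 0"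
  shows "f x \<le> f y * exp D"
proof -
  have "D * dist x y powr \<alpha> \<le> D" using assms dist_powr_le_1[of \<alpha> x y] by (auto intro: mult_left_le)
  then have "f y * exp (D * dist x y powr \<alpha>) \<le> f y * exp D"
    using holder_cone_pos[OF assms(1), of y] by (intro mult_left_mono) auto
  then show ?thesis using holder_coneD[OF assms(1), of x y] by linarith
qed

lemma holder_cone_imp_holder:
  assumes "f \<in> holder_cone \<alpha> D" "D \<ge> 0" "\<alpha> \<ge> 0"
  shows "f \<in> holder_space \<alpha>"
  using holder_cone_abs_diff[OF assms, of "f undefined * exp D"] holder_cone_ratio[OF assms]
  by (intro holder_spaceI) auto

lemma holder_cone_limit:
  assumes f: "\<And>n. f n \<in> holder_cone \<alpha> D" and lim: "\<And>x. (\<lambda>n. f n x) \<longlonglongrightarrow> f' x" and pos: "\<And>x. 0 < f' x"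
  shows "f' \<in> holder_cone \<alpha> D"
proof -
  have "f' x \<le> f' y * exp (D * dist x y powr \<alpha>)" for x y
    by (rule LIMSEQ_le[OF lim[of x] tendsto_mult_right[OF lim[of y]]]) (use holder_coneD[OF f] in blast)
  then show ?thesis using pos by (auto simp: holder_cone_def)
qed

section \<open>The eigenfunction\<close>

text \<open>Up to the error \<open>c\<close> the sequence is both subadditive and superadditive.
  Computing \<open>b (n * k)\<close> in both ways gives
  \<open>(b n - c) / n \<le> (b k + c) / k\<close>, so one number \<open>r\<close> separates all
  lower from all upper quotients.\<close>

lemma almost_additive:
  fixes b :: "nat \<Rightarrow> real"
  assumes "\<And>m n. \<bar>b (m + n) - b m - b n\<bar> \<le> c"
  obtains r :: real where "\<And>n. \<bar>b n - real n * r\<bar> \<le> c"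
proof -
  have c0: "0 \<le> c" using assms[of 0 0] by linarith
  have up: "b (k * m) \<le> k * b m + (real k - 1) * c" if "k \<ge> 1" for k m
    using that
  proof (induction k rule: dec_induct)
    case (step k)
    then show ?case using assms[of m "k * m"] by (simp add: algebra_simps abs_le_iff)
  qed simp
  have low: "k * b m - (real k - 1) * c \<le> b (k * m)" if "k \<ge> 1" for k m
    using that
  proof (induction k rule: dec_induct)
    case (step k)
    then show ?case using assms[of m "k * m"] by (simp add: algebra_simps abs_le_iff)
  qed simp
  have cross: "(b n - c) / n \<le> (b k + c) / k" if "n \<ge> 1" "k \<ge> 1" for n k
  proof -
    have "k * b n - (real k - 1) * c \<le> n * b k + (real n - 1) * c"
      using low[OF that(2), of n] up[OF that(1), of k] by (simp add: mult.commute)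
    then have "real k * (b n - c) \<le> real n * (b k + c)" using c0 by (simp add: algebra_simps)
    then show ?thesis using that by (simp add: field_simps)
  qed
  define r where "r = (INF n\<in>{1..}. (b n + c) / real n)"
  have bdd: "bdd_below ((\<lambda>n. (b n + c) / real n) ` {1..})"
    by (rule bdd_belowI[of _ "(b 1 - c) / 1"]) (use cross[of 1] in auto)
  have "\<bar>b n - n * r\<bar> \<le> c" for n
  proof (cases "n = 0")
    case True
    then show ?thesis using assms[of 0 0] by simp
  next
    case False
    then have n: "n \<ge> 1" by simp
    have "r \<le> (b n + c) / n" unfolding r_def using n by (intro cINF_lower bdd) auto
    moreover have "(b n - c) / n \<le> r" unfolding r_def using cross[OF n] by (intro cINF_greatest) auto
    ultimately show ?thesis using n by (simp add: field_simps abs_le_iff)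
  qed
  then show ?thesis using that by blast
qed

text \<open>The flatness condition makes the distortion of Birkhoff sums of \<open>A\<close> telescope along inverse branches.\<close>

locale flat_potential = circle_lift +
  fixes A :: "circle \<Rightarrow> real" and \<alpha> C :: real
  assumes \<alpha>: "0 < \<alpha>" "\<alpha> \<le> 1" and C: "0 \<le> C" and A_holder: "A \<in> holder_space \<alpha>"
    and flat: "\<bar>t - s\<bar> \<le> 1/2 \<Longrightarrow>
      \<bar>A (to_circle (G t)) - A (to_circle (G s))\<bar> \<le> C * (\<bar>t - s\<bar> powr \<alpha> - \<bar>G t - G s\<bar> powr \<alpha>)"
begin

abbreviation L :: "(circle \<Rightarrow> real) \<Rightarrow> circle \<Rightarrow> real" where
  "L \<equiv> weighted_transfer (\<lambda>y. exp (A y))"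

lemma continuous_A: "continuous_on UNIV A"
  using holder_continuous[OF A_holder \<alpha>(1)] .

text \<open>Preimages of two nearby points are paired along the same branch. The loss of the
  \<open>\<alpha>\<close>-th power of the distance, multiplied by \<open>C \<le> D\<close>, pays for
  the distortion of \<open>exp A\<close>; the remaining distance, multiplied by \<open>D\<close>,
  pays for that of \<open>f\<close>. The cone constant therefore does not grow.\<close>

lemma transfer_holder_cone:
  assumes f: "f \<in> holder_cone \<alpha> D" and D: "C \<le> D"
  shows "L f \<in> holder_cone \<alpha> D"
proof -
  have "L f x \<le> L f y * exp (D * dist x y powr \<alpha>)" for x y
  proof -
    define t where "t = coord x"
    obtain s where s: "to_circle s = y" "\<bar>t - s\<bar> = dist (to_circle t) y" by (rule lift_near)
    have t: "to_circle t = x" by (simp add: t_def)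
    have d: "\<bar>t - s\<bar> = dist x y" "\<bar>t - s\<bar> \<le> 1/2" using s(2) t dist_circle_le_half by auto
    have "exp (A (to_circle (G (t + real j)))) * f (to_circle (G (t + real j)))
      \<le> (exp (A (to_circle (G (s + real j)))) * f (to_circle (G (s + real j)))) * exp (D * dist x y powr \<alpha>)"
      (is "exp ?A1 * ?f1 \<le> (exp ?A2 * ?f2) * _") for j
    proof -
      let ?g = "\<bar>G (t + real j) - G (s + real j)\<bar> powr \<alpha>"
      have "\<bar>?A1 - ?A2\<bar> \<le> C * (\<bar>t - s\<bar> powr \<alpha> - ?g)"
        using flat[of "t + real j" "s + real j"] d by simp
      also have "\<dots> \<le> D * (\<bar>t - s\<bar> powr \<alpha> - ?g)"
        using G_le[of "t + real j" "s + real j"] \<alpha> D by (intro mult_right_mono) (auto intro!: powr_mono2)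
      finally have 1: "?A1 + D * ?g \<le> ?A2 + D * dist x y powr \<alpha>"
        using d by (simp add: algebra_simps)
      have "?f1 \<le> ?f2 * exp (D * dist (to_circle (G (t + real j))) (to_circle (G (s + real j))) powr \<alpha>)"
        by (rule holder_coneD[OF f])
      also have "\<dots> \<le> ?f2 * exp (D * ?g)"
        using holder_cone_pos[OF f] D C \<alpha> dist_to_circle_le
        by (intro mult_left_mono) (simp_all add: mult_left_mono powr_mono2 less_imp_le)
      finally have "exp ?A1 * ?f1 \<le> exp ?A1 * (?f2 * exp (D * ?g))" by (intro mult_left_mono) auto
      also have "\<dots> = ?f2 * exp (?A1 + D * ?g)" by (simp add: exp_add)
      also have "\<dots> \<le> ?f2 * exp (?A2 + D * dist x y powr \<alpha>)"
        using 1 holder_cone_pos[OF f] by (intro mult_left_mono) (auto intro: less_imp_le)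
      finally show ?thesis by (simp add: exp_add algebra_simps)
    qed
    then have "L f (to_circle t) \<le> L f (to_circle s) * exp (D * dist x y powr \<alpha>)"
      unfolding weighted_transfer_lift sum_distrib_right by (intro sum_mono)
    then show ?thesis using t s(1) by simp
  qed
  then show ?thesis
    using weighted_transfer_pos[of "\<lambda>y. exp (A y)" f] holder_cone_pos[OF f] by (auto simp: holder_cone_def)
qed

lemma transfer_iterate_holder_cone:
  "f \<in> holder_cone \<alpha> D \<Longrightarrow> C \<le> D \<Longrightarrow> (L ^^ n) f \<in> holder_cone \<alpha> D"
  by (induction n) (auto intro: transfer_holder_cone)

lemma transfer_iterate_mono:
  "(\<And>y. f y \<le> f' y) \<Longrightarrow> (L ^^ n) f x \<le> (L ^^ n) f' x"
  by (induction n arbitrary: x) (auto intro: weighted_transfer_mono)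

lemma transfer_iterate_cmult: "(L ^^ n) (\<lambda>y. a * f y) x = a * (L ^^ n) f x"
proof (induction n arbitrary: x)
  case (Suc n)
  have "(L ^^ n) (\<lambda>y. a * f y) = (\<lambda>x. a * (L ^^ n) f x)" using Suc by blast
  then show ?case by (simp add: weighted_transfer_cmult)
qed simp

text \<open>All iterates of 1 lie in the cone with constant \<open>C\<close>, so their values at any
  two points differ by a factor of at most \<open>exp C\<close>. The logarithm at a base point is
  then almost additive. In \<open>K = exp (2 * C)\<close> one \<open>C\<close> is the error of the
  linear approximation and one comes from changing the point.\<close>

lemma transfer_iterates_growth:
  obtains \<rho> K where "\<rho> > 0" "K \<ge> 1"
    "\<And>n x. (L ^^ n) (\<lambda>_. 1) x \<le> K * \<rho> ^ n" "\<And>n x. \<rho> ^ n \<le> K * (L ^^ n) (\<lambda>_. 1) x"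
proof -
  define u where "u n = (L ^^ n) (\<lambda>_. 1)" for n
  have u_cone: "u n \<in> holder_cone \<alpha> C" for n
    unfolding u_def using C by (intro transfer_iterate_holder_cone) (auto simp: holder_cone_def)
  have u_pos: "0 < u n x" for n x by (rule holder_cone_pos[OF u_cone])
  have ratio: "u n x \<le> u n y * exp C" for n x y
    by (rule holder_cone_ratio[OF u_cone C]) (use \<alpha> in simp)
  define x0 where "x0 = to_circle 0"
  define b where "b n = ln (u n x0)" for n
  have add: "\<bar>b (m + n) - b m - b n\<bar> \<le> C" for m n
  proof -
    have eq: "u (m + n) = (L ^^ m) (u n)" by (simp add: u_def funpow_add)
    have "u (m + n) x0 \<le> (L ^^ m) (\<lambda>y. (u n x0 * exp C) * 1) x0"
      unfolding eq by (rule transfer_iterate_mono) (use ratio in simp)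
    then have 1: "u (m + n) x0 \<le> u n x0 * exp C * u m x0"
      by (subst (asm) transfer_iterate_cmult) (simp add: u_def)
    have "(L ^^ m) (\<lambda>y. (u n x0 * exp (- C)) * 1) x0 \<le> u (m + n) x0"
      unfolding eq
      by (rule transfer_iterate_mono) (use ratio[of n x0] in \<open>simp add: exp_minus field_simps\<close>)
    then have 2: "u n x0 * exp (- C) * u m x0 \<le> u (m + n) x0"
      by (subst (asm) transfer_iterate_cmult) (simp add: u_def)
    have "b (m + n) \<le> ln (u n x0 * exp C * u m x0)"
      unfolding b_def using 1 u_pos by (subst ln_le_cancel_iff) auto
    moreover have "ln (u n x0 * exp (- C) * u m x0) \<le> b (m + n)"
      unfolding b_def using 2 u_pos by (subst ln_le_cancel_iff) auto
    moreover have "ln (u n x0 * exp C * u m x0) = b n + C + b m"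
      "ln (u n x0 * exp (- C) * u m x0) = b n - C + b m"
      using u_pos by (simp_all add: ln_mult b_def less_imp_neq[OF u_pos, symmetric])
    ultimately show ?thesis by (simp add: abs_le_iff)
  qed
  obtain r :: real where r: "\<And>n. \<bar>b n - real n * r\<bar> \<le> C"
    using almost_additive[of b C, OF add] by blast
  have exp_b: "exp (b n) = u n x0" for n using u_pos by (simp add: b_def)
  have exp2C: "exp (2 * C) = exp C * exp C" by (simp flip: exp_add)
  have exp_r: "exp r ^ n = exp (n * r)" for n by (simp add: exp_of_nat_mult)
  have "u n x \<le> exp (2 * C) * exp r ^ n" for n x
  proof -
    have "u n x \<le> exp (b n) * exp C" using ratio[of n x x0] by (simp add: exp_b)
    also have "\<dots> = exp (b n + C)" by (simp add: exp_add)
    also have "\<dots> \<le> exp (2 * C + n * r)" using r[of n] by (simp add: abs_le_iff)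
    finally show ?thesis by (simp add: exp_add exp_r)
  qed
  moreover have "exp r ^ n \<le> exp (2 * C) * u n x" for n x
  proof -
    have "exp r ^ n \<le> exp (b n + C)" unfolding exp_r using r[of n] by (simp add: abs_le_iff)
    also have "\<dots> = u n x0 * exp C" by (simp add: exp_add exp_b)
    also have "\<dots> \<le> (u n x * exp C) * exp C" using ratio[of n x0 x] by (intro mult_right_mono) auto
    also have "\<dots> = exp (2 * C) * u n x" by (simp add: exp2C)
    finally show ?thesis .
  qed
  ultimately show ?thesis using that[of "exp r" "exp (2 * C)"] C by (auto simp: u_def)
qed

text \<open>The limes superior \<open>v\<close> of the normalized iterates satisfies
  \<open>\<rho> * v \<le> L v\<close>, because the monotone operator applied to a supremum dominates
  the supremum of the images. Positivity then makes the normalized iterates of \<open>v\<close>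
  increase; they are bounded by the growth estimate, and their limit is a genuine
  eigenfunction.\<close>

lemma eigenfunction_exists:
  obtains h \<rho> where "h \<in> holder_space \<alpha>" "\<And>x. 0 < h x" "\<rho> > 0" "\<And>x. L h x = \<rho> * h x"
proof -
  obtain \<rho> K where \<rho>: "\<rho> > 0" and K: "K \<ge> 1"
    and up: "\<And>n x. (L ^^ n) (\<lambda>_. 1) x \<le> K * \<rho> ^ n"
    and low: "\<And>n x. \<rho> ^ n \<le> K * (L ^^ n) (\<lambda>_. 1) x"
    using transfer_iterates_growth by blast
  define u where "u n x = (L ^^ n) (\<lambda>_. 1) x / \<rho> ^ n" for n x
  have cone_div: "(\<lambda>x. f x / c) \<in> holder_cone \<alpha> C" if "f \<in> holder_cone \<alpha> C" "c > 0" for f c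
    using that by (auto simp: holder_cone_def divide_right_mono)
  have u_cone: "u n \<in> holder_cone \<alpha> C" for n
    unfolding u_def using C \<rho> by (intro cone_div transfer_iterate_holder_cone) (auto simp: holder_cone_def)
  have u_le: "u n x \<le> K" and u_ge: "1 / K \<le> u n x" for n x
    using up[of n x] low[of n x] \<rho> K by (auto simp: u_def field_simps)
  have u_Suc: "L (u n) x = \<rho> * u (Suc n) x" for n x
    using weighted_transfer_cmult[of "\<lambda>y. exp (A y)" "1 / \<rho> ^ n" "(L ^^ n) (\<lambda>_. 1)" x] \<rho>
    by (simp add: u_def[abs_def] field_simps)
  \<comment> \<open>Tail suprema, decreasing in \<open>N\<close>. Every step is an inequality
    between pointwise limits, and \<open>L\<close> commutes with such limits because fibres are
    finite.\<close>
  define w where "w N x = (SUP n. u (N + n) x)" for N x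
  have bdd: "bdd_above (range (\<lambda>n. u (N + n) x))" for N x
    using u_le by (intro bdd_aboveI[of _ K]) auto
  have w_ge: "u (N + n) x \<le> w N x" for N n x unfolding w_def by (intro cSUP_upper bdd) auto
  have w_le: "w N x \<le> K" for N x unfolding w_def using u_le by (intro cSUP_least) auto
  have w_ge': "1 / K \<le> w N x" for N x using u_ge[of "N + 0" x] w_ge[of N 0 x] by linarith
  have w_pos: "0 < w N x" for N x using w_ge'[of N x] K by (meson divide_pos_pos less_le_trans zero_less_one)
  have w_cone: "w N \<in> holder_cone \<alpha> C" for N
  proof -
    have "w N x \<le> w N y * exp (C * dist x y powr \<alpha>)" for x y
      unfolding w_def[of N x]
    proof (rule cSUP_least)
      fix n
      show "u (N + n) x \<le> w N y * exp (C * dist x y powr \<alpha>)"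
        by (rule order_trans[OF holder_coneD[OF u_cone] mult_right_mono[OF w_ge]]) simp
    qed simp
    then show ?thesis using w_pos by (auto simp: holder_cone_def)
  qed
  have w_dec: "w (Suc N) x \<le> w N x" for N x
    unfolding w_def[of "Suc N"] using w_ge[of N "Suc _" x] by (intro cSUP_least) auto
  have Lw: "\<rho> * w (Suc N) x \<le> L (w N) x" for N x
  proof -
    have "w (Suc N) x \<le> L (w N) x / \<rho>"
      unfolding w_def[of "Suc N"]
    proof (rule cSUP_least)
      fix n
      have "\<rho> * u (Suc (N + n)) x \<le> L (w N) x"
        unfolding u_Suc[symmetric] by (rule weighted_transfer_mono) (auto intro: w_ge)
      then show "u (Suc N + n) x \<le> L (w N) x / \<rho>" using \<rho> by (simp add: field_simps)
    qed simp
    then show ?thesis using \<rho> by (simp add: field_simps)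
  qed
  have "\<exists>l. (\<lambda>N. w N x) \<longlonglongrightarrow> l" for x
  proof -
    have "decseq (\<lambda>N. w N x)" using w_dec by (intro decseq_SucI)
    moreover have "\<forall>N. 0 \<le> w N x" using w_pos less_imp_le by blast
    ultimately show ?thesis using decseq_convergent by metis
  qed
  then obtain v where v: "\<And>x. (\<lambda>N. w N x) \<longlonglongrightarrow> v x" by metis
  have v_ge: "1 / K \<le> v x" for x by (rule LIMSEQ_le_const[OF v]) (use w_ge' in blast)
  have v_le: "v x \<le> K" for x by (rule LIMSEQ_le_const2[OF v]) (use w_le in blast)
  have v_pos: "0 < v x" for x using v_ge[of x] K by (meson divide_pos_pos less_le_trans zero_less_one)
  have v_cone: "v \<in> holder_cone \<alpha> C" by (rule holder_cone_limit[OF w_cone v v_pos])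
  have Lv: "\<rho> * v x \<le> L v x" for x
    by (rule LIMSEQ_le[OF tendsto_mult_left[OF LIMSEQ_Suc[OF v]] weighted_transfer_tendsto[of w v, OF v]])
       (use Lw in blast)
  \<comment> \<open>Starts at the subsolution \<open>v\<close>, hence increases; the bound
    \<open>K * K\<close> comes from \<open>v \<le> K\<close> and the growth of the iterates of
    1.\<close>
  define z where "z n x = (L ^^ n) v x / \<rho> ^ n" for n x
  have z_cone: "z n \<in> holder_cone \<alpha> C" for n
    unfolding z_def using \<rho> by (intro cone_div transfer_iterate_holder_cone v_cone) auto
  have z_Suc: "L (z n) x = \<rho> * z (Suc n) x" for n x
    using weighted_transfer_cmult[of "\<lambda>y. exp (A y)" "1 / \<rho> ^ n" "(L ^^ n) v" x] \<rho>
    by (simp add: z_def[abs_def] field_simps)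
  have z_inc: "z n x \<le> z (Suc n) x" for n x
  proof -
    have "(L ^^ n) (\<lambda>y. \<rho> * v y) x \<le> (L ^^ n) (L v) x" by (rule transfer_iterate_mono) (rule Lv)
    then show ?thesis using \<rho> unfolding transfer_iterate_cmult
      by (simp add: z_def field_simps funpow_swap1)
  qed
  have z_le: "z n x \<le> K * K" for n x
  proof -
    have "(L ^^ n) v x \<le> (L ^^ n) (\<lambda>y. K * 1) x" by (rule transfer_iterate_mono) (use v_le in simp)
    also have "\<dots> \<le> K * (K * \<rho> ^ n)"
      unfolding transfer_iterate_cmult using up[of n x] K by (intro mult_left_mono) auto
    finally show ?thesis using \<rho> by (simp add: z_def field_simps)
  qed
  have "\<exists>l. (\<lambda>n. z n x) \<longlonglongrightarrow> l" for x
  proof -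
    have "incseq (\<lambda>n. z n x)" using z_inc by (intro incseq_SucI)
    then show ?thesis using incseq_convergent[of "\<lambda>n. z n x" "K * K"] z_le by metis
  qed
  then obtain h where h: "\<And>x. (\<lambda>n. z n x) \<longlonglongrightarrow> h x" by metis
  have "v x \<le> h x" for x
  proof (rule LIMSEQ_le_const[OF h], intro exI allI impI)
    fix n
    show "v x \<le> z n x" by (induction n) (use z_inc in \<open>auto simp: z_def intro: order_trans\<close>)
  qed
  then have h_pos: "0 < h x" for x using v_pos[of x] by (meson less_le_trans)
  have "h \<in> holder_cone \<alpha> C" by (rule holder_cone_limit[OF z_cone h h_pos])
  then have "h \<in> holder_space \<alpha>" using C \<alpha> by (intro holder_cone_imp_holder) auto
  moreover have "L h x = \<rho> * h x" for x
    by (rule LIMSEQ_unique[OF weighted_transfer_tendsto[of z h, OF h]])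
       (use tendsto_mult_left[OF LIMSEQ_Suc[OF h], of \<rho> x] in \<open>simp add: z_Suc\<close>)
  ultimately show ?thesis using that h_pos \<rho> by blast
qed

end

section \<open>The normalized transfer operator\<close>

lemma continuous_circle_integrable:
  fixes f :: "circle \<Rightarrow> real"
  assumes "continuous_on UNIV f" "finite_measure \<mu>" "sets \<mu> = sets borel"
  shows "integrable \<mu> f"
proof -
  interpret finite_measure \<mu> by fact
  obtain B where "\<And>x. \<bar>f x\<bar> \<le> B" using continuous_circle_bounded[OF assms(1)] by blast
  then show ?thesis
    by (intro integrable_const_bound[of _ B])
       (auto simp: measurable_cong_sets[OF assms(3) refl] assms(1) borel_measurable_continuous_onI)
qed

lemma prob_integral_diff_le:
  fixes f f' :: "'a \<Rightarrow> real"
  assumes "prob_space \<mu>" "integrable \<mu> f" "integrable \<mu> f'" "\<And>x. \<bar>f x - f' x\<bar> \<le> e"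
  shows "\<bar>integral\<^sup>L \<mu> f - integral\<^sup>L \<mu> f'\<bar> \<le> e"
proof -
  interpret prob_space \<mu> by fact
  have "\<bar>integral\<^sup>L \<mu> f - integral\<^sup>L \<mu> f'\<bar> = \<bar>\<integral>x. f x - f' x \<partial>\<mu>\<bar>" using assms by simp
  also have "\<dots> \<le> (\<integral>x. \<bar>f x - f' x\<bar> \<partial>\<mu>)" by (rule integral_abs_bound)
  also have "\<dots> \<le> (\<integral>x. e \<partial>\<mu>)" using assms by (intro integral_mono) auto
  finally show ?thesis by (simp add: prob_space)
qed

locale normalized_potential = flat_potential +
  fixes h :: "circle \<Rightarrow> real" and \<rho> :: real
  assumes h_holder: "h \<in> holder_space \<alpha>" and h_pos: "0 < h x" and \<rho>_pos: "0 < \<rho>"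
    and eigen: "L h x = \<rho> * h x"
begin

text \<open>The Doob transform of the weight \<open>exp A\<close> by \<open>h\<close>: the
  eigenvalue equation makes its fibre sums equal to 1, so that \<open>g\<close> is a transition
  probability from a point to its preimages.\<close>

definition g :: "circle \<Rightarrow> real" where
  "g y = exp (A y) * h y / (\<rho> * h (T y))"

abbreviation Q :: "(circle \<Rightarrow> real) \<Rightarrow> circle \<Rightarrow> real" where
  "Q \<equiv> weighted_transfer g"

lemma continuous_h: "continuous_on UNIV h"
  using holder_continuous[OF h_holder \<alpha>(1)] .

lemma g_pos: "0 < g y"
  by (simp add: g_def h_pos \<rho>_pos)

lemma h_nonzero: "h x \<noteq> 0"
  using h_pos[of x] by simp

lemma continuous_g: "continuous_on UNIV g"
  unfolding g_def[abs_def]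
  by (intro continuous_intros continuous_A continuous_h continuous_on_compose2[OF continuous_h continuous_T])
     (use h_nonzero \<rho>_pos in auto)

lemma ln_g: "ln (g y) = A y + ln (h y) - ln (h (T y)) - ln \<rho>"
  using h_pos \<rho>_pos by (simp add: g_def ln_div ln_mult h_nonzero)

lemma Q_eq: "Q f x = L (\<lambda>y. h y * f y) x / (\<rho> * h x)"
  by (auto simp: weighted_transfer_def g_def sum_divide_distrib intro!: sum.cong)

lemma Q_one: "Q (\<lambda>_. 1) x = 1"
  using eigen[of x] h_pos[of x] \<rho>_pos by (simp add: Q_eq)

lemma Q_const: "Q (\<lambda>_. a) x = a"
  using weighted_transfer_cmult[of g a "\<lambda>_. 1" x] Q_one by simp

lemma Q_mono: "(\<And>y. f y \<le> f' y) \<Longrightarrow> Q f x \<le> Q f' x"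
  by (rule weighted_transfer_mono) (auto intro: less_imp_le g_pos)

lemma Q_le: "(\<And>y. f y \<le> a) \<Longrightarrow> Q f x \<le> a"
  using Q_mono[of f "\<lambda>_. a" x] Q_const[of a x] by simp

lemma Q_ge: "(\<And>y. a \<le> f y) \<Longrightarrow> a \<le> Q f x"
  using Q_mono[of "\<lambda>_. a" f x] Q_const[of a x] by simp

lemma continuous_Q: "continuous_on UNIV f \<Longrightarrow> continuous_on UNIV (Q f)"
  by (rule continuous_weighted_transfer[OF continuous_g])

lemma continuous_Q_iterate: "continuous_on UNIV f \<Longrightarrow> continuous_on UNIV ((Q ^^ n) f)"
  by (induction n) (simp_all add: continuous_Q)

lemma Q_iterate_le: "(\<And>y. f y \<le> a) \<Longrightarrow> (Q ^^ n) f x \<le> a"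
proof (induction n arbitrary: x)
  case (Suc n)
  then show ?case using Q_le[of "(Q ^^ n) f" a x] by simp
qed simp

lemma Q_iterate_ge: "(\<And>y. a \<le> f y) \<Longrightarrow> a \<le> (Q ^^ n) f x"
proof (induction n arbitrary: x)
  case (Suc n)
  then show ?case using Q_ge[of a "(Q ^^ n) f" x] by simp
qed simp

lemma Q_iterate_eq: "(Q ^^ n) f x = (L ^^ n) (\<lambda>y. h y * f y) x / (\<rho> ^ n * h x)"
proof (induction n arbitrary: x)
  case 0
  show ?case using h_nonzero by simp
next
  case (Suc n)
  have "(Q ^^ Suc n) f x = L (\<lambda>y. h y * (Q ^^ n) f y) x / (\<rho> * h x)" by (simp add: Q_eq)
  also have "(\<lambda>y. h y * (Q ^^ n) f y) = (\<lambda>y. (1 / \<rho> ^ n) * (L ^^ n) (\<lambda>y. h y * f y) y)"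
    using h_nonzero \<rho>_pos by (intro ext) (simp add: Suc field_simps)
  finally show ?case by (simp add: weighted_transfer_cmult[of _ "1 / \<rho> ^ n", simplified] field_simps)
qed

lemma Q_linear: "Q (\<lambda>y. a * f y + b * f' y) x = a * Q f x + b * Q f' x"
  by (rule weighted_transfer_linear)

lemma Q_iterate_linear: "(Q ^^ n) (\<lambda>y. a * f y + b * f' y) x = a * (Q ^^ n) f x + b * (Q ^^ n) f' x"
proof (induction n arbitrary: x)
  case (Suc n)
  have "(Q ^^ n) (\<lambda>y. a * f y + b * f' y) = (\<lambda>x. a * (Q ^^ n) f x + b * (Q ^^ n) f' x)"
    using Suc by blast
  then show ?case by (simp add: Q_linear)
qed simp

lemma Q_iterate_const: "(Q ^^ n) (\<lambda>_. a) x = a"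
  using Q_iterate_le[of "\<lambda>_. a" a n x] Q_iterate_ge[of a "\<lambda>_. a" n x] by simp

text \<open>By \<open>Q_iterate_eq\<close> an iterate of \<open>Q\<close> is an iterate of
  \<open>L\<close> divided by a multiple of \<open>h\<close>. The numerators stay in one cone for
  all \<open>n\<close>, and the quotient adds the constant of \<open>h\<close>.\<close>

lemma Q_equicontinuous:
  assumes f: "f \<in> holder_space \<alpha>" and e: "e > 0"
  obtains d where "d > 0" "\<And>n x y. dist x y < d \<Longrightarrow> \<bar>(Q ^^ n) f x - (Q ^^ n) f y\<bar> \<le> e"
proof -
  obtain B where B: "B > 0" "\<And>x. \<bar>f x\<bar> \<le> B"
    using continuous_circle_bounded[OF holder_continuous[OF f \<alpha>(1)]] by blast
  \<comment> \<open>A shift into the positive functions, where cones make sense; \<open>Q\<close>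
    fixes constants, so the shift cancels from differences.\<close>
  define f1 where "f1 x = f x + (B + 1)" for x
  have f1: "0 < f1 x" "f1 x \<le> 2 * B + 1" for x using B(2)[of x] by (auto simp: f1_def abs_le_iff)
  have "f1 \<in> holder_space \<alpha>"
    using f unfolding holder_space_def modulus_space_def by (simp add: f1_def)
  then have "(\<lambda>x. h x * f1 x) \<in> holder_space \<alpha>"
    using holder_mult[OF h_holder _ \<alpha>(1)] by blast
  then obtain D where D: "(\<lambda>x. h x * f1 x) \<in> holder_cone \<alpha> D"
    using holder_coneI[of _ \<alpha>] h_pos f1 \<alpha>(1) by (metis mult_pos_pos)
  obtain D' where D': "h \<in> holder_cone \<alpha> D'"
    using holder_coneI[OF h_holder h_pos \<alpha>(1)] by blast
  \<comment> \<open>One constant for the numerator and one for the denominator. The maximum with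
    \<open>C\<close> makes the numerator's cone invariant, the maximum with \<open>0\<close> keeps
    the sum nonnegative.\<close>
  define E where "E = max D C + max D' 0"
  have E: "0 \<le> E" using C by (simp add: E_def)
  have cone: "(Q ^^ n) f1 \<in> holder_cone \<alpha> E" for n
  proof -
    have num: "(L ^^ n) (\<lambda>x. h x * f1 x) \<in> holder_cone \<alpha> (max D C)"
      by (rule transfer_iterate_holder_cone[OF holder_cone_mono[OF D]]) auto
    have h': "h \<in> holder_cone \<alpha> (max D' 0)"
      by (rule holder_cone_mono[OF D']) auto
    have "(Q ^^ n) f1 x \<le> (Q ^^ n) f1 y * exp (E * dist x y powr \<alpha>)" for x y
    proof -
      let ?u = "dist x y powr \<alpha>"
      let ?N = "(L ^^ n) (\<lambda>x. h x * f1 x)"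
      have "h y \<le> h x * exp (max D' 0 * ?u)"
        using holder_coneD[OF h', of y x] by (simp add: dist_commute)
      then have "?N x * h y \<le> (?N y * exp (max D C * ?u)) * (h x * exp (max D' 0 * ?u))"
        using holder_coneD[OF num, of x y] holder_cone_pos[OF num] h_pos
        by (intro mult_mono) (auto intro: less_imp_le)
      also have "\<dots> = ?N y * h x * exp (E * ?u)"
        by (simp add: E_def exp_add distrib_right)
      finally show ?thesis
        using h_pos[of x] h_pos[of y] \<rho>_pos unfolding Q_iterate_eq by (simp add: field_simps)
    qed
    moreover have "0 < (Q ^^ n) f1 x" for x
      using holder_cone_pos[OF num, of x] h_pos[of x] \<rho>_pos unfolding Q_iterate_eq by simp
    ultimately show ?thesis by (auto simp: holder_cone_def)
  qed
  \<comment> \<open>The added 1 keeps \<open>H\<close> positive when \<open>E = 0\<close>, since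
    \<open>e / H\<close> is used below.\<close>
  define H where "H = (2 * B + 1) * exp E * E + 1"
  have H: "H > 0" using B E by (simp add: H_def add_nonneg_pos)
  have diff: "\<bar>(Q ^^ n) f x - (Q ^^ n) f y\<bar> \<le> H * dist x y powr \<alpha>" for n x y
  proof -
    have eq: "(Q ^^ n) f1 x = (Q ^^ n) f x + (B + 1)" for x
      using Q_iterate_linear[of n 1 f "B + 1" "\<lambda>_. 1" x] Q_iterate_const[of n 1 x]
      by (simp add: f1_def[abs_def])
    have "\<bar>(Q ^^ n) f1 x - (Q ^^ n) f1 y\<bar> \<le> (2 * B + 1) * exp E * E * dist x y powr \<alpha>"
      using holder_cone_abs_diff[OF cone E _ Q_iterate_le[of f1 "2 * B + 1"]] f1(2) \<alpha> by simp
    moreover have "0 \<le> dist x y powr \<alpha>" by simp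
    moreover have "(Q ^^ n) f x - (Q ^^ n) f y = (Q ^^ n) f1 x - (Q ^^ n) f1 y" by (simp add: eq)
    ultimately show ?thesis unfolding H_def distrib_right[of _ 1] by linarith
  qed
  obtain d where d: "d > 0" "\<And>r. 0 \<le> r \<Longrightarrow> r < d \<Longrightarrow> r powr \<alpha> < e / H"
    using powr_tendsto_0[OF \<alpha>(1), of "e / H"] e H by auto
  have "\<bar>(Q ^^ n) f x - (Q ^^ n) f y\<bar> \<le> e" if "dist x y < d" for n x y
  proof -
    have "H * dist x y powr \<alpha> \<le> e"
      using d(2)[of "dist x y"] that H by (simp add: field_simps less_imp_le)
    then show ?thesis using diff[of n x y] by linarith
  qed
  then show ?thesis using that d(1) by blast
qed

text \<open>Of each fibre sum only the summand on the orbit of \<open>y\<close> is kept.\<close>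

lemma Q_iterate_lower:
  assumes "0 < c" "\<And>y. c \<le> g y" "\<And>y. 0 \<le> f y"
  shows "c ^ n * f y \<le> (Q ^^ n) f ((T ^^ n) y)"
proof (induction n)
  case (Suc n)
  have nn: "0 \<le> (Q ^^ n) f z" for z by (rule Q_iterate_ge) (rule assms(3))
  have "c ^ Suc n * f y \<le> c * (Q ^^ n) f ((T ^^ n) y)"
    using Suc assms(1) by (simp add: mult.assoc)
  also have "\<dots> \<le> g ((T ^^ n) y) * (Q ^^ n) f ((T ^^ n) y)"
    by (intro mult_right_mono assms nn)
  also have "\<dots> \<le> Q ((Q ^^ n) f) (T ((T ^^ n) y))"
    by (rule weighted_transfer_ge) (auto intro: less_imp_le g_pos nn)
  finally show ?case by simp
qed simp

text \<open>
  Every point has, for a fixed large \<open>N\<close>, a \<open>T\<^sup>N\<close>-preimage at which \<open>Q\<^sup>n f\<close> is nearly minimal;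
  this shrinks the oscillation of \<open>Q\<^sup>n f\<close> by a definite factor in \<open>N\<close> steps.
\<close>

lemma Q_iterates_converge:
  assumes f: "f \<in> holder_space \<alpha>"
  obtains c where "\<And>x. (\<lambda>n. (Q ^^ n) f x) \<longlonglongrightarrow> c"
proof -
  have cont: "continuous_on UNIV ((Q ^^ n) f)" for n
    by (rule continuous_Q_iterate[OF holder_continuous[OF f \<alpha>(1)]])
  have "\<exists>x. \<forall>y. (Q ^^ n) f y \<le> (Q ^^ n) f x" for n
    using continuous_attains_sup[OF compact_circle _ cont[of n]] by auto
  then obtain xM where xM: "\<And>n y. (Q ^^ n) f y \<le> (Q ^^ n) f (xM n)" by metis
  have "\<exists>x. \<forall>y. (Q ^^ n) f x \<le> (Q ^^ n) f y" for n
    using continuous_attains_inf[OF compact_circle _ cont[of n]] by auto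
  then obtain xm where xm: "\<And>n y. (Q ^^ n) f (xm n) \<le> (Q ^^ n) f y" by metis
  define a where "a n = (Q ^^ n) f (xm n)" for n
  define b where "b n = (Q ^^ n) f (xM n)" for n
  have ab: "a n \<le> (Q ^^ n) f x" "(Q ^^ n) f x \<le> b n" for n x
    using xm xM by (auto simp: a_def b_def)
  have ab_le: "a n \<le> b n" for n using ab[of n "xM n"] by simp
  have inc: "a n \<le> a (Suc n)" for n
    unfolding a_def[of "Suc n"] using Q_ge[OF ab(1)[of n]] by simp
  have dec: "b (Suc n) \<le> b n" for n
    unfolding b_def[of "Suc n"] using Q_le[OF ab(2)[of n]] by simp
  have inc': "incseq a" using inc by (rule incseq_SucI)
  have dec': "decseq b" using dec by (rule decseq_SucI)
  have a_le: "a n \<le> b 0" for n using ab_le[of n] decseqD[OF dec', of 0 n] by simp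
  have b_ge: "a 0 \<le> b n" for n using ab_le[of n] incseqD[OF inc', of 0 n] by simp
  obtain la where la: "a \<longlonglongrightarrow> la" using incseq_convergent[OF inc', of "b 0"] a_le by blast
  obtain lb where lb: "b \<longlonglongrightarrow> lb" using decseq_convergent[OF dec', of "a 0"] b_ge by blast
  define l where "l = lb - la"
  have osc: "(\<lambda>n. b n - a n) \<longlonglongrightarrow> l" unfolding l_def by (intro tendsto_diff la lb)
  have l0: "0 \<le> l" by (rule LIMSEQ_le_const[OF osc]) (use ab_le in auto)
  have "l \<le> e" if e: "e > 0" for e
  proof -
    obtain d where d: "d > 0" "\<And>n x y. dist x y < d \<Longrightarrow> \<bar>(Q ^^ n) f x - (Q ^^ n) f y\<bar> \<le> e"
      using Q_equicontinuous[OF f e] by blast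
    obtain N where N: "\<And>x y. \<exists>z. (T ^^ N) z = y \<and> dist z x \<le> d / 2"
      using preimages_dense[of "d / 2"] d(1) by (metis half_gt_zero)
    obtain c where c: "c > 0" "\<And>y. c \<le> g y"
      using continuous_circle_bounded_below[OF continuous_g g_pos] by blast
    have step: "b (N + n) - a (N + n) \<le> (b n - a n) - c ^ N * (b n - a n - e)" for n
    proof -
      have "(Q ^^ (N + n)) f x \<le> b n - c ^ N * (b n - a n - e)" for x
      proof -
        obtain z where z: "(T ^^ N) z = x" "dist z (xm n) \<le> d / 2" using N by blast
        have "(Q ^^ n) f z \<le> a n + e"
          using d(2)[of z "xm n" n] z(2) d(1) by (simp add: a_def abs_le_iff)
        then have "c ^ N * (b n - a n - e) \<le> c ^ N * (b n - (Q ^^ n) f z)"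
          using c(1) by (intro mult_left_mono) auto
        also have "\<dots> \<le> (Q ^^ N) (\<lambda>y. b n - (Q ^^ n) f y) x"
          using Q_iterate_lower[OF c, of "\<lambda>y. b n - (Q ^^ n) f y" N z] ab(2) z(1) by simp
        also have "\<dots> = b n - (Q ^^ (N + n)) f x"
          using Q_iterate_linear[of N "b n" "\<lambda>_. 1" "-1" "(Q ^^ n) f" x] Q_iterate_const[of N 1 x]
          by (simp add: funpow_add)
        finally show ?thesis by simp
      qed
      then have "b (N + n) \<le> b n - c ^ N * (b n - a n - e)" unfolding b_def[of "N + n"] .
      moreover have "a n \<le> a (N + n)" by (rule incseqD[OF inc']) simp
      ultimately show ?thesis by simp
    qed
    \<comment> \<open>\<open>N\<close> and \<open>c\<close> depend on \<open>e\<close> and the maps,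
      but not on \<open>n\<close>, so the one-block inequality passes to the limit and reads
      \<open>l \<le> l - c ^ N * (l - e)\<close>, which forces \<open>l \<le> e\<close>.\<close>
    have "(\<lambda>n. b (n + N) - a (n + N)) \<longlonglongrightarrow> l" by (rule LIMSEQ_ignore_initial_segment[OF osc])
    moreover have "(\<lambda>n. (b n - a n) - c ^ N * (b n - a n - e)) \<longlonglongrightarrow> l - c ^ N * (l - e)"
      by (intro tendsto_intros osc)
    ultimately have "l \<le> l - c ^ N * (l - e)"
      by (rule LIMSEQ_le) (use step in \<open>simp add: add.commute\<close>)
    then have "c ^ N * (l - e) \<le> 0" by simp
    then show "l \<le> e" using c(1) zero_less_power[OF c(1), of N] by (simp add: mult_le_0_iff)
  qed
  then have "l \<le> 0" by (rule field_le_epsilon) simp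
  then have "l = 0" using l0 by simp
  then have "la = lb" by (simp add: l_def)
  then have lim: "(\<lambda>n. (Q ^^ n) f x) \<longlonglongrightarrow> la" for x
    using la lb ab by (auto intro!: tendsto_sandwich[of a "\<lambda>n. (Q ^^ n) f x" sequentially b])
  show ?thesis by (rule that[OF lim])
qed

section \<open>The invariant probability of the normalized operator\<close>

definition Q_invariant :: "circle measure \<Rightarrow> bool" where
  "Q_invariant \<mu> \<longleftrightarrow> prob_space \<mu> \<and> sets \<mu> = sets borel \<and>
     (\<forall>f. continuous_on UNIV f \<longrightarrow> integral\<^sup>L \<mu> (Q f) = integral\<^sup>L \<mu> f)"

text \<open>Lipschitz functions are \<open>\<alpha>\<close>-Holder because
  \<open>\<alpha> \<le> 1\<close>, they are uniformly dense, and \<open>Q\<close> does not increase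
  uniform distances.\<close>

lemma Q_invariantI:
  assumes \<mu>: "prob_space \<mu>" "sets \<mu> = sets borel"
    and inv: "\<And>f. f \<in> holder_space \<alpha> \<Longrightarrow> integral\<^sup>L \<mu> (Q f) = integral\<^sup>L \<mu> f"
  shows "Q_invariant \<mu>"
  unfolding Q_invariant_def
proof (intro conjI allI impI \<mu>)
  fix f :: "circle \<Rightarrow> real" assume f: "continuous_on UNIV f"
  interpret prob_space \<mu> by fact
  note int = continuous_circle_integrable[OF _ finite_measure_axioms \<mu>(2)]
  have "\<bar>integral\<^sup>L \<mu> (Q f) - integral\<^sup>L \<mu> f\<bar> \<le> e" if e: "e > 0" for e
  proof -
    obtain f' K where f': "\<And>x y. \<bar>f' x - f' y\<bar> \<le> K * dist x y" "\<And>x. \<bar>f x - f' x\<bar> \<le> e / 2"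
      using lipschitz_approximation[OF compact_circle f half_gt_zero[OF e]] by blast
    have hol: "f' \<in> holder_space \<alpha>" by (rule lipschitz_imp_holder[OF f'(1) \<alpha>(2)])
    have f'c: "continuous_on UNIV f'" by (rule holder_continuous[OF hol \<alpha>(1)])
    have "\<bar>Q f x - Q f' x\<bar> \<le> e / 2" for x
    proof -
      have eq: "Q (\<lambda>y. f y - f' y) x = Q f x - Q f' x"
        using Q_linear[of 1 f "-1" f' x] by simp
      have d: "f y - f' y \<le> e / 2" "- (e / 2) \<le> f y - f' y" for y using f'(2)[of y] by linarith+
      show ?thesis using Q_le[of "\<lambda>y. f y - f' y", OF d(1), of x]
        Q_ge[of _ "\<lambda>y. f y - f' y", OF d(2), of x] unfolding eq by linarith
    qed
    then have "\<bar>integral\<^sup>L \<mu> (Q f) - integral\<^sup>L \<mu> (Q f')\<bar> \<le> e / 2"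
      by (intro prob_integral_diff_le \<mu> int continuous_Q f f'c)
    moreover have "\<bar>integral\<^sup>L \<mu> f - integral\<^sup>L \<mu> f'\<bar> \<le> e / 2"
      by (intro prob_integral_diff_le \<mu> int f f'c f'(2))
    ultimately show ?thesis using inv[OF hol] by linarith
  qed
  then have "\<bar>integral\<^sup>L \<mu> (Q f) - integral\<^sup>L \<mu> f\<bar> \<le> 0" 
    by (rule field_le_epsilon) simp
  then show "integral\<^sup>L \<mu> (Q f) = integral\<^sup>L \<mu> f" by simp
qed

lemma Q_invariant_iterate:
  assumes "Q_invariant \<mu>" "continuous_on UNIV f"
  shows "integral\<^sup>L \<mu> ((Q ^^ n) f) = integral\<^sup>L \<mu> f"
proof (induction n)
  case (Suc n)
  then show ?case using assms continuous_Q_iterate[OF assms(2), of n] by (simp add: Q_invariant_def)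
qed simp

lemma Q_invariant_integral:
  assumes \<mu>: "Q_invariant \<mu>" and f: "f \<in> holder_space \<alpha>" and c: "\<And>x. (\<lambda>n. (Q ^^ n) f x) \<longlonglongrightarrow> c"
  shows "integral\<^sup>L \<mu> f = c"
proof -
  interpret prob_space \<mu> using \<mu> by (simp add: Q_invariant_def)
  have sets: "sets \<mu> = sets borel" using \<mu> by (simp add: Q_invariant_def)
  have f': "continuous_on UNIV f" by (rule holder_continuous[OF f \<alpha>(1)])
  obtain B where B: "\<And>x. \<bar>f x\<bar> \<le> B" using continuous_circle_bounded[OF f'] by blast
  have "(\<lambda>n. integral\<^sup>L \<mu> ((Q ^^ n) f)) \<longlonglongrightarrow> (\<integral>x. c \<partial>\<mu>)"
  proof (rule integral_dominated_convergence[where w = "\<lambda>_. B"])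
    show "(Q ^^ n) f \<in> borel_measurable \<mu>" for n
      using continuous_Q_iterate[OF f', of n]
      by (simp add: measurable_cong_sets[OF sets refl] borel_measurable_continuous_onI)
    have "\<bar>(Q ^^ n) f x\<bar> \<le> B" for n x
    proof -
      have "f y \<le> B" "- B \<le> f y" for y using B[of y] by (simp_all add: abs_le_iff)
      then have "(Q ^^ n) f x \<le> B" "- B \<le> (Q ^^ n) f x" by (auto intro: Q_iterate_le Q_iterate_ge)
      then show ?thesis by (simp add: abs_le_iff)
    qed
    then show "AE x in \<mu>. norm ((Q ^^ n) f x) \<le> B" for n by simp
  qed (use c in auto)
  then have "(\<lambda>n. integral\<^sup>L \<mu> f) \<longlonglongrightarrow> c"
    by (simp add: Q_invariant_iterate[OF \<mu> f'] prob_space)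
  then show ?thesis by (simp add: LIMSEQ_const_iff)
qed

text \<open>The integral of a Lipschitz function is forced to be the constant to which its iterates
  under \<open>Q\<close> converge.\<close>

lemma Q_invariant_unique:
  assumes "Q_invariant \<mu>" "Q_invariant \<nu>"
  shows "\<mu> = \<nu>"
proof (rule finite_measure_eqI_lipschitz)
  fix f :: "circle \<Rightarrow> real" and K assume "\<And>x y. \<bar>f x - f y\<bar> \<le> K * dist x y"
  then have f: "f \<in> holder_space \<alpha>" by (rule lipschitz_imp_holder[OF _ \<alpha>(2)])
  obtain c where "\<And>x. (\<lambda>n. (Q ^^ n) f x) \<longlonglongrightarrow> c" by (rule Q_iterates_converge[OF f]) blast
  then show "integral\<^sup>L \<mu> f = integral\<^sup>L \<nu> f"
    using Q_invariant_integral[OF assms(1) f] Q_invariant_integral[OF assms(2) f] by metis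
qed (use assms in \<open>auto simp: Q_invariant_def intro: prob_space.finite_measure\<close>)

text \<open>The transition law of the backward random walk: from \<open>x\<close> to one of its
  preimages \<open>y\<close> with probability \<open>g y\<close>.\<close>

definition fibre_pmf :: "circle \<Rightarrow> circle pmf" where
  "fibre_pmf x = embed_pmf (\<lambda>y. if T y = x then g y else 0)"

lemma fibre_pmf:
  "finite (set_pmf (fibre_pmf x))" "measure_pmf.expectation (fibre_pmf x) f = Q f x"
proof -
  let ?p = "\<lambda>y. if T y = x then g y else 0"
  have nonneg: "0 \<le> ?p y" for y using g_pos[of y] by (simp add: less_imp_le)
  have "(\<integral>\<^sup>+y. ennreal (?p y) \<partial>count_space UNIV) = (\<integral>\<^sup>+y. ennreal (?p y) * indicator (T -` {x}) y \<partial>count_space UNIV)"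
    by (intro nn_integral_cong) (auto simp: indicator_def)
  also have "\<dots> = (\<Sum>y\<in>T -` {x}. ennreal (?p y))"
    by (subst nn_integral_indicator_finite[OF finite_fibre]) (auto intro!: sum.cong)
  also have "\<dots> = ennreal (\<Sum>y\<in>T -` {x}. ?p y)" by (rule sum_ennreal) (rule nonneg)
  also have "(\<Sum>y\<in>T -` {x}. ?p y) = Q (\<lambda>_. 1) x"
    unfolding weighted_transfer_def by (intro sum.cong) auto
  finally have one: "(\<integral>\<^sup>+y. ennreal (?p y) \<partial>count_space UNIV) = 1" by (simp add: Q_one)
  have pmf: "pmf (fibre_pmf x) y = ?p y" for y
    unfolding fibre_pmf_def by (rule pmf_embed_pmf[OF nonneg one])
  then have supp: "set_pmf (fibre_pmf x) \<subseteq> T -` {x}" by (auto simp: set_pmf_eq)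
  then show "finite (set_pmf (fibre_pmf x))" by (rule finite_subset[OF _ finite_fibre])
  have "measure_pmf.expectation (fibre_pmf x) f = (\<Sum>y\<in>T -` {x}. f y * pmf (fibre_pmf x) y)"
    by (rule integral_measure_pmf_real[OF finite_fibre]) (use supp in auto)
  also have "\<dots> = Q f x"
    unfolding weighted_transfer_def by (intro sum.cong) (auto simp: pmf)
  finally show "measure_pmf.expectation (fibre_pmf x) f = Q f x" .
qed

text \<open>The law of the backward walk after \<open>n\<close> steps from the origin. It realizes
  the functional \<open>f \<mapsto> (Q ^^ n) f (to_circle 0)\<close> by a finitely supported
  probability, so that weak compactness applies to these functionals.\<close>

primrec chain :: "nat \<Rightarrow> circle pmf" where
  "chain 0 = return_pmf (to_circle 0)"
| "chain (Suc n) = bind_pmf (chain n) fibre_pmf"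

lemma chain:
  "finite (set_pmf (chain n))" "measure_pmf.expectation (chain n) f = (Q ^^ n) f (to_circle 0)"
proof (induction n arbitrary: f)
  case (Suc n)
  { case 1 then show ?case using Suc.IH(1) fibre_pmf(1) by simp }
  { case 2
    have "measure_pmf.expectation (chain (Suc n)) f
      = (\<Sum>x\<in>set_pmf (chain n). pmf (chain n) x *\<^sub>R measure_pmf.expectation (fibre_pmf x) f)"
      unfolding chain.simps by (rule pmf_expectation_bind) (use Suc.IH(1) fibre_pmf(1) in auto)
    also have "\<dots> = (\<Sum>x\<in>set_pmf (chain n). Q f x * pmf (chain n) x)"
      by (simp add: fibre_pmf(2) mult.commute)
    also have "\<dots> = measure_pmf.expectation (chain n) (Q f)"
      by (rule integral_measure_pmf_real[symmetric]) (use Suc.IH(1) in auto)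
    also have "\<dots> = (Q ^^ Suc n) f (to_circle 0)" by (simp add: Suc.IH(2) funpow_swap1)
    finally show ?case . }
qed auto

text \<open>A weak limit of the laws of the backward walk, read on the line through
  \<open>coord\<close>. Mass may accumulate at 1, where \<open>coord\<close> jumps; this does no
  harm, since \<open>to_circle\<close> identifies 1 with 0 and the test functions
  \<open>f (to_circle t)\<close> are continuous there. Invariance holds because \<open>f\<close> and
  \<open>Q f\<close> have the same limit under iteration.\<close>

lemma Q_invariant_exists: obtains \<mu> where "Q_invariant \<mu>"
proof -
  define \<nu> where "\<nu> n = distr (measure_pmf (chain n)) borel coord" for n
  have rd: "real_distribution (\<nu> n)" for n
    unfolding \<nu>_def by (rule prob_space.real_distribution_distr[OF prob_space_measure_pmf]) simp
  have "tight \<nu>"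
    unfolding tight_def
  proof (intro conjI allI impI rd)
    fix \<epsilon> :: real assume "\<epsilon> > 0"
    have "measure (\<nu> n) {-1<..1} = 1" for n
    proof -
      have "coord -` {-1<..1} = UNIV"
        using coord_bounds by (auto simp: less_imp_le intro!: less_le_trans[of "-1" 0 "coord _"])
      then show ?thesis unfolding \<nu>_def by (subst measure_distr) auto
    qed
    then show "\<exists>a b. a < b \<and> (\<forall>n. 1 - \<epsilon> < measure (\<nu> n) {a<..b})"
      using \<open>\<epsilon> > 0\<close> by (intro exI[of _ "-1"] exI[of _ 1]) auto
  qed
  then obtain r M where r: "strict_mono (r :: nat \<Rightarrow> nat)" "real_distribution M" "weak_conv_m (\<nu> \<circ> id \<circ> r) M"
    using tight_imp_convergent_subsubsequence[of \<nu> id] by (auto simp: strict_mono_id)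
  interpret M: real_distribution M by fact
  define \<mu> where "\<mu> = distr M borel to_circle"
  have c_meas: "to_circle \<in> borel_measurable M"
    using to_circle_measurable by (simp add: measurable_cong_sets[OF M.events_eq_borel refl])
  have \<mu>: "prob_space \<mu>" "sets \<mu> = sets borel"
    unfolding \<mu>_def by (rule M.prob_space_distr[OF c_meas]) simp
  have conv: "(\<lambda>n. (Q ^^ r n) f (to_circle 0)) \<longlonglongrightarrow> integral\<^sup>L \<mu> f" if f: "continuous_on UNIV f" for f
  proof -
    obtain B where B: "\<And>x. \<bar>f x\<bar> \<le> B" using continuous_circle_bounded[OF f] by blast
    have fc: "continuous_on UNIV (\<lambda>t. f (to_circle t))"
      by (rule continuous_on_compose2[OF f]) (auto intro!: continuous_intros)
    have fm: "f \<in> borel_measurable borel" by (rule borel_measurable_continuous_onI[OF f])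
    have "(\<lambda>n. integral\<^sup>L ((\<nu> \<circ> id \<circ> r) n) (\<lambda>t. f (to_circle t))) \<longlonglongrightarrow> integral\<^sup>L M (\<lambda>t. f (to_circle t))"
      by (rule weak_conv_imp_integral_bdd_continuous_conv[where B = B])
         (use rd r fc B in \<open>auto simp: continuous_on_eq_continuous_at o_def\<close>)
    moreover have "integral\<^sup>L (\<nu> n) (\<lambda>t. f (to_circle t)) = (Q ^^ n) f (to_circle 0)" for n
    proof -
      have "integral\<^sup>L (\<nu> n) (\<lambda>t. f (to_circle t)) = measure_pmf.expectation (chain n) (\<lambda>x. f (to_circle (coord x)))"
        unfolding \<nu>_def by (rule integral_distr[OF _ borel_measurable_continuous_onI[OF fc]]) simp
      then show ?thesis unfolding to_circle_coord chain(2) .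
    qed
    moreover have "integral\<^sup>L \<mu> f = integral\<^sup>L M (\<lambda>t. f (to_circle t))"
      unfolding \<mu>_def by (rule integral_distr[OF c_meas fm])
    ultimately show ?thesis by simp
  qed
  have "Q_invariant \<mu>"
  proof (rule Q_invariantI[OF \<mu>])
    fix f assume f: "f \<in> holder_space \<alpha>"
    then have fc: "continuous_on UNIV f" by (rule holder_continuous[OF _ \<alpha>(1)])
    obtain c where c: "\<And>x. (\<lambda>n. (Q ^^ n) f x) \<longlonglongrightarrow> c" by (rule Q_iterates_converge[OF f]) blast
    have "(\<lambda>n. (Q ^^ r n) f (to_circle 0)) \<longlonglongrightarrow> c"
      using LIMSEQ_subseq_LIMSEQ[OF c r(1)] by (simp add: o_def)
    then have 1: "integral\<^sup>L \<mu> f = c" using conv[OF fc] LIMSEQ_unique by blast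
    have "(\<lambda>n. (Q ^^ Suc n) f (to_circle 0)) \<longlonglongrightarrow> c" by (rule LIMSEQ_Suc[OF c])
    then have "(\<lambda>n. (Q ^^ r n) (Q f) (to_circle 0)) \<longlonglongrightarrow> c"
      using LIMSEQ_subseq_LIMSEQ[OF _ r(1)] by (force simp: o_def funpow_swap1)
    then have "integral\<^sup>L \<mu> (Q f) = c" using conv[OF continuous_Q[OF fc]] LIMSEQ_unique by blast
    then show "integral\<^sup>L \<mu> (Q f) = integral\<^sup>L \<mu> f" using 1 by simp
  qed
  then show ?thesis using that by blast
qed

text \<open>Dual form of \<open>Q (\<phi> \<cdot> (f \<circ> T)) = f \<cdot> Q \<phi>\<close>.\<close>

lemma Q_invariant_distr:
  assumes \<mu>: "Q_invariant \<mu>" and \<phi>: "continuous_on UNIV \<phi>" "\<And>x. 0 \<le> \<phi> x"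
  shows "distr (density \<mu> (\<lambda>x. ennreal (\<phi> x))) borel T = density \<mu> (\<lambda>x. ennreal (Q \<phi> x))"
proof (rule finite_measure_eqI_lipschitz)
  interpret prob_space \<mu> using \<mu> by (simp add: Q_invariant_def)
  have sets: "sets \<mu> = sets borel" using \<mu> by (simp add: Q_invariant_def)
  note meas = measurable_cong_sets[OF sets refl]
  have Q\<phi>: "continuous_on UNIV (Q \<phi>)" "0 \<le> Q \<phi> x" for x
    using continuous_Q[OF \<phi>(1)] Q_ge[OF \<phi>(2)] by auto
  have fin: "finite_measure (density \<mu> (\<lambda>x. ennreal (\<psi> x)))"
    if "continuous_on UNIV \<psi>" "\<And>x. 0 \<le> \<psi> x" for \<psi>
  proof (rule finite_measureI)
    have "integrable \<mu> \<psi>" by (rule continuous_circle_integrable[OF that(1) finite_measure_axioms sets])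
    then show "emeasure (density \<mu> (\<lambda>x. ennreal (\<psi> x))) (space (density \<mu> (\<lambda>x. ennreal (\<psi> x)))) \<noteq> \<infinity>"
      using that by (subst emeasure_density)
        (auto simp: meas borel_measurable_continuous_onI nn_integral_eq_integral cong: nn_integral_cong)
  qed
  have T: "T \<in> measurable (density \<mu> (\<lambda>x. ennreal (\<phi> x))) borel"
    using T_borel by (simp add: measurable_cong_sets[OF sets refl])
  show "finite_measure (distr (density \<mu> (\<lambda>x. ennreal (\<phi> x))) borel T)"
    by (rule finite_measure.finite_measure_distr[OF fin[OF \<phi>] T])
  show "finite_measure (density \<mu> (\<lambda>x. ennreal (Q \<phi> x)))" by (rule fin[OF Q\<phi>])
  fix f :: "circle \<Rightarrow> real" and K assume "\<And>x y. \<bar>f x - f y\<bar> \<le> K * dist x y"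
  then have f: "continuous_on UNIV f"
    by (intro holder_continuous[OF lipschitz_imp_holder[OF _ \<alpha>(2)] \<alpha>(1)])
  have fT: "continuous_on UNIV (\<lambda>x. f (T x))"
    by (rule continuous_on_compose2[OF f continuous_T]) auto
  have "integral\<^sup>L (distr (density \<mu> (\<lambda>x. ennreal (\<phi> x))) borel T) f
    = (\<integral>x. f (T x) \<partial>density \<mu> (\<lambda>x. ennreal (\<phi> x)))"
    using f by (intro integral_distr[OF T] borel_measurable_continuous_onI)
  also have "\<dots> = (\<integral>x. \<phi> x *\<^sub>R f (T x) \<partial>\<mu>)"
    using fT \<phi> by (intro integral_density) (auto simp: meas borel_measurable_continuous_onI)
  also have "\<dots> = (\<integral>x. f (T x) * \<phi> x \<partial>\<mu>)" by (simp add: mult.commute)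
  also have "\<dots> = integral\<^sup>L \<mu> (Q (\<lambda>x. f (T x) * \<phi> x))"
    using \<mu> continuous_on_mult[OF fT \<phi>(1)] by (simp add: Q_invariant_def)
  also have "\<dots> = (\<integral>x. Q \<phi> x *\<^sub>R f x \<partial>\<mu>)"
  proof -
    have "Q (\<lambda>x. f (T x) * \<phi> x) = (\<lambda>x. f x * Q \<phi> x)" by (intro ext weighted_transfer_compose)
    then show ?thesis by (simp add: mult.commute)
  qed
  also have "\<dots> = integral\<^sup>L (density \<mu> (\<lambda>x. ennreal (Q \<phi> x))) f"
    using f Q\<phi> by (intro integral_density[symmetric]) (auto simp: meas borel_measurable_continuous_onI)
  finally show "integral\<^sup>L (distr (density \<mu> (\<lambda>x. ennreal (\<phi> x))) borel T) f
    = integral\<^sup>L (density \<mu> (\<lambda>x. ennreal (Q \<phi> x))) f" .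
qed (use \<mu> in \<open>auto simp: Q_invariant_def\<close>)

lemma Q_invariant_imp_invariant:
  assumes \<mu>: "Q_invariant \<mu>"
  shows "invariant_prob T \<mu>"
proof -
  have sets: "sets \<mu> = sets borel" and p: "prob_space \<mu>" using \<mu> by (auto simp: Q_invariant_def)
  have "distr (density \<mu> (\<lambda>x. ennreal 1)) borel T = density \<mu> (\<lambda>x. ennreal (Q (\<lambda>_. 1) x))"
    by (rule Q_invariant_distr[OF \<mu>]) auto
  then have "distr \<mu> borel T = \<mu>" by (simp add: Q_one density_1)
  moreover have "distr \<mu> \<mu> T = distr \<mu> borel T" by (rule distr_cong) (auto simp: sets)
  moreover have "T \<in> measurable \<mu> \<mu>" using T_borel by (simp add: measurable_cong_sets[OF sets sets])
  ultimately show ?thesis using p sets by (simp add: invariant_prob_def)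
qed

end

section \<open>Entropy bounds\<close>

context circle_lift
begin

lemma circle_systemI:
  assumes "invariant_prob T \<nu>" "finite_measurable_partition \<nu> P"
  shows "circle_system \<nu> T P"
  using assms unfolding circle_system_def circle_system_axioms_def partitioned_system_def
    partitioned_system_axioms_def invariant_prob_def by auto

text \<open>The numbers \<open>V ws x\<close>, for a fixed point \<open>x\<close>, form a
  subprobability on the words of length \<open>n\<close>: kernels sum to at most 1 over the cells,
  weights to at most 1 over each fibre. Gibbs' inequality then bounds the block entropy. For the
  itinerary of \<open>y\<close>, the sum \<open>V\<close> contains the term of a preimage of
  \<open>x\<close> whose orbit shadows that of \<open>y\<close>, so its logarithm is at least the
  Birkhoff sum of \<open>\<phi>\<close> up to \<open>n * \<eta>\<close> and a bounded error.\<close>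

lemma entropy_of_partition_le_weight:
  assumes \<nu>: "invariant_prob T \<nu>" and P: "finite_measurable_partition \<nu> P"
    and w: "continuous_on UNIV w" "\<And>x. 0 < w x" and sub: "\<And>x. weighted_transfer w (\<lambda>_. 1) x \<le> 1"
  shows "entropy_of_partition \<nu> T P \<le> - (\<integral>x. ln (w x) \<partial>\<nu>)"
proof (rule field_le_epsilon)
  fix e :: real assume "e > 0"
  \<comment> \<open>Half of \<open>e\<close> is spent on replacing cells by kernels, half on the
    oscillation of \<open>\<phi>\<close> between shadowing orbits.\<close>
  define \<eta> where "\<eta> = e / 2"
  have \<eta>: "\<eta> > 0" using \<open>e > 0\<close> by (simp add: \<eta>_def)
  interpret circle_system \<nu> T P by (rule circle_systemI[OF \<nu> P])
  obtain k where k: "\<And>c. c \<in> P \<Longrightarrow> continuous_on UNIV (k c)" "\<And>c x. c \<in> P \<Longrightarrow> 0 < k c x"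
    "\<And>x. (\<Sum>c\<in>P. k c x) \<le> 1"
    "integrable \<nu> (\<lambda>x. ln (k (cell x) x))" "- \<eta> \<le> (\<integral>x. ln (k (cell x) x) \<partial>\<nu>)"
    using continuous_kernels[OF \<eta>] by blast
  \<comment> \<open>At \<open>x\<close> this sums, over the preimages of order
    \<open>length cs\<close>, the product of the weights and of the kernels of the letters along the
    orbit down to \<open>x\<close>. The most recent letter belongs to the last point before
    \<open>x\<close>, hence to the outermost operator.\<close>
  define V where "V cs = foldr (\<lambda>c. weighted_transfer (\<lambda>z. w z * k c z)) cs (\<lambda>_. 1)" for cs
  have V_Nil: "V [] = (\<lambda>_. 1)" and V_Cons: "V (c # cs) = weighted_transfer (\<lambda>z. w z * k c z) (V cs)" for c cs
    by (simp_all add: V_def)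
  have V_pos: "0 < V cs x" if "set cs \<subseteq> P" for cs x
    using that
  proof (induction cs arbitrary: x)
    case (Cons c cs)
    then show ?case unfolding V_Cons by (intro weighted_transfer_pos mult_pos_pos w k) auto
  qed (simp add: V_Nil)
  have V_sum: "(\<Sum>ws\<in>words n. V ws x) \<le> 1" for n x
  proof (induction n arbitrary: x)
    case 0
    have "words 0 = {[]}" by (auto simp: words_def)
    then show ?case by (simp add: V_Nil)
  next
    case (Suc n)
    have "(\<Sum>ws\<in>words (Suc n). V ws x) = (\<Sum>(c, ws)\<in>P \<times> words n. V (c # ws) x)"
      unfolding words_Suc by (subst sum.reindex) (auto simp: inj_on_def intro!: sum.cong)
    also have "\<dots> = (\<Sum>c\<in>P. \<Sum>ws\<in>words n. \<Sum>z\<in>T -` {x}. w z * k c z * V ws z)"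
      by (simp only: sum.cartesian_product[symmetric] V_Cons weighted_transfer_def)
    also have "\<dots> = (\<Sum>c\<in>P. \<Sum>z\<in>T -` {x}. \<Sum>ws\<in>words n. w z * k c z * V ws z)"
      by (intro sum.cong refl sum.swap)
    also have "\<dots> = (\<Sum>z\<in>T -` {x}. \<Sum>c\<in>P. \<Sum>ws\<in>words n. w z * k c z * V ws z)"
      by (rule sum.swap)
    also have "\<dots> = (\<Sum>z\<in>T -` {x}. w z * ((\<Sum>c\<in>P. k c z) * (\<Sum>ws\<in>words n. V ws z)))"
      by (simp only: sum_product) (simp only: sum_distrib_left mult.assoc)
    also have "\<dots> \<le> (\<Sum>z\<in>T -` {x}. w z * 1)"
    proof (intro sum_mono mult_left_mono)
      fix z
      have "0 \<le> (\<Sum>ws\<in>words n. V ws z)"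
        using V_pos by (intro sum_nonneg) (simp add: words_def less_imp_le)
      then show "(\<Sum>c\<in>P. k c z) * (\<Sum>ws\<in>words n. V ws z) \<le> 1"
        using k(3)[of z] Suc[of z] by (intro mult_le_one)
      show "0 \<le> w z" using w(2)[of z] by simp
    qed
    also have "\<dots> \<le> 1" using sub[of x] by (simp add: weighted_transfer_def)
    finally show ?case .
  qed
  define \<phi> where "\<phi> c z = ln (w z) + ln (k c z)" for c z
  have \<phi>_cont: "continuous_on UNIV (\<phi> c)" if "c \<in> P" for c
    unfolding \<phi>_def using w k(1,2)[OF that]
    by (intro continuous_intros) (auto simp: less_imp_neq[THEN not_sym])
  have exp_\<phi>: "exp (\<phi> c z) = w z * k c z" if "c \<in> P" for c z
    using w(2)[of z] k(2)[OF that, of z] by (simp add: \<phi>_def exp_add)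
  have "\<exists>B. \<forall>c\<in>P. \<forall>z. \<bar>\<phi> c z\<bar> \<le> B"
  proof -
    have "\<exists>B. \<forall>z. \<bar>\<phi> c z\<bar> \<le> B" if "c \<in> P" for c
      using continuous_circle_bounded[OF \<phi>_cont[OF that]] by metis
    then obtain b where b: "\<And>c z. c \<in> P \<Longrightarrow> \<bar>\<phi> c z\<bar> \<le> b c" by metis
    have "b c \<le> (\<Sum>c\<in>P. \<bar>b c\<bar>)" if "c \<in> P" for c
      using member_le_sum[OF that _ finite_P, of "\<lambda>c. \<bar>b c\<bar>"] by simp
    then show ?thesis using b by (meson order_trans)
  qed
  then obtain B where B: "\<And>c z. c \<in> P \<Longrightarrow> \<bar>\<phi> c z\<bar> \<le> B" by blast
  have "\<exists>d>0. \<forall>c\<in>P. \<forall>z z'. dist z z' < d \<longrightarrow> \<bar>\<phi> c z - \<phi> c z'\<bar> \<le> \<eta>"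
  proof -
    have "\<exists>d>0. \<forall>z z'. dist z z' < d \<longrightarrow> \<bar>\<phi> c z - \<phi> c z'\<bar> \<le> \<eta>" if "c \<in> P" for c
    proof -
      have "uniformly_continuous_on UNIV (\<phi> c)"
        by (rule compact_uniformly_continuous[OF \<phi>_cont[OF that] compact_circle])
      then show ?thesis using \<eta> unfolding uniformly_continuous_on_def dist_real_def
        by (metis UNIV_I dist_commute less_imp_le)
    qed
    then obtain d where d: "\<And>c. c \<in> P \<Longrightarrow> d c > 0"
      "\<And>c z z'. c \<in> P \<Longrightarrow> dist z z' < d c \<Longrightarrow> \<bar>\<phi> c z - \<phi> c z'\<bar> \<le> \<eta>" by metis
    have "Min (insert 1 (d ` P)) > 0" using finite_P d(1) by (subst Min_gr_iff) auto
    moreover have "Min (insert 1 (d ` P)) \<le> d c" if "c \<in> P" for c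
      using finite_P that by (intro Min_le) auto
    ultimately show ?thesis using d(2) by (intro exI[of _ "Min (insert 1 (d ` P))"]) (meson less_le_trans)
  qed
  then obtain d where d: "d > 0" "\<And>c z z'. c \<in> P \<Longrightarrow> dist z z' < d \<Longrightarrow> \<bar>\<phi> c z - \<phi> c z'\<bar> \<le> \<eta>" by blast
  define \<epsilon> where "\<epsilon> = min (d / 2) 1"
  have \<epsilon>: "0 < \<epsilon>" "\<epsilon> \<le> 1" "\<epsilon> < d" using d(1) by (auto simp: \<epsilon>_def)
  obtain \<theta> where \<theta>: "0 < \<theta>" "\<theta> < 1" "\<And>t s. \<bar>t - s\<bar> \<le> 1 \<Longrightarrow> \<bar>G t - G s\<bar> \<le> max \<epsilon> (\<theta> * \<bar>t - s\<bar>)"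
    using contraction[OF \<epsilon>(1)] by blast
  obtain J where J: "\<theta> ^ J < \<epsilon>" using real_arch_pow_inv[OF \<epsilon>(1) \<theta>(2)] by blast
  have small: "max \<epsilon> (\<theta> ^ j) < d" if "J \<le> j" for j
  proof -
    have "\<theta> ^ j \<le> \<theta> ^ J" using that \<theta>(1,2) by (intro power_decreasing) auto
    then show ?thesis using J \<epsilon> by simp
  qed
  define S where "S n y = (\<Sum>i<n. \<phi> (cell ((T ^^ i) y)) ((T ^^ i) y))" for n y
  \<comment> \<open>\<open>J\<close> inverse steps bring lifts within distance 1 so close that
    \<open>\<phi>\<close> varies by at most \<open>\<eta>\<close>. \<open>D j\<close> is the price
    still to be paid after \<open>j\<close> steps: \<open>2 * B\<close> for each missing one.
    Truncated subtraction makes it vanish from \<open>J\<close> on.\<close>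
  define D where "D j = 2 * B * real (J - j)" for j
  text \<open>The preimage of \<open>x\<close> along the inverse branch that follows the orbit of \<open>y\<close> shadows this orbit.\<close>
  have shadow: "exp (S n y - (n * \<eta> + D j)) \<le> V (word n y) (to_circle t)"
    if "to_circle s = (T ^^ n) y" "\<bar>t - s\<bar> \<le> max \<epsilon> (\<theta> ^ j)" for n j y t s
    using that
  proof (induction n arbitrary: j t s)
    case 0
    have "0 \<le> B" using B[OF cell(1), of y y] by simp
    then show ?case by (simp add: S_def D_def V_Nil)
  next
    case (Suc n)
    define c where "c = cell ((T ^^ n) y)"
    have c: "c \<in> P" unfolding c_def by (rule cell(1)) simp
    have "(T ^^ n) y \<in> T -` {to_circle s}" using Suc.prems(1) by simp
    then obtain i where i: "(T ^^ n) y = to_circle (G (s + real i))"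
      unfolding fibre(1) by auto
    define z where "z = to_circle (G (t + real i))"
    have close: "\<bar>G (t + real i) - G (s + real i)\<bar> \<le> max \<epsilon> (\<theta> ^ Suc j)"
      by (rule G_iterate_le[OF \<epsilon>(1,2) \<theta>]) (use Suc.prems(2) in auto)
    have IH: "exp (S n y - (n * \<eta> + D (Suc j))) \<le> V (word n y) z"
      unfolding z_def by (rule Suc.IH[OF i[symmetric] close])
    have Tz: "T z = to_circle t"
      using T_G[of "t + real i"] to_circle_add_int[of t "int i"] by (simp add: z_def)
    have "\<phi> c ((T ^^ n) y) - (\<eta> + (D j - D (Suc j))) \<le> \<phi> c z"
    proof (cases "J \<le> Suc j")
      case True
      have "dist z ((T ^^ n) y) \<le> \<bar>G (t + real i) - G (s + real i)\<bar>"
        unfolding z_def i by (rule dist_to_circle_le)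
      also have "\<dots> < d" using close small[OF True] by linarith
      finally have "\<bar>\<phi> c z - \<phi> c ((T ^^ n) y)\<bar> \<le> \<eta>" by (rule d(2)[OF c])
      moreover have "0 \<le> B" using B[OF c, of z] by simp
      then have "D (Suc j) \<le> D j" by (simp add: D_def mult_left_mono)
      ultimately show ?thesis by (simp add: abs_le_iff)
    next
      case False
      then have "D j - D (Suc j) = 2 * B" by (simp add: D_def of_nat_diff algebra_simps)
      then show ?thesis using B[OF c, of z] B[OF c, of "(T ^^ n) y"] \<eta> by (simp add: abs_le_iff)
    qed
    then have "S (Suc n) y - (Suc n * \<eta> + D j) \<le> \<phi> c z + (S n y - (n * \<eta> + D (Suc j)))"
      by (simp add: S_def c_def algebra_simps)
    then have "exp (S (Suc n) y - (Suc n * \<eta> + D j)) \<le> exp (\<phi> c z) * exp (S n y - (n * \<eta> + D (Suc j)))"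
      by (simp flip: exp_add)
    also have "\<dots> \<le> exp (\<phi> c z) * V (word n y) z" by (intro mult_left_mono IH) auto
    also have "\<dots> = (w z * k c z) * V (word n y) z" by (simp add: exp_\<phi>[OF c])
    also have "\<dots> \<le> V (c # word n y) (T z)"
      unfolding V_Cons
      using w(2) k(2)[OF c] V_pos[of "word n y"] word_in_words[of y n]
      by (intro weighted_transfer_ge) (auto simp: words_def less_imp_le)
    finally show ?case by (simp add: Tz c_def)
  qed
  define \<psi> where "\<psi> y = \<phi> (cell y) y" for y
  have int_w: "integrable \<nu> (\<lambda>x. ln (w x))"
    using w by (intro continuous_integrable continuous_intros) (auto simp: less_imp_neq[THEN not_sym])
  have int_\<psi>: "integrable \<nu> \<psi>" unfolding \<psi>_def \<phi>_def using int_w k(4) by simp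
  have int_\<psi>': "integrable \<nu> (\<lambda>y. \<psi> ((T ^^ i) y))" for i
  proof -
    have "integrable (distr \<nu> \<nu> (T ^^ i)) \<psi>" unfolding invariant_funpow by (rule int_\<psi>)
    then show ?thesis
      by (subst (asm) integrable_distr_eq) (use int_\<psi> in \<open>auto intro: borel_measurable_integrable\<close>)
  qed
  have int_S: "integrable \<nu> (S n)" "integral\<^sup>L \<nu> (S n) = n * integral\<^sup>L \<nu> \<psi>" for n
  proof -
    have S_eq: "S n = (\<lambda>y. \<Sum>i<n. \<psi> ((T ^^ i) y))" by (simp add: S_def[abs_def] \<psi>_def)
    show "integrable \<nu> (S n)" unfolding S_eq by (intro Bochner_Integration.integrable_sum int_\<psi>')
    show "integral\<^sup>L \<nu> (S n) = n * integral\<^sup>L \<nu> \<psi>"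
      unfolding S_eq using integral_funpow[OF borel_measurable_integrable[OF int_\<psi>]]
      by (simp add: Bochner_Integration.integral_sum int_\<psi>')
  qed
  have "block_entropy n \<le> n * (- (\<integral>x. ln (w x) \<partial>\<nu>) + e) + D 0" for n
  proof -
    \<comment> \<open>The evaluation point is the same for all \<open>y\<close>, as the
      subprobability in Gibbs' inequality must not depend on the orbit; any point of the circle has
      a lift within 1/2 of a given one, so shadowing starts at \<open>j = 0\<close>.\<close>
    have "S n y - (n * \<eta> + D 0) \<le> ln (V (word n y) (to_circle 0))" for y
    proof -
      obtain s where "to_circle s = (T ^^ n) y" "\<bar>0 - s\<bar> = dist (to_circle 0) ((T ^^ n) y)"
        by (rule lift_near)
      then have "exp (S n y - (n * \<eta> + D 0)) \<le> V (word n y) (to_circle 0)"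
        using shadow[of s n y 0 0] dist_circle_le_half[of "to_circle 0" "(T ^^ n) y"] by simp
      then show ?thesis by (subst ln_ge_iff) (auto intro: less_le_trans[OF exp_gt_zero])
    qed
    then have "(\<integral>y. S n y - (n * \<eta> + D 0) \<partial>\<nu>) \<le> (\<integral>y. ln (V (word n y) (to_circle 0)) \<partial>\<nu>)"
      by (intro integral_mono Bochner_Integration.integrable_diff int_S
          integral_word(3)[of "\<lambda>ws. ln (V ws (to_circle 0))"]) auto
    moreover have "block_entropy n \<le> - (\<integral>y. ln (V (word n y) (to_circle 0)) \<partial>\<nu>)"
      using V_sum V_pos by (intro block_entropy_le) (auto simp: words_def less_imp_le)
    moreover have "(\<integral>y. S n y - (n * \<eta> + D 0) \<partial>\<nu>) = n * integral\<^sup>L \<nu> \<psi> - (n * \<eta> + D 0)"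
      using prob_space int_S by simp
    moreover have "integral\<^sup>L \<nu> \<psi> = (\<integral>x. ln (w x) \<partial>\<nu>) + (\<integral>x. ln (k (cell x) x) \<partial>\<nu>)"
      unfolding \<psi>_def \<phi>_def using int_w k(4) by simp
    then have "real n * ((\<integral>x. ln (w x) \<partial>\<nu>) - \<eta>) \<le> n * integral\<^sup>L \<nu> \<psi>"
      using k(5) by (intro mult_left_mono) auto
    moreover have "real n * (- (\<integral>x. ln (w x) \<partial>\<nu>) + e) = - (real n * ((\<integral>x. ln (w x) \<partial>\<nu>) - \<eta>)) + n * \<eta>"
      by (simp add: \<eta>_def algebra_simps)
    ultimately show ?thesis by linarith
  qed
  then show "entropy_of_partition \<nu> T P \<le> - (\<integral>x. ln (w x) \<partial>\<nu>) + e"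
    by (rule entropy_of_partition_le)
qed

lemma KS_entropy_le_weight:
  assumes "invariant_prob T \<nu>" "continuous_on UNIV w" "\<And>x. 0 < w x" "\<And>x. weighted_transfer w (\<lambda>_. 1) x \<le> 1"
  shows "KS_entropy \<nu> T \<le> ereal (- (\<integral>x. ln (w x) \<partial>\<nu>))"
  unfolding KS_entropy_def
  by (intro SUP_least) (auto intro!: entropy_of_partition_le_weight assms)

end

section \<open>The lower entropy bound for the invariant probability of the normalized
  operator\<close>

lemma interval_partition:
  assumes "N > (0::nat)"
  obtains P where "finite P" "P \<subseteq> sets borel" "partition_on (UNIV :: circle set) P"
    "\<And>c x y. c \<in> P \<Longrightarrow> x \<in> c \<Longrightarrow> y \<in> c \<Longrightarrow> dist x y < 1 / N"
proof -
  define I where "I i = coord -` {real i / N..<(real i + 1) / N}" for i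
  have I_iff: "x \<in> I i \<longleftrightarrow> nat \<lfloor>N * coord x\<rfloor> = i" for x i
  proof -
    have "x \<in> I i \<longleftrightarrow> real i \<le> N * coord x \<and> N * coord x < real i + 1"
      using assms by (simp add: I_def field_simps)
    also have "\<dots> \<longleftrightarrow> \<lfloor>N * coord x\<rfloor> = int i" by (simp add: floor_eq_iff)
    also have "\<dots> \<longleftrightarrow> nat \<lfloor>N * coord x\<rfloor> = i"
      using coord_bounds(1)[of x] by auto
    finally show ?thesis .
  qed
  have "nat \<lfloor>N * coord x\<rfloor> < N" for x
  proof -
    have "N * coord x < N" using coord_bounds(2)[of x] assms by simp
    then show ?thesis using coord_bounds(1)[of x] by (simp add: floor_less_iff nat_less_iff)
  qed
  then have cover: "\<Union> (I ` {..<N}) = UNIV" using I_iff by auto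
  have ne: "I i \<noteq> {}" if "i < N" for i
  proof -
    have "real i / N < 1" using that by simp
    then have "coord (to_circle (real i / N)) = real i / N" by (simp add: frac_eq)
    then have "to_circle (real i / N) \<in> I i" using assms by (simp add: I_def divide_strict_right_mono)
    then show ?thesis by blast
  qed
  show ?thesis
  proof (rule that[of "I ` {..<N}"])
    show "I ` {..<N} \<subseteq> sets borel"
      unfolding I_def using measurable_sets[OF coord_measurable] by (force simp: image_subset_iff)
    show "partition_on UNIV (I ` {..<N})"
    proof -
      have "{} \<notin> I ` {..<N}" using ne by (metis image_iff lessThan_iff)
      moreover have "disjoint (I ` {..<N})" using I_iff by (auto simp: disjoint_def)
      ultimately show ?thesis using cover by (simp add: partition_on_def)
    qed
    show "dist x y < 1 / N" if c: "c \<in> I ` {..<N}" "x \<in> c" "y \<in> c" for c x y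
    proof -
      obtain i where "x \<in> I i" "y \<in> I i" using c by blast
      then have "\<bar>coord x - coord y\<bar> < (real i + 1) / N - real i / N" by (auto simp: I_def abs_less_iff)
      also have "\<dots> = 1 / N" by (simp flip: diff_divide_distrib)
      finally show ?thesis by (auto simp: dist_circle_def)
    qed
  qed simp
qed

context normalized_potential
begin

lemma continuous_ln_g: "continuous_on UNIV (\<lambda>x. ln (g x))"
  using g_pos by (intro continuous_intros continuous_g) (auto simp: less_imp_neq[THEN not_sym])

text \<open>On a small cell \<open>g\<close> is the inverse Jacobian of \<open>T\<close>. The
  indicator of \<open>c\<close> is dominated by a bump \<open>\<phi>\<close>, to which the duality
  \<open>Q_invariant_distr\<close> applies; by injectivity each fibre meets the support of
  \<open>\<phi>\<close> at most once, so \<open>Q \<phi>\<close> is bounded by a single value of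
  \<open>g\<close>.\<close>

lemma cell_measure_bound:
  assumes \<mu>: "Q_invariant \<mu>" and c: "c \<in> sets borel" "c \<noteq> {}" and r: "r > 0"
    and inj: "\<And>x y. T x = T y \<Longrightarrow> dist x y < 3 * r \<Longrightarrow> x = y"
    and osc: "\<And>x y. dist x y < 3 * r \<Longrightarrow> \<bar>ln (g x) - ln (g y)\<bar> \<le> \<eta>"
    and diam: "\<And>x y. x \<in> c \<Longrightarrow> y \<in> c \<Longrightarrow> dist x y < r"
  obtains s where "0 < s" "\<And>y. y \<in> c \<Longrightarrow> ln s \<le> \<eta> + ln (g y)"
    "\<And>E. E \<in> sets borel \<Longrightarrow> measure \<mu> (c \<inter> T -` E) \<le> s * measure \<mu> E"
proof -
  interpret prob_space \<mu> using \<mu> by (simp add: Q_invariant_def)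
  have sets: "sets \<mu> = sets borel" using \<mu> by (simp add: Q_invariant_def)
  have space: "space \<mu> = UNIV" using sets_eq_imp_space_eq[OF sets] by simp
  \<comment> \<open>The support reaches less than \<open>r\<close> beyond a cell of diameter at most
    \<open>r\<close>, so two of its points are less than \<open>3 * r\<close> apart; this is the
    radius in the hypotheses.\<close>
  define \<phi> where "\<phi> x = max 0 (1 - infdist x c / r)" for x
  have \<phi>: "continuous_on UNIV \<phi>" "\<And>x. 0 \<le> \<phi> x" "\<And>x. \<phi> x \<le> 1" "\<And>x. x \<in> c \<Longrightarrow> \<phi> x = 1"
    unfolding \<phi>_def using r by (auto intro!: continuous_intros simp: infdist_nonneg)
  have supp: "\<exists>u\<in>c. dist x u < r" if "\<phi> x \<noteq> 0" for x
  proof -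
    have "infdist x c < r" using that r by (auto simp: \<phi>_def max_def field_simps split: if_splits)
    then show ?thesis unfolding infdist_notempty[OF c(2)]
      by (subst (asm) cINF_less_iff) (use c(2) in auto)
  qed
  obtain m0 where m0: "m0 > 0" "\<And>x. m0 \<le> g x"
    using continuous_circle_bounded_below[OF continuous_g g_pos] by blast
  define s where "s = exp \<eta> * (INF y\<in>c. g y)"
  have bdd: "bdd_below (g ` c)" using m0(2) by (intro bdd_belowI[of _ m0]) auto
  have "m0 \<le> (INF y\<in>c. g y)" using c(2) m0(2) by (intro cINF_greatest) auto
  then have s_pos: "0 < s" using m0(1) by (simp add: s_def)
  have s_le: "ln s \<le> \<eta> + ln (g y)" if "y \<in> c" for y
  proof -
    have "s \<le> exp \<eta> * g y" unfolding s_def using that by (intro mult_left_mono cINF_lower bdd) auto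
    then have "ln s \<le> ln (exp \<eta> * g y)" using s_pos g_pos[of y] by (subst ln_le_cancel_iff) auto
    also have "\<dots> = \<eta> + ln (g y)" using g_pos[of y] by (simp add: ln_mult)
    finally show ?thesis .
  qed
  have Q\<phi>: "Q \<phi> x \<le> s" for x
  proof (cases "\<exists>z\<in>T -` {x}. \<phi> z \<noteq> 0")
    case True
    then obtain z where z: "T z = x" "\<phi> z \<noteq> 0" by auto
    obtain u where u: "u \<in> c" "dist z u < r" using supp[OF z(2)] by blast
    have "\<phi> z' = 0" if z': "T z' = x" "z' \<noteq> z" for z'
    proof (rule ccontr)
      assume "\<phi> z' \<noteq> 0"
      then obtain u' where u': "u' \<in> c" "dist z' u' < r" using supp by blast
      have "dist z' z \<le> dist z' u' + dist u' u + dist z u"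
        using dist_triangle[of z' z u'] dist_triangle[of u' z u] by (simp add: dist_commute)
      also have "\<dots> < 3 * r" using u u' diam[OF u'(1) u(1)] by simp
      finally have "z' = z" using inj z(1) z'(1) by blast
      then show False using z'(2) by simp
    qed
    then have "Q \<phi> x = (\<Sum>y\<in>T -` {x}. if y = z then g z * \<phi> z else 0)"
      unfolding weighted_transfer_def by (intro sum.cong) auto
    also have "\<dots> = g z * \<phi> z" using z(1) finite_fibre by simp
    also have "\<dots> \<le> g z" using \<phi>(3)[of z] g_pos[of z] by (simp add: mult_left_le)
    also have "g z \<le> s"
    proof -
      have "exp (- \<eta>) * g z \<le> g y" if "y \<in> c" for y
      proof -
        have "dist z y < 3 * r" using dist_triangle[of z y u] u diam[OF u(1) that] r by linarith
        from osc[OF this] have "ln (g z) - \<eta> \<le> ln (g y)" by (simp add: abs_le_iff)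
        then have "exp (ln (g z) - \<eta>) \<le> exp (ln (g y))" by simp
        then show ?thesis using g_pos[of z] g_pos[of y] by (simp add: exp_diff exp_minus field_simps)
      qed
      then have "exp (- \<eta>) * g z \<le> (INF y\<in>c. g y)" using c(2) by (intro cINF_greatest)
      then show ?thesis by (simp add: s_def exp_minus field_simps)
    qed
    finally show ?thesis .
  next
    case False
    then have "Q \<phi> x = 0" unfolding weighted_transfer_def by (intro sum.neutral) auto
    then show ?thesis using s_pos by simp
  qed
  have "measure \<mu> (c \<inter> T -` E) \<le> s * measure \<mu> E" if E: "E \<in> sets borel" for E
  proof -
    have TE: "T -` E \<in> sets borel" using measurable_sets[OF T_borel E] by simp
    have meas: "(\<lambda>x. ennreal (\<psi> x)) \<in> borel_measurable \<mu>" if "continuous_on UNIV \<psi>" for \<psi> :: "circle \<Rightarrow> real"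
      using borel_measurable_continuous_onI[OF that] by (simp add: measurable_cong_sets[OF sets refl])
    have "emeasure \<mu> (c \<inter> T -` E) = (\<integral>\<^sup>+x. indicator (c \<inter> T -` E) x \<partial>\<mu>)"
      using c TE by (subst nn_integral_indicator) (auto simp: sets)
    also have "\<dots> \<le> (\<integral>\<^sup>+x. ennreal (\<phi> x) * indicator (T -` E) x \<partial>\<mu>)"
      using \<phi>(4) by (intro nn_integral_mono) (auto simp: indicator_def)
    also have "\<dots> = emeasure (density \<mu> (\<lambda>x. ennreal (\<phi> x))) (T -` E)"
      using TE by (subst emeasure_density[OF meas[OF \<phi>(1)]]) (auto simp: sets)
    also have "\<dots> = emeasure (distr (density \<mu> (\<lambda>x. ennreal (\<phi> x))) borel T) E"
      using T_borel E by (subst emeasure_distr) (auto simp: measurable_cong_sets[OF sets refl] space)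
    also have "\<dots> = emeasure (density \<mu> (\<lambda>x. ennreal (Q \<phi> x))) E"
      by (simp add: Q_invariant_distr[OF \<mu> \<phi>(1,2)])
    also have "\<dots> = (\<integral>\<^sup>+x. ennreal (Q \<phi> x) * indicator E x \<partial>\<mu>)"
      using E by (subst emeasure_density[OF meas[OF continuous_Q[OF \<phi>(1)]]]) (auto simp: sets)
    also have "\<dots> \<le> (\<integral>\<^sup>+x. ennreal s * indicator E x \<partial>\<mu>)"
      using Q\<phi> by (intro nn_integral_mono mult_right_mono ennreal_leI) auto
    also have "\<dots> = ennreal s * emeasure \<mu> E"
      using E by (subst nn_integral_cmult_indicator) (auto simp: sets)
    also have "\<dots> = ennreal (s * measure \<mu> E)"
      using s_pos by (simp add: emeasure_eq_measure ennreal_mult)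
    finally show ?thesis using s_pos by (simp add: emeasure_eq_measure)
  qed
  then show ?thesis using that s_pos s_le by blast
qed

text \<open>Removing the oldest letter of a word costs one factor \<open>s c\<close>, so a cylinder
  has measure at most the product of these factors. On the cylinder of \<open>y\<close> the
  logarithm of the product is at most the Birkhoff sum of \<open>ln g\<close> plus
  \<open>n * \<eta>\<close>, and integration bounds the block entropies from below.\<close>

lemma entropy_Q_invariant_ge:
  assumes \<mu>: "Q_invariant \<mu>" and \<eta>: "\<eta> > 0"
  obtains P where "finite_measurable_partition \<mu> P" "- (\<eta> + (\<integral>x. ln (g x) \<partial>\<mu>)) \<le> entropy_of_partition \<mu> T P"
proof -
  have inv: "invariant_prob T \<mu>" by (rule Q_invariant_imp_invariant[OF \<mu>])
  have sets: "sets \<mu> = sets borel" using \<mu> by (simp add: Q_invariant_def)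
  obtain d1 where d1: "d1 > 0" "\<And>x y. T x = T y \<Longrightarrow> dist x y < d1 \<Longrightarrow> x = y"
    using locally_injective by blast
  have "uniformly_continuous_on UNIV (\<lambda>x. ln (g x))"
    by (rule compact_uniformly_continuous[OF continuous_ln_g compact_circle])
  then obtain d2 where d2: "d2 > 0" "\<And>x y. dist x y < d2 \<Longrightarrow> \<bar>ln (g x) - ln (g y)\<bar> \<le> \<eta>"
    using \<eta> unfolding uniformly_continuous_on_def dist_real_def
    by (metis UNIV_I dist_commute less_imp_le)
  obtain N :: nat where N: "N > 0" "3 * (1 / real N) < min d1 d2"
  proof -
    define d where "d = min d1 d2"
    have d: "d > 0" using d1(1) d2(1) by (simp add: d_def)
    obtain n :: nat where n: "real n > 3 / d" using reals_Archimedean2 by blast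
    moreover have "3 / d > 0" using d by simp
    ultimately have "real n > 0" by linarith
    moreover have "3 * (1 / real n) < d" using n d \<open>real n > 0\<close> by (simp add: field_simps)
    ultimately show ?thesis using that unfolding d_def by simp
  qed
  obtain P where P: "finite P" "P \<subseteq> sets borel" "partition_on (UNIV :: circle set) P"
    "\<And>c x y. c \<in> P \<Longrightarrow> x \<in> c \<Longrightarrow> y \<in> c \<Longrightarrow> dist x y < 1 / N"
    using interval_partition[OF N(1)] by blast
  have fmp: "finite_measurable_partition \<mu> P"
    using P sets sets_eq_imp_space_eq[OF sets] by (simp add: finite_measurable_partition_def)
  interpret circle_system \<mu> T P by (rule circle_systemI[OF inv fmp])
  have "\<exists>s>0. (\<forall>y\<in>c. ln s \<le> \<eta> + ln (g y)) \<and> (\<forall>E\<in>sets borel. measure \<mu> (c \<inter> T -` E) \<le> s * measure \<mu> E)"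
    if "c \<in> P" for c
  proof -
    have c: "c \<in> sets borel" "c \<noteq> {}" using that P(2,3) by (auto simp: partition_on_def)
    have Npos: "0 < 1 / real N" using N(1) by simp
    have inj: "x = y" if "T x = T y" "dist x y < 3 * (1 / real N)" for x y
      using d1(2)[OF that(1)] that(2) N(2) by simp
    have osc: "\<bar>ln (g x) - ln (g y)\<bar> \<le> \<eta>" if "dist x y < 3 * (1 / real N)" for x y
      using d2(2) that N(2) by simp
    show ?thesis
    proof (rule cell_measure_bound[OF \<mu> c Npos inj osc P(4)[OF that]])
      fix s assume "0 < s" "\<And>y. y \<in> c \<Longrightarrow> ln s \<le> \<eta> + ln (g y)"
        "\<And>E. E \<in> sets borel \<Longrightarrow> measure \<mu> (c \<inter> T -` E) \<le> s * measure \<mu> E"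
      then show ?thesis by blast
    qed
  qed
  then obtain s where s: "\<And>c. c \<in> P \<Longrightarrow> 0 < s c" "\<And>c y. c \<in> P \<Longrightarrow> y \<in> c \<Longrightarrow> ln (s c) \<le> \<eta> + ln (g y)"
    "\<And>c E. c \<in> P \<Longrightarrow> E \<in> sets borel \<Longrightarrow> measure \<mu> (c \<inter> T -` E) \<le> s c * measure \<mu> E"
    by metis
  define q where "q ws = (\<Prod>c\<leftarrow>ws. s c)" for ws
  have q_pos: "0 < q ws" if "set ws \<subseteq> P" for ws
    using that by (induction ws) (auto simp: q_def s(1))
  have cyl: "prob (cylinder n ws) \<le> q ws" if "ws \<in> words n" for n ws
    using that
  proof (induction ws arbitrary: n rule: rev_induct)
    case Nil
    then show ?case by (simp add: q_def)
  next
    case (snoc c ws)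
    define m where "m = length ws"
    have c: "c \<in> P" and ws: "ws \<in> words m" and n: "n = 1 + m" using snoc.prems by (auto simp: words_def m_def)
    have "cylinder 1 [c] = c" using cylinder_Suc[OF c, of 0 "[]"] by (simp add: cylinder_0)
    then have "cylinder n (ws @ [c]) = c \<inter> T -` cylinder m ws"
      unfolding n cylinder_add[OF m_def[symmetric]] by auto
    then have "prob (cylinder n (ws @ [c])) \<le> s c * prob (cylinder m ws)"
      using s(3)[OF c] sets_cylinder[OF ws] sets by simp
    also have "\<dots> \<le> s c * q ws" using snoc.IH[OF ws] s(1)[OF c] by (intro mult_left_mono) auto
    finally show ?case by (simp add: q_def mult.commute)
  qed
  have ln_q: "ln (q (word n y)) \<le> (\<Sum>i<n. \<eta> + ln (g ((T ^^ i) y)))" for n y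
  proof (induction n)
    case 0
    then show ?case by (simp add: q_def)
  next
    case (Suc n)
    let ?c = "cell ((T ^^ n) y)"
    have c: "?c \<in> P" "(T ^^ n) y \<in> ?c" using cell[of "(T ^^ n) y"] by auto
    have qp: "0 < q (word n y)" using q_pos word_in_words[of y n] by (auto simp: words_def)
    have "ln (q (word (Suc n) y)) = ln (s ?c * q (word n y))" by (simp add: q_def)
    also have "\<dots> = ln (s ?c) + ln (q (word n y))"
      using s(1)[OF c(1)] qp by (simp add: ln_mult)
    finally show ?case using s(2)[OF c] Suc by simp
  qed
  have int_g: "integrable \<mu> (\<lambda>x. ln (g x))" by (rule continuous_integrable[OF continuous_ln_g])
  have int_g': "integrable \<mu> (\<lambda>x. ln (g ((T ^^ i) x)))" for i
  proof -
    have "integrable (distr \<mu> \<mu> (T ^^ i)) (\<lambda>x. ln (g x))" unfolding invariant_funpow by (rule int_g)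
    then show ?thesis
      by (subst (asm) integrable_distr_eq) (use int_g in \<open>auto intro: borel_measurable_integrable\<close>)
  qed
  have "n * (- (\<eta> + (\<integral>x. ln (g x) \<partial>\<mu>))) \<le> block_entropy n" for n
  proof -
    have "prob (cylinder n ws) * ln (prob (cylinder n ws)) \<le> prob (cylinder n ws) * ln (q ws)"
      if "ws \<in> words n" for ws
    proof (cases "prob (cylinder n ws) = 0")
      case False
      then have "0 < prob (cylinder n ws)" by (simp add: zero_less_measure_iff)
      then have "ln (prob (cylinder n ws)) \<le> ln (q ws)"
        using cyl[OF that] by (subst ln_le_cancel_iff) auto
      then show ?thesis by (intro mult_left_mono) auto
    qed simp
    then have "- block_entropy n \<le> (\<Sum>ws\<in>words n. prob (cylinder n ws) * ln (q ws))"
      unfolding block_entropy_def by (simp add: sum_mono)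
    also have "\<dots> = (\<integral>x. ln (q (word n x)) \<partial>\<mu>)"
      by (rule integral_word(1)[of "\<lambda>ws. ln (q ws)", symmetric])
    also have "\<dots> \<le> (\<integral>x. (\<Sum>i<n. \<eta> + ln (g ((T ^^ i) x))) \<partial>\<mu>)"
      by (intro integral_mono integral_word(3)[of "\<lambda>ws. ln (q ws)"] ln_q
          Bochner_Integration.integrable_sum Bochner_Integration.integrable_add int_g') simp
    also have "\<dots> = (\<Sum>i<n. \<integral>x. \<eta> + ln (g ((T ^^ i) x)) \<partial>\<mu>)"
      by (intro Bochner_Integration.integral_sum Bochner_Integration.integrable_add int_g') simp
    also have "\<dots> = n * (\<eta> + (\<integral>x. ln (g x) \<partial>\<mu>))"
      using integral_funpow[OF borel_measurable_integrable[OF int_g]] int_g' prob_space by simp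
    finally show ?thesis unfolding mult_minus_right by linarith
  qed
  then have "- (\<eta> + (\<integral>x. ln (g x) \<partial>\<mu>)) \<le> entropy_of_partition \<mu> T P"
    by (rule le_entropy_of_partition)
  then show ?thesis using that fmp by blast
qed

lemma KS_entropy_Q_invariant_ge:
  assumes "Q_invariant \<mu>"
  shows "ereal (- (\<integral>x. ln (g x) \<partial>\<mu>)) \<le> KS_entropy \<mu> T"
proof (rule ereal_le_epsilon2)
  fix e :: real assume "e > 0"
  obtain P where P: "finite_measurable_partition \<mu> P"
    "- (e + (\<integral>x. ln (g x) \<partial>\<mu>)) \<le> entropy_of_partition \<mu> T P"
    by (rule entropy_Q_invariant_ge[OF assms \<open>e > 0\<close>])
  have "ereal (- (\<integral>x. ln (g x) \<partial>\<mu>)) \<le> ereal (entropy_of_partition \<mu> T P) + ereal e" using P(2) by simp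
  also have "\<dots> \<le> KS_entropy \<mu> T + ereal e"
    unfolding KS_entropy_def using P(1) by (intro add_right_mono SUP_upper) auto
  finally show "ereal (- (\<integral>x. ln (g x) \<partial>\<mu>)) \<le> KS_entropy \<mu> T + ereal e" .
qed

end

section \<open>Equilibrium states of flat potentials\<close>

context normalized_potential
begin

lemma integral_ln_g:
  assumes \<nu>: "invariant_prob T \<nu>"
  shows "(\<integral>x. ln (g x) \<partial>\<nu>) = (\<integral>x. A x \<partial>\<nu>) - ln \<rho>"
proof -
  interpret prob_space \<nu> using \<nu> by (simp add: invariant_prob_def)
  have sets: "sets \<nu> = sets borel" and T: "T \<in> measurable \<nu> \<nu>" and inv: "distr \<nu> \<nu> T = \<nu>"
    using \<nu> by (auto simp: invariant_prob_def)
  have lnh: "continuous_on UNIV (\<lambda>x. ln (h x))"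
    using h_nonzero by (intro continuous_intros continuous_h) auto
  have lnhT: "continuous_on UNIV (\<lambda>x. ln (h (T x)))"
    by (rule continuous_on_compose2[OF lnh continuous_T]) auto
  note int = continuous_circle_integrable[OF _ finite_measure_axioms sets]
  have "(\<integral>x. ln (h (T x)) \<partial>\<nu>) = (\<integral>x. ln (h x) \<partial>\<nu>)"
    using integral_distr[OF T, of "\<lambda>x. ln (h x)"] borel_measurable_continuous_onI[OF lnh]
    by (simp add: inv measurable_cong_sets[OF sets refl])
  then show ?thesis
    unfolding ln_g using int[OF continuous_A] int[OF lnh] int[OF lnhT] prob_space by simp
qed

lemma KS_entropy_invariant_le:
  assumes "invariant_prob T \<nu>"
  shows "KS_entropy \<nu> T \<le> ereal (- (\<integral>x. ln (g x) \<partial>\<nu>))"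
  by (rule KS_entropy_le_weight[OF assms continuous_g g_pos]) (simp add: Q_one)

lemma free_energy_le:
  assumes "invariant_prob T \<nu>"
  shows "free_energy T A \<nu> \<le> ereal (ln \<rho>)"
proof -
  have "free_energy T A \<nu> \<le> ereal (- (\<integral>x. ln (g x) \<partial>\<nu>)) + ereal (\<integral>x. A x \<partial>\<nu>)"
    unfolding free_energy_def by (intro add_right_mono KS_entropy_invariant_le assms)
  then show ?thesis by (simp add: integral_ln_g[OF assms])
qed

lemma free_energy_Q_invariant:
  assumes "Q_invariant \<mu>"
  shows "free_energy T A \<mu> = ereal (ln \<rho>)"
proof (rule antisym)
  have inv: "invariant_prob T \<mu>" by (rule Q_invariant_imp_invariant[OF assms])
  show "free_energy T A \<mu> \<le> ereal (ln \<rho>)" by (rule free_energy_le[OF inv])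
  have "ereal (- (\<integral>x. ln (g x) \<partial>\<mu>)) + ereal (\<integral>x. A x \<partial>\<mu>) \<le> free_energy T A \<mu>"
    unfolding free_energy_def by (intro add_right_mono KS_entropy_Q_invariant_ge assms)
  then show "ereal (ln \<rho>) \<le> free_energy T A \<mu>" by (simp add: integral_ln_g[OF inv])
qed

text \<open>
  If the weight \<open>g\<close> attains the entropy bound for \<open>\<nu>\<close>, then the perturbed weights \<open>g (1 + t \<psi>)\<close> with
  \<open>\<psi> = \<phi> - (Q \<phi>) \<circ> T\<close>, which are again normalized since \<open>Q \<psi> = 0\<close>, cannot improve it to first order.
\<close>

lemma maximal_free_energy_imp_Q_invariant:
  assumes \<nu>: "invariant_prob T \<nu>" and max: "ereal (ln \<rho>) \<le> free_energy T A \<nu>"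
  shows "Q_invariant \<nu>"
proof -
  interpret prob_space \<nu> using \<nu> by (simp add: invariant_prob_def)
  have sets: "sets \<nu> = sets borel" and T: "T \<in> measurable \<nu> \<nu>" and inv: "distr \<nu> \<nu> T = \<nu>"
    using \<nu> by (auto simp: invariant_prob_def)
  note int = continuous_circle_integrable[OF _ finite_measure_axioms sets]
  have ge: "ereal (- (\<integral>x. ln (g x) \<partial>\<nu>)) \<le> KS_entropy \<nu> T"
  proof -
    have "KS_entropy \<nu> T \<noteq> - \<infinity>"
      using max by (auto simp: free_energy_def)
    then show ?thesis using max unfolding free_energy_def integral_ln_g[OF \<nu>]
      by (cases "KS_entropy \<nu> T") auto
  qed
  have le: "(\<integral>x. \<phi> x \<partial>\<nu>) \<le> (\<integral>x. Q \<phi> x \<partial>\<nu>)" if \<phi>: "continuous_on UNIV \<phi>" for \<phi>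
  proof -
    define \<psi> where "\<psi> x = \<phi> x - Q \<phi> (T x)" for x
    have Q\<phi>T: "continuous_on UNIV (\<lambda>x. Q \<phi> (T x))"
      by (rule continuous_on_compose2[OF continuous_Q[OF \<phi>] continuous_T]) auto
    have \<psi>: "continuous_on UNIV \<psi>" unfolding \<psi>_def by (intro continuous_intros \<phi> Q\<phi>T)
    obtain B where B: "B > 0" "\<And>x. \<bar>\<psi> x\<bar> \<le> B" using continuous_circle_bounded[OF \<psi>] by blast
    have Q\<psi>: "Q \<psi> x = 0" for x
      using Q_linear[of 1 \<phi> "-1" "\<lambda>y. Q \<phi> (T y) * 1" x] weighted_transfer_compose[of g "Q \<phi>" "\<lambda>_. 1" x] Q_one[of x]
      by (simp add: \<psi>_def[abs_def])
    \<comment> \<open>Maximality and the bound for the perturbed weight together give that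
      \<open>ln (1 + t * \<psi> x)\<close> has nonpositive integral. The logarithm is linear up to
      \<open>2 * (t * B)^2\<close> as long as \<open>t * B \<le> 1/2\<close>; division by
      \<open>t\<close> leaves an error that vanishes as \<open>t\<close> tends to 0.\<close>
    have "(\<integral>x. \<psi> x \<partial>\<nu>) \<le> 2 * t * B\<^sup>2" if t: "0 < t" "t * B \<le> 1/2" for t
    proof -
      have small: "\<bar>t * \<psi> x\<bar> \<le> 1/2" for x
      proof -
        have "\<bar>t * \<psi> x\<bar> = t * \<bar>\<psi> x\<bar>" using t by (simp add: abs_mult)
        also have "\<dots> \<le> t * B" using t B(2) by (intro mult_left_mono) auto
        finally show ?thesis using t(2) by simp
      qed
      then have pos: "0 < 1 + t * \<psi> x" for x using small[of x] by linarith
      define w where "w x = g x * (1 + t * \<psi> x)" for x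
      have w: "continuous_on UNIV w" "\<And>x. 0 < w x"
        unfolding w_def using pos g_pos by (auto intro!: continuous_intros continuous_g \<psi>)
      have "weighted_transfer w (\<lambda>_. 1) x = Q (\<lambda>y. 1 * 1 + t * \<psi> y) x" for x
        by (simp add: weighted_transfer_def w_def)
      then have "weighted_transfer w (\<lambda>_. 1) x = 1" for x
        by (simp only: Q_linear Q_one Q\<psi>)
      then have "KS_entropy \<nu> T \<le> ereal (- (\<integral>x. ln (w x) \<partial>\<nu>))"
        by (intro KS_entropy_le_weight[OF \<nu> w]) simp_all
      then have 1: "(\<integral>x. ln (w x) \<partial>\<nu>) \<le> (\<integral>x. ln (g x) \<partial>\<nu>)"
        using order_trans[OF ge] by fastforce
      have l: "continuous_on UNIV (\<lambda>x. ln (1 + t * \<psi> x))"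
        using pos by (intro continuous_intros \<psi>) (auto simp: less_imp_neq[THEN not_sym])
      have "ln (w x) = ln (g x) + ln (1 + t * \<psi> x)" for x
        unfolding w_def using pos[of x] g_pos[of x] by (simp add: ln_mult)
      then have "(\<integral>x. ln (w x) \<partial>\<nu>) = (\<integral>x. ln (g x) \<partial>\<nu>) + (\<integral>x. ln (1 + t * \<psi> x) \<partial>\<nu>)"
        using int[OF continuous_ln_g] int[OF l] by simp
      then have 2: "(\<integral>x. ln (1 + t * \<psi> x) \<partial>\<nu>) \<le> 0" using 1 by simp
      have "t * \<psi> x - 2 * (t * B)\<^sup>2 \<le> ln (1 + t * \<psi> x)" for x
      proof -
        have "\<bar>ln (1 + t * \<psi> x) - t * \<psi> x\<bar> \<le> 2 * (t * \<psi> x)\<^sup>2"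
          by (rule abs_ln_one_plus_x_minus_x_bound[OF small])
        moreover have "(t * \<psi> x)\<^sup>2 \<le> (t * B)\<^sup>2"
        proof -
          have "\<bar>t * \<psi> x\<bar> \<le> \<bar>t * B\<bar>" unfolding abs_mult using t B by (intro mult_left_mono) auto
          then show ?thesis by (simp only: abs_le_square_iff)
        qed
        ultimately show ?thesis by linarith
      qed
      then have "(\<integral>x. t * \<psi> x - 2 * (t * B)\<^sup>2 \<partial>\<nu>) \<le> (\<integral>x. ln (1 + t * \<psi> x) \<partial>\<nu>)"
        by (intro integral_mono int[OF l] Bochner_Integration.integrable_diff integrable_mult_right int[OF \<psi>]) auto
      then have "t * (\<integral>x. \<psi> x \<partial>\<nu>) - 2 * (t * B)\<^sup>2 \<le> 0"
        using 2 int[OF \<psi>] prob_space by simp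
      then have "t * (\<integral>x. \<psi> x \<partial>\<nu>) \<le> t * (2 * t * B\<^sup>2)" by (simp add: power2_eq_square algebra_simps)
      then show ?thesis using t(1) by simp
    qed
    note bound = this
    have "(\<integral>x. \<psi> x \<partial>\<nu>) \<le> 0 + e" if "e > 0" for e
    proof -
      define t where "t = min (1 / (2 * B)) (e / (2 * B\<^sup>2))"
      have t: "t > 0" "t \<le> 1 / (2 * B)" "t \<le> e / (2 * B\<^sup>2)" using B(1) that by (auto simp: t_def)
      then have "t * B \<le> 1/2" "2 * t * B\<^sup>2 \<le> e" using B(1) by (simp_all add: field_simps)
      then show ?thesis using bound[OF t(1)] by linarith
    qed
    then have "(\<integral>x. \<psi> x \<partial>\<nu>) \<le> 0" by (rule field_le_epsilon)
    moreover have "(\<integral>x. \<psi> x \<partial>\<nu>) = (\<integral>x. \<phi> x \<partial>\<nu>) - (\<integral>x. Q \<phi> (T x) \<partial>\<nu>)"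
      unfolding \<psi>_def using int[OF \<phi>] int[OF Q\<phi>T] by simp
    moreover have "(\<integral>x. Q \<phi> (T x) \<partial>\<nu>) = (\<integral>x. Q \<phi> x \<partial>\<nu>)"
      using integral_distr[OF T, of "Q \<phi>"] borel_measurable_continuous_onI[OF continuous_Q[OF \<phi>]]
      by (simp add: inv measurable_cong_sets[OF sets refl])
    ultimately show ?thesis by simp
  qed
  \<comment> \<open>The one-sided inequality for \<open>\<phi>\<close> and for
    \<open>- \<phi>\<close> gives equality.\<close>
  have "integral\<^sup>L \<nu> (Q \<phi>) = integral\<^sup>L \<nu> \<phi>" if \<phi>: "continuous_on UNIV \<phi>" for \<phi>
  proof -
    have "Q (\<lambda>x. - \<phi> x) = (\<lambda>x. - Q \<phi> x)"
      using weighted_transfer_cmult[of g "-1" \<phi>] by (intro ext) simp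
    then show ?thesis using le[OF \<phi>] le[OF continuous_on_minus[OF \<phi>]] by simp
  qed
  then show ?thesis using sets prob_space_axioms by (simp add: Q_invariant_def)
qed

lemma Q_invariant_equilibrium:
  assumes "Q_invariant \<mu>"
  shows "equilibrium_state T A \<mu> \<and> (\<forall>\<nu>. equilibrium_state T A \<nu> \<longrightarrow> \<nu> = \<mu>)"
proof (intro conjI allI impI)
  have inv: "invariant_prob T \<mu>" by (rule Q_invariant_imp_invariant[OF assms])
  show "equilibrium_state T A \<mu>"
    unfolding equilibrium_state_def free_energy_Q_invariant[OF assms] using inv free_energy_le by blast
  fix \<nu> assume \<nu>: "equilibrium_state T A \<nu>"
  then have "ereal (ln \<rho>) \<le> free_energy T A \<nu>"
    using inv by (auto simp: equilibrium_state_def simp flip: free_energy_Q_invariant[OF assms])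
  then have "Q_invariant \<nu>"
    using \<nu> by (intro maximal_free_energy_imp_Q_invariant) (auto simp: equilibrium_state_def)
  then show "\<nu> = \<mu>" by (rule Q_invariant_unique[OF _ assms])
qed

text \<open>Undoes the normalization: if \<open>\<mu>\<close> is invariant under \<open>Q\<close>,
  then \<open>\<mu>\<close> with density \<open>1 / h\<close> is an eigenmeasure of
  \<open>L\<close>, and multiplying it by \<open>h\<close> returns the probability
  \<open>\<mu>\<close> itself.\<close>

lemma RPF_measure_exists: "\<exists>\<mu>. RPF_measure \<alpha> T A \<mu>"
proof -
  obtain \<mu> where \<mu>: "Q_invariant \<mu>" by (rule Q_invariant_exists)
  interpret prob_space \<mu> using \<mu> by (simp add: Q_invariant_def)
  have sets: "sets \<mu> = sets borel" using \<mu> by (simp add: Q_invariant_def)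
  have ih: "continuous_on UNIV (\<lambda>x. 1 / h x)"
    using h_nonzero by (intro continuous_intros continuous_h) auto
  have meas: "(\<lambda>x. f x) \<in> borel_measurable \<mu>" if "continuous_on UNIV f" for f :: "circle \<Rightarrow> real"
    using borel_measurable_continuous_onI[OF that] by (simp add: measurable_cong_sets[OF sets refl])
  define \<nu> where "\<nu> = density \<mu> (\<lambda>x. ennreal (1 / h x))"
  have sets_\<nu>: "sets \<nu> = sets borel" by (simp add: \<nu>_def sets)
  have integral_\<nu>: "integral\<^sup>L \<nu> f = (\<integral>x. f x / h x \<partial>\<mu>)" if "continuous_on UNIV f" for f
    unfolding \<nu>_def using h_pos
    by (subst integral_density) (auto intro!: meas ih that simp: less_imp_le)
  have "(\<integral>\<^sup>+x. ennreal (1 / h x) \<partial>\<mu>) = ennreal (\<integral>x. 1 / h x \<partial>\<mu>)"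
    using h_pos by (intro nn_integral_eq_integral continuous_circle_integrable[OF ih finite_measure_axioms sets])
      (auto simp: less_imp_le)
  moreover have "emeasure \<nu> (space \<nu>) = (\<integral>\<^sup>+x. ennreal (1 / h x) \<partial>\<mu>)"
    unfolding \<nu>_def using meas[OF ih] by (subst emeasure_density) (auto cong: nn_integral_cong)
  ultimately have fin: "emeasure \<nu> (space \<nu>) \<noteq> \<infinity>" by simp
  have dens: "density \<nu> (\<lambda>x. ennreal (h x)) = \<mu>"
  proof -
    have "density \<nu> (\<lambda>x. ennreal (h x)) = density \<mu> (\<lambda>x. ennreal (1 / h x) * ennreal (h x))"
      unfolding \<nu>_def by (intro density_density_eq measurable_compose[OF _ measurable_ennreal] meas ih continuous_h)
    also have "(\<lambda>x. ennreal (1 / h x) * ennreal (h x)) = (\<lambda>_. 1)"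
      using h_pos h_nonzero by (intro ext) (simp add: less_imp_le flip: ennreal_mult)
    finally show ?thesis by (simp add: density_1)
  qed
  have "emeasure \<nu> (space \<nu>) \<noteq> 0"
  proof
    assume zero: "emeasure \<nu> (space \<nu>) = 0"
    have "emeasure \<mu> (space \<mu>) = emeasure (density \<nu> (\<lambda>x. ennreal (h x))) (space \<nu>)"
      unfolding dens by (simp add: \<nu>_def)
    also have "\<dots> = (\<integral>\<^sup>+x\<in>space \<nu>. ennreal (h x) \<partial>\<nu>)"
      using borel_measurable_continuous_onI[OF continuous_h]
      by (intro emeasure_density) (auto simp: measurable_cong_sets[OF sets_\<nu> refl])
    also have "\<dots> = 0" using zero by (intro nn_integral_null_set) (auto simp: null_sets_def)
    finally show False using emeasure_space_1 by simp
  qed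
  moreover have "(\<integral>x. transfer_operator T A f x \<partial>\<nu>) = \<rho> * (\<integral>x. f x \<partial>\<nu>)" if "f \<in> holder_space \<alpha>" for f
  proof -
    have f: "continuous_on UNIV f" by (rule holder_continuous[OF that \<alpha>(1)])
    have fh: "continuous_on UNIV (\<lambda>x. f x / h x)"
      using h_nonzero by (intro continuous_intros f continuous_h) auto
    have Lf: "continuous_on UNIV (L f)"
      by (intro continuous_weighted_transfer continuous_intros continuous_A f)
    have "(\<lambda>y. h y * (f y / h y)) = f" using h_nonzero by (intro ext) simp
    then have eq: "L f x / h x = \<rho> * Q (\<lambda>x. f x / h x) x" for x
      using h_nonzero \<rho>_pos unfolding Q_eq[of "\<lambda>x. f x / h x"] by simp
    have "(\<integral>x. L f x \<partial>\<nu>) = \<rho> * (\<integral>x. Q (\<lambda>x. f x / h x) x \<partial>\<mu>)"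
      unfolding integral_\<nu>[OF Lf] eq by simp
    also have "(\<integral>x. Q (\<lambda>x. f x / h x) x \<partial>\<mu>) = (\<integral>x. f x / h x \<partial>\<mu>)"
      using \<mu> fh by (simp add: Q_invariant_def)
    finally show ?thesis unfolding integral_\<nu>[OF f] transfer_operator_eq .
  qed
  ultimately have "RPF_measure \<alpha> T A \<mu>"
    unfolding RPF_measure_def using sets_\<nu> fin h_holder h_pos \<rho>_pos eigen dens prob_space_axioms
    by (intro exI[of _ h] exI[of _ \<rho>] exI[of _ \<nu>]) (auto intro: finite_measureI simp: transfer_operator_eq)
  then show ?thesis by blast
qed

end

context flat_potential
begin

lemma normalized_potentialI:
  assumes "h \<in> holder_space \<alpha>" "\<And>x. 0 < h x" "0 < \<rho>" "\<And>x. L h x = \<rho> * h x"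
  shows "normalized_potential T F m A \<alpha> C h \<rho>"
  using assms by unfold_locales auto

text \<open>The normalization is carried out with the eigenfunction that comes with the given
  measure, which may differ from the constructed one. For this \<open>h\<close> the measure is
  invariant under the associated \<open>Q\<close>, and the equilibrium property mentions
  \<open>h\<close> no more.\<close>

lemma RPF_measure_equilibrium:
  assumes "RPF_measure \<alpha> T A \<mu>"
  shows "equilibrium_state T A \<mu> \<and> (\<forall>\<nu>. equilibrium_state T A \<nu> \<longrightarrow> \<nu> = \<mu>)"
proof -
  obtain h \<rho> \<nu> where h: "h \<in> holder_space \<alpha>" "\<And>x. 0 < h x" and \<rho>: "0 < \<rho>"
    and sets_\<nu>: "sets \<nu> = sets borel"
    and eigen: "\<And>x. transfer_operator T A h x = \<rho> * h x"
    and dual: "\<And>f. f \<in> holder_space \<alpha> \<Longrightarrow> (\<integral>x. transfer_operator T A f x \<partial>\<nu>) = \<rho> * (\<integral>x. f x \<partial>\<nu>)"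
    and \<mu>: "\<mu> = density \<nu> (\<lambda>x. ennreal (h x))" "prob_space \<mu>"
    using assms unfolding RPF_measure_def by auto
  interpret normalized_potential T F m A \<alpha> C h \<rho>
    by (rule normalized_potentialI[OF h \<rho>]) (use eigen in \<open>simp add: transfer_operator_eq\<close>)
  have integral_\<mu>: "integral\<^sup>L \<mu> f = (\<integral>x. h x * f x \<partial>\<nu>)" if "continuous_on UNIV f" for f
    unfolding \<mu>(1) using h borel_measurable_continuous_onI[OF that] borel_measurable_continuous_onI[OF continuous_h]
    by (subst integral_density) (auto simp: measurable_cong_sets[OF sets_\<nu> refl] less_imp_le)
  have "Q_invariant \<mu>"
  proof (rule Q_invariantI[OF \<mu>(2)])
    show "sets \<mu> = sets borel" by (simp add: \<mu>(1) sets_\<nu>)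
    fix f assume f: "f \<in> holder_space \<alpha>"
    have fc: "continuous_on UNIV f" by (rule holder_continuous[OF f \<alpha>(1)])
    have "h x * Q f x = (1 / \<rho>) * L (\<lambda>y. h y * f y) x" for x
      unfolding Q_eq using h_nonzero[of x] by simp
    then have "integral\<^sup>L \<mu> (Q f) = (1 / \<rho>) * (\<integral>x. L (\<lambda>y. h y * f y) x \<partial>\<nu>)"
      unfolding integral_\<mu>[OF continuous_Q[OF fc]] by (simp only: integral_mult_right_zero)
    also have "\<dots> = (\<integral>x. h x * f x \<partial>\<nu>)"
      using dual[OF holder_mult[OF h(1) f \<alpha>(1)]] \<rho> by (simp add: transfer_operator_eq)
    finally show "integral\<^sup>L \<mu> (Q f) = integral\<^sup>L \<mu> f" by (simp add: integral_\<mu>[OF fc])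
  qed
  then show ?thesis by (rule Q_invariant_equilibrium)
qed

theorem RPF_measure_unique_equilibrium:
  "(\<exists>\<mu>. RPF_measure \<alpha> T A \<mu>) \<and>
   (\<forall>\<mu>. RPF_measure \<alpha> T A \<mu> \<longrightarrow>
      equilibrium_state T A \<mu> \<and> (\<forall>\<nu>. equilibrium_state T A \<nu> \<longrightarrow> \<nu> = \<mu>))"
proof -
  obtain h \<rho> where "h \<in> holder_space \<alpha>" "\<And>x. 0 < h x" "0 < \<rho>" "\<And>x. L h x = \<rho> * h x"
    using eigenfunction_exists by blast
  then interpret normalized_potential T F m A \<alpha> C h \<rho> by (rule normalized_potentialI)
  show ?thesis using RPF_measure_exists RPF_measure_equilibrium by blast
qed

end

section \<open>Derivatives of monotone functions\<close>

text \<open>Vitali's covering theorem on the line. An interval need only contain the point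
  \<open>x\<close>, not be centred there, which is why the balls are indexed by intervals and have
  the midpoints as centres.\<close>

lemma vitali_intervals:
  fixes E O' :: "real set"
  assumes "open O'" "E \<subseteq> O'"
    and small: "\<And>x d. x \<in> E \<Longrightarrow> d > 0 \<Longrightarrow> \<exists>u v. u < v \<and> u \<le> x \<and> x \<le> v \<and> v - u < d \<and> R u v"
  obtains C :: "(real \<times> real) set"
  where "countable C" "\<And>u v. (u, v) \<in> C \<Longrightarrow> u < v \<and> {u..v} \<subseteq> O' \<and> R u v"
    "disjoint_family_on (\<lambda>(u, v). {u..v}) C" "negligible (E - (\<Union>(u, v)\<in>C. {u..v}))"
proof -
  define K where "K = {(u, v). u < v \<and> {u..v} \<subseteq> O' \<and> R u v}"
  define a where "a p = (fst p + snd p) / 2" for p :: "real \<times> real"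
  define r where "r p = (snd p - fst p) / 2" for p :: "real \<times> real"
  have cball: "cball (a p) (r p) = {fst p..snd p}" for p
    by (auto simp: a_def r_def cball_eq_atLeastAtMost field_simps)
  have S: "\<exists>i. i \<in> K \<and> x \<in> cball (a i) (r i) \<and> r i < d" if x: "x \<in> E" and d: "0 < d" for x d
  proof -
    obtain e where e: "e > 0" "ball x e \<subseteq> O'" using assms(1,2) x open_contains_ball by blast
    obtain u v where uv: "u < v" "u \<le> x" "x \<le> v" "v - u < min d e" "R u v"
      using small[OF x, of "min d e"] d e(1) by auto
    have "{u..v} \<subseteq> ball x e"
      using uv by (auto simp: dist_real_def abs_if)
    then have "(u, v) \<in> K" using uv e(2) by (auto simp: K_def)
    moreover have "x \<in> cball (a (u, v)) (r (u, v))" unfolding cball using uv by simp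
    moreover have "r (u, v) < d" using uv by (simp add: r_def)
    ultimately show ?thesis by blast
  qed
  have r0: "0 < r i" if "i \<in> K" for i using that by (auto simp: K_def r_def)
  obtain C where C: "countable C" "C \<subseteq> K"
    "pairwise (\<lambda>i j. disjnt (cball (a i) (r i)) (cball (a j) (r j))) C"
    "negligible (E - (\<Union>i\<in>C. cball (a i) (r i)))"
    using Vitali_covering_theorem_cballs[of K r E a, OF r0 S] by blast
  show ?thesis
  proof (rule that[OF C(1)])
    show "u < v \<and> {u..v} \<subseteq> O' \<and> R u v" if "(u, v) \<in> C" for u v
      using C(2) that by (auto simp: K_def)
    show "disjoint_family_on (\<lambda>(u, v). {u..v}) C"
      using C(3) unfolding cball by (auto simp: disjoint_family_on_def pairwise_def disjnt_def case_prod_unfold)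
    show "negligible (E - (\<Union>(u, v)\<in>C. {u..v}))"
      using C(4) unfolding cball by (simp add: case_prod_unfold)
  qed
qed

lemma emeasure_disjoint_intervals:
  assumes "countable C" "disjoint_family_on (\<lambda>(u, v). {u..v::real}) C" "sets M = sets borel"
  shows "emeasure M (\<Union>(u, v)\<in>C. {u..v}) = (\<integral>\<^sup>+p. emeasure M {fst p..snd p} \<partial>count_space C)"
  using emeasure_UN_countable[of C "\<lambda>(u, v). {u..v}" M] assms by (simp add: case_prod_unfold)

section \<open>Derivates of a monotone function through its Stieltjes measure\<close>

locale continuous_mono =
  fixes F :: "real \<Rightarrow> real"
  assumes mono: "x \<le> y \<Longrightarrow> F x \<le> F y" and cont: "continuous_on UNIV F"
begin

abbreviation M :: "real measure" where "M \<equiv> interval_measure F"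

lemma emeasure_M: "u \<le> v \<Longrightarrow> emeasure M {u..v} = ennreal (F v - F u)"
  by (rule emeasure_interval_measure_Icc[OF _ mono cont])

text \<open>Contains all points whose lower derivate, taken over shrinking intervals around the
  point, is less than \<open>p\<close>; \<open>slope_above\<close> is the counterpart for the upper
  derivate.\<close>

definition slope_below :: "real \<Rightarrow> real set" where
  "slope_below p = {x. \<forall>d>0. \<exists>u v. u < v \<and> u \<le> x \<and> x \<le> v \<and> v - u < d \<and> F v - F u < p * (v - u)}"

definition slope_above :: "real \<Rightarrow> real set" where
  "slope_above q = {x. \<forall>d>0. \<exists>u v. u < v \<and> u \<le> x \<and> x \<le> v \<and> v - u < d \<and> q * (v - u) < F v - F u}"

text \<open>Almost all of \<open>E\<close> is covered by disjoint intervals in \<open>W\<close> on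
  which the Stieltjes measure is at least \<open>q\<close> times the length; both measures are added
  up over this countable family.\<close>

lemma slope_above_cover:
  assumes "open W" "E \<subseteq> W" "E \<subseteq> slope_above q" "0 < q"
  obtains U where "U \<in> sets borel" "U \<subseteq> W" "negligible (E - U)" "ennreal q * emeasure lborel U \<le> emeasure M W"
proof -
  have small: "\<exists>u v. u < v \<and> u \<le> x \<and> x \<le> v \<and> v - u < d \<and> q * (v - u) < F v - F u" if "x \<in> E" "d > 0" for x d
    using assms(3) that by (auto simp: slope_above_def)
  obtain C where C: "countable C" "\<And>u v. (u, v) \<in> C \<Longrightarrow> u < v \<and> {u..v} \<subseteq> W \<and> q * (v - u) < F v - F u"
    "disjoint_family_on (\<lambda>(u, v). {u..v}) C" "negligible (E - (\<Union>(u, v)\<in>C. {u..v}))"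
    using vitali_intervals[OF assms(1,2) small] by blast
  define U where "U = (\<Union>(u, v)\<in>C. {u..v})"
  have U: "U \<in> sets borel" unfolding U_def using C(1) by (auto intro!: sets.countable_UN' simp: case_prod_unfold)
  have UW: "U \<subseteq> W" unfolding U_def using C(2) by blast
  have "ennreal q * emeasure lborel U = (\<integral>\<^sup>+p. ennreal q * emeasure lborel {fst p..snd p} \<partial>count_space C)"
    unfolding U_def emeasure_disjoint_intervals[OF C(1,3) sets_lborel] by (rule nn_integral_cmult[symmetric]) simp
  also have "\<dots> \<le> (\<integral>\<^sup>+p. emeasure M {fst p..snd p} \<partial>count_space C)"
  proof (rule nn_integral_mono)
    fix p assume "p \<in> space (count_space C)"
    then have p: "fst p < snd p" "q * (snd p - fst p) < F (snd p) - F (fst p)"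
      using C(2)[of "fst p" "snd p"] by auto
    then show "ennreal q * emeasure lborel {fst p..snd p} \<le> emeasure M {fst p..snd p}"
      using assms(4) by (simp add: emeasure_M less_imp_le ennreal_leI flip: ennreal_mult)
  qed
  also have "\<dots> = emeasure M U"
    unfolding U_def by (rule emeasure_disjoint_intervals[OF C(1,3), symmetric]) simp
  also have "\<dots> \<le> emeasure M W" using UW assms(1) by (intro emeasure_mono) auto
  finally show ?thesis using that U UW C(4) unfolding U_def by blast
qed

text \<open>As for large slopes, but the cover is made open by discarding the countably many
  endpoints. An open \<open>U\<close> can serve as the confining set when
  \<open>slope_above_cover\<close> is applied inside it.\<close>

lemma slope_below_cover:
  assumes "open W" "E \<subseteq> W" "E \<subseteq> slope_below p" "0 < p"
  obtains U where "open U" "U \<subseteq> W" "negligible (E - U)" "emeasure M U \<le> ennreal p * emeasure lborel W"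
proof -
  have small: "\<exists>u v. u < v \<and> u \<le> x \<and> x \<le> v \<and> v - u < d \<and> F v - F u < p * (v - u)" if "x \<in> E" "d > 0" for x d
    using assms(3) that by (auto simp: slope_below_def)
  obtain C where C: "countable C" "\<And>u v. (u, v) \<in> C \<Longrightarrow> u < v \<and> {u..v} \<subseteq> W \<and> F v - F u < p * (v - u)"
    "disjoint_family_on (\<lambda>(u, v). {u..v}) C" "negligible (E - (\<Union>(u, v)\<in>C. {u..v}))"
    using vitali_intervals[OF assms(1,2) small] by blast
  define U where "U = (\<Union>(u, v)\<in>C. {u..v})"
  define U' where "U' = (\<Union>(u, v)\<in>C. {u<..<v})"
  have U: "U \<in> sets borel" unfolding U_def using C(1) by (auto intro!: sets.countable_UN' simp: case_prod_unfold)
  have UW: "U \<subseteq> W" unfolding U_def using C(2) by blast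
  have U': "open U'" "U' \<subseteq> U" unfolding U_def U'_def by (auto intro!: open_UN) 
  have "U - U' \<subseteq> fst ` C \<union> snd ` C"
  proof
    fix x assume x: "x \<in> U - U'"
    then obtain u v where uv: "(u, v) \<in> C" "u \<le> x" "x \<le> v" by (auto simp: U_def)
    then have "x = u \<or> x = v" using x by (force simp: U'_def)
    then show "x \<in> fst ` C \<union> snd ` C" using uv(1) by force
  qed
  then have "countable (U - U')" using C(1) by (meson countable_Un countable_image countable_subset)
  then have "negligible (U - U')"
    unfolding negligible_iff_null_sets by (intro null_sets_completionI countable_imp_null_set_lborel)
  then have "negligible ((E - U) \<union> (U - U'))" using C(4) by (simp add: U_def negligible_Un)
  then have neg: "negligible (E - U')" by (rule negligible_subset) auto
  have "emeasure M U' \<le> emeasure M U" using U U' by (intro emeasure_mono) auto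
  also have "\<dots> = (\<integral>\<^sup>+p. emeasure M {fst p..snd p} \<partial>count_space C)"
    unfolding U_def by (rule emeasure_disjoint_intervals[OF C(1,3)]) simp
  also have "\<dots> \<le> (\<integral>\<^sup>+i. ennreal p * emeasure lborel {fst i..snd i} \<partial>count_space C)"
  proof (rule nn_integral_mono)
    fix i assume "i \<in> space (count_space C)"
    then have i: "fst i < snd i" "F (snd i) - F (fst i) < p * (snd i - fst i)"
      using C(2)[of "fst i" "snd i"] by auto
    then show "emeasure M {fst i..snd i} \<le> ennreal p * emeasure lborel {fst i..snd i}"
      using assms(4) by (simp add: emeasure_M less_imp_le ennreal_leI flip: ennreal_mult)
  qed
  also have "\<dots> = ennreal p * emeasure lborel U"
    unfolding U_def emeasure_disjoint_intervals[OF C(1,3) sets_lborel] by (rule nn_integral_cmult) simp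
  also have "\<dots> \<le> ennreal p * emeasure lborel W"
    using UW assms(1) by (intro mult_left_mono emeasure_mono) auto
  finally show ?thesis using that U' UW neg by blast
qed

lemma measurable_cover:
  assumes "U \<in> sets borel" "negligible (E - U)" "emeasure lborel U \<le> ennreal c" "0 \<le> c"
  obtains B where "E \<subseteq> B" "B \<in> lmeasurable" "measure lebesgue B \<le> c"
proof
  show "E \<subseteq> U \<union> (E - U)" by blast
  have null: "E - U \<in> null_sets lebesgue" using assms(2) by (simp add: negligible_iff_null_sets)
  have em: "emeasure lebesgue (U \<union> (E - U)) = emeasure lborel U"
    using assms(1) null by (subst emeasure_Un_null_set) auto
  have "U \<union> (E - U) \<in> sets lebesgue"
    using assms(1) null by (intro sets.Un) auto
  moreover have "emeasure lebesgue (U \<union> (E - U)) < \<infinity>"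
    unfolding em using assms(3) by (rule le_less_trans) simp
  ultimately show "U \<union> (E - U) \<in> lmeasurable" by (rule fmeasurableI)
  show "measure lebesgue (U \<union> (E - U)) \<le> c"
    unfolding measure_def em using assms(3,4) by (simp add: enn2real_leI)
qed

text \<open>Covering first by intervals of slope below \<open>p\<close> and, inside these, by
  intervals of slope above \<open>q\<close> shows \<open>q * s \<le> p * s\<close> for the outer
  measure \<open>s\<close> of the set, whence \<open>s = 0\<close>. Outer measure is expressed as an
  infimum over measurable supersets.\<close>

lemma negligible_slope_gap:
  assumes "0 < p" "p < q"
  shows "negligible (slope_below p \<inter> slope_above q \<inter> {a<..<b})"
proof -
  define E where "E = slope_below p \<inter> slope_above q \<inter> {a<..<b}"
  define \<B> where "\<B> = {B \<in> lmeasurable. E \<subseteq> B}"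
  define s where "s = (INF B\<in>\<B>. measure lebesgue B)"
  have ne: "\<B> \<noteq> {}"
  proof -
    have "{a<..<b} \<in> \<B>" by (auto simp: \<B>_def E_def)
    then show ?thesis by blast
  qed
  have bdd: "bdd_below (measure lebesgue ` \<B>)" by (rule bdd_belowI[of _ 0]) auto
  have s_le: "s \<le> measure lebesgue B" if "B \<in> \<B>" for B
    unfolding s_def using that by (intro cINF_lower bdd)
  have s0: "0 \<le> s" unfolding s_def using ne by (intro cINF_greatest) auto
  have "q * s \<le> p * s + e" if "e > 0" for e
  proof -
    \<comment> \<open>Enters twice, in the choice of \<open>B\<close> and of the open set
      \<open>W\<close>, and is multiplied by \<open>p\<close>.\<close>
    define \<epsilon> where "\<epsilon> = e / (2 * p)"
    have \<epsilon>: "\<epsilon> > 0" using that assms by (simp add: \<epsilon>_def)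
    have "\<exists>B\<in>\<B>. measure lebesgue B < s + \<epsilon>"
      using \<epsilon> ne bdd unfolding s_def by (subst cINF_less_iff[symmetric]) auto
    then obtain B where B: "B \<in> lmeasurable" "E \<subseteq> B" "measure lebesgue B < s + \<epsilon>" by (auto simp: \<B>_def)
    obtain W where W: "open W" "B \<subseteq> W" "W \<in> lmeasurable" "measure lebesgue W < measure lebesgue B + \<epsilon>"
    proof -
      obtain W where W: "open W" "B \<subseteq> W" "W - B \<in> lmeasurable" "emeasure lebesgue (W - B) < ennreal \<epsilon>"
        using sets_lebesgue_outer_open[OF fmeasurableD[OF B(1)] \<epsilon>] by blast
      have "B \<union> (W - B) = W" using W(2) by blast
      then have "W \<in> lmeasurable" "measure lebesgue W \<le> measure lebesgue B + measure lebesgue (W - B)"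
        using fmeasurable.Un[OF B(1) W(3)] measure_Un_le[of B lebesgue "W - B"] B(1) W(3)
        by (auto simp: fmeasurableD)
      moreover have "measure lebesgue (W - B) < \<epsilon>"
        using W(3,4) \<epsilon> by (simp add: emeasure_eq_measure2 ennreal_less_iff)
      ultimately show ?thesis using that W(1,2) by fastforce
    qed
    have mW: "emeasure lborel W = ennreal (measure lebesgue W)"
    proof -
      have "W \<in> sets lborel" using W(1) by simp
      then have "emeasure lebesgue W = emeasure lborel W" by simp
      then show ?thesis using emeasure_eq_measure2[OF W(3)] by simp
    qed
    obtain U where U: "open U" "negligible (E - U)" "emeasure M U \<le> ennreal p * emeasure lborel W"
    proof -
      have "E \<subseteq> W" "E \<subseteq> slope_below p" using B(2) W(2) by (auto simp: E_def)
      then show ?thesis using slope_below_cover[OF W(1) _ _ assms(1)] that by metis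
    qed
    obtain U' where U': "U' \<in> sets borel" "negligible (E \<inter> U - U')" "ennreal q * emeasure lborel U' \<le> emeasure M U"
    proof -
      have "E \<inter> U \<subseteq> U" "E \<inter> U \<subseteq> slope_above q" "0 < q" using assms by (auto simp: E_def)
      then show ?thesis using slope_above_cover[OF U(1)] that by metis
    qed
    have *: "ennreal q * emeasure lborel U' \<le> ennreal (p * (s + 2 * \<epsilon>))"
    proof -
      have "ennreal q * emeasure lborel U' \<le> ennreal p * ennreal (measure lebesgue W)"
        using U'(3) U(3) mW by (metis order_trans)
      also have "\<dots> = ennreal (p * measure lebesgue W)" using assms by (simp add: ennreal_mult)
      also have "\<dots> \<le> ennreal (p * (s + 2 * \<epsilon>))"
        using W(4) B(3) assms by (intro ennreal_leI mult_left_mono) auto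
      finally show ?thesis .
    qed
    have le: "emeasure lborel U' \<le> ennreal (p * (s + 2 * \<epsilon>) / q)"
    proof -
      have "emeasure lborel U' = ennreal (1 / q) * (ennreal q * emeasure lborel U')"
        using assms by (simp flip: ennreal_mult mult.assoc)
      also have "\<dots> \<le> ennreal (1 / q) * ennreal (p * (s + 2 * \<epsilon>))" by (intro mult_left_mono *) auto
      also have "\<dots> = ennreal (p * (s + 2 * \<epsilon>) / q)" using assms s0 \<epsilon> by (simp flip: ennreal_mult)
      finally show ?thesis .
    qed
    have "negligible ((E - U) \<union> (E \<inter> U - U'))" using U(2) U'(2) by (rule negligible_Un)
    then have "negligible (E - U')" by (rule negligible_subset) auto
    moreover have "0 \<le> p * (s + 2 * \<epsilon>) / q" using assms s0 \<epsilon> by simp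
    ultimately obtain B' where "E \<subseteq> B'" "B' \<in> lmeasurable" "measure lebesgue B' \<le> p * (s + 2 * \<epsilon>) / q"
      using measurable_cover[OF U'(1) _ le] by blast
    then have "s \<le> p * (s + 2 * \<epsilon>) / q" using s_le[of B'] by (simp add: \<B>_def)
    then have "q * s \<le> p * s + 2 * p * \<epsilon>" using assms by (simp add: field_simps)
    then show ?thesis using assms by (simp add: \<epsilon>_def)
  qed
  then have "q * s \<le> p * s" by (rule field_le_epsilon)
  then have "s = 0" using assms s0 by (simp add: mult_le_cancel_right)
  have "\<exists>T. E \<subseteq> T \<and> T \<in> lmeasurable \<and> measure lebesgue T < e" if "e > 0" for e
  proof -
    have "\<exists>B\<in>\<B>. measure lebesgue B < e"
      using that \<open>s = 0\<close> cINF_less_iff[OF ne bdd, of e] by (simp add: s_def)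
    then show ?thesis by (auto simp: \<B>_def)
  qed
  then show ?thesis unfolding E_def[symmetric] negligible_outer by blast
qed

text \<open>A cover by intervals of slope above \<open>Suc n\<close> has length at most
  \<open>(F b - F a) / Suc n\<close>, since the Stieltjes measure of the whole interval is
  finite.\<close>

lemma negligible_infinite_slope:
  assumes "a < b"
  shows "negligible ((\<Inter>n. slope_above (real (Suc n))) \<inter> {a<..<b})"
  unfolding negligible_outer_le
proof (intro allI impI)
  define E where "E = (\<Inter>n. slope_above (real (Suc n))) \<inter> {a<..<b}"
  fix e :: real assume e: "e > 0"
  have V: "0 \<le> F b - F a" using mono[of a b] assms by simp
  obtain n :: nat where n: "real n > (F b - F a) / e" using reals_Archimedean2 by blast
  obtain U where U: "U \<in> sets borel" "negligible (E - U)"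
    "ennreal (real (Suc n)) * emeasure lborel U \<le> emeasure M {a<..<b}"
  proof -
    have "E \<subseteq> {a<..<b}" "E \<subseteq> slope_above (real (Suc n))" "0 < real (Suc n)" by (auto simp: E_def)
    then show ?thesis using slope_above_cover[OF open_greaterThanLessThan] that by metis
  qed
  have "emeasure M {a<..<b} \<le> emeasure M {a..b}" by (intro emeasure_mono) auto
  also have "\<dots> = ennreal (F b - F a)" using assms by (simp add: emeasure_M)
  finally have *: "ennreal (real (Suc n)) * emeasure lborel U \<le> ennreal (F b - F a)" using U(3) by (rule order_trans[rotated])
  have "emeasure lborel U = ennreal (1 / real (Suc n)) * (ennreal (real (Suc n)) * emeasure lborel U)"
    by (simp flip: ennreal_mult mult.assoc del: of_nat_Suc)
  also have "\<dots> \<le> ennreal (1 / real (Suc n)) * ennreal (F b - F a)" by (intro mult_left_mono *) auto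
  also have "\<dots> = ennreal ((F b - F a) / real (Suc n))" using V by (simp flip: ennreal_mult del: of_nat_Suc)
  also have "\<dots> \<le> ennreal e"
  proof (rule ennreal_leI)
    have "(F b - F a) / e < real (Suc n)" using n by simp
    then show "(F b - F a) / real (Suc n) \<le> e" using e by (simp add: field_simps del: of_nat_Suc)
  qed
  finally have "emeasure lborel U \<le> ennreal e" .
  then obtain B where "E \<subseteq> B" "B \<in> lmeasurable" "measure lebesgue B \<le> e"
    using measurable_cover[OF U(1,2) _ less_imp_le[OF e]] by blast
  then show "\<exists>T. (\<Inter>n. slope_above (real (Suc n))) \<inter> {a<..<b} \<subseteq> T \<and> T \<in> lmeasurable \<and> measure lebesgue T \<le> e"
    unfolding E_def by blast
qed

lemma slope_aboveD:
  assumes "x \<notin> slope_above q"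
  obtains d where "d > 0" "\<And>u v. u < v \<Longrightarrow> u \<le> x \<Longrightarrow> x \<le> v \<Longrightarrow> v - u < d \<Longrightarrow> F v - F u \<le> q * (v - u)"
proof -
  obtain d where "d > 0" "\<And>u v. \<not> (u < v \<and> u \<le> x \<and> x \<le> v \<and> v - u < d \<and> q * (v - u) < F v - F u)"
    using assms unfolding slope_above_def by blast
  then show ?thesis using that by (meson not_less)
qed

lemma slope_belowD:
  assumes "x \<notin> slope_below q"
  obtains d where "d > 0" "\<And>u v. u < v \<Longrightarrow> u \<le> x \<Longrightarrow> x \<le> v \<Longrightarrow> v - u < d \<Longrightarrow> q * (v - u) \<le> F v - F u"
proof -
  obtain d where "d > 0" "\<And>u v. \<not> (u < v \<and> u \<le> x \<and> x \<le> v \<and> v - u < d \<and> F v - F u < q * (v - u))"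
    using assms unfolding slope_below_def by blast
  then show ?thesis using that by (meson not_less)
qed

text \<open>The derivative is the upper derivate \<open>D\<close>: the first hypothesis makes it
  finite, and the absence of rational gaps prevents the lower derivate from being smaller.\<close>

lemma differentiable_at_regular_point:
  assumes fin: "x \<notin> slope_above (real (Suc n))"
    and gap: "\<And>p q. p \<in> \<rat> \<Longrightarrow> q \<in> \<rat> \<Longrightarrow> 0 < p \<Longrightarrow> p < q \<Longrightarrow> x \<notin> slope_below p \<inter> slope_above q"
  obtains D where "(F has_real_derivative D) (at x)"
proof -
  define S where "S = {q. 0 < q \<and> x \<notin> slope_above q}"
  define D where "D = Inf S"
  have ne: "real (Suc n) \<in> S" using fin by (simp add: S_def del: of_nat_Suc)
  have bdd: "bdd_below S" by (rule bdd_belowI[of _ 0]) (auto simp: S_def)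
  have "S \<noteq> {}" using ne by blast
  then have D0: "0 \<le> D" unfolding D_def by (rule cInf_greatest) (simp add: S_def)
  have "\<exists>d>0. \<forall>u v. u < v \<longrightarrow> u \<le> x \<longrightarrow> x \<le> v \<longrightarrow> v - u < d \<longrightarrow>
      (D - e) * (v - u) \<le> F v - F u \<and> F v - F u \<le> (D + e) * (v - u)" if e: "e > 0" for e
  proof -
    obtain q where q: "q \<in> S" "q < D + e"
      using cInf_lessD[of S "D + e"] ne e unfolding D_def by auto
    obtain d1 where d1: "d1 > 0" "\<And>u v. u < v \<Longrightarrow> u \<le> x \<Longrightarrow> x \<le> v \<Longrightarrow> v - u < d1 \<Longrightarrow> F v - F u \<le> q * (v - u)"
      using slope_aboveD[of x q] q(1) by (auto simp: S_def)
    obtain d2 where d2: "d2 > 0"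
      "\<And>u v. u < v \<Longrightarrow> u \<le> x \<Longrightarrow> x \<le> v \<Longrightarrow> v - u < d2 \<Longrightarrow> (D - e) * (v - u) \<le> F v - F u"
    proof (cases "D - e \<le> 0")
      case True
      have "(D - e) * (v - u) \<le> F v - F u" if "u < v" for u v
      proof -
        have "(D - e) * (v - u) \<le> 0" using True that by (intro mult_nonpos_nonneg) auto
        then show ?thesis using mono[of u v] that by simp
      qed
      then show ?thesis using that[of 1] by simp
    next
      case False
      \<comment> \<open>Two rationals between \<open>D - e\<close> and \<open>D\<close>: near
        \<open>x\<close> slopes above the larger one occur, so by the gap condition slopes below the
        smaller one do not occur at small scale.\<close>
      obtain p where p: "p \<in> \<rat>" "D - e < p" "p < D" using Rats_dense_in_real[of "D - e" D] e by auto
      obtain q' where q': "q' \<in> \<rat>" "p < q'" "q' < D" using Rats_dense_in_real[OF p(3)] by auto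
      have "q' \<notin> S" using q'(3) cInf_lower[OF _ bdd, of q'] by (auto simp: D_def)
      then have "x \<in> slope_above q'" using False p q' by (simp add: S_def)
      then have "x \<notin> slope_below p" using gap[OF p(1) q'(1)] False p q' by auto
      then obtain d where d: "d > 0" "\<And>u v. u < v \<Longrightarrow> u \<le> x \<Longrightarrow> x \<le> v \<Longrightarrow> v - u < d \<Longrightarrow> p * (v - u) \<le> F v - F u"
        using slope_belowD by blast
      have "(D - e) * (v - u) \<le> F v - F u" if "u < v" "u \<le> x" "x \<le> v" "v - u < d" for u v
      proof -
        have "(D - e) * (v - u) \<le> p * (v - u)" using p(2) that by (intro mult_right_mono) auto
        then show ?thesis using d(2)[OF that] by simp
      qed
      then show ?thesis using that d(1) by blast
    qed
    have "F v - F u \<le> (D + e) * (v - u)" if "u < v" "u \<le> x" "x \<le> v" "v - u < d1" for u v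
    proof -
      have "q * (v - u) \<le> (D + e) * (v - u)" using q(2) that by (intro mult_right_mono) auto
      then show ?thesis using d1(2)[OF that] by simp
    qed
    then show ?thesis using d1(1) d2 by (intro exI[of _ "min d1 d2"]) auto
  qed
  note quot = this
  have "((\<lambda>y. (F y - F x) / (y - x)) \<longlongrightarrow> D) (at x)"
    unfolding LIM_def
  proof (intro allI impI)
    fix r :: real assume "r > 0"
    then obtain d where d: "d > 0" "\<And>u v. u < v \<Longrightarrow> u \<le> x \<Longrightarrow> x \<le> v \<Longrightarrow> v - u < d \<Longrightarrow>
      (D - r / 2) * (v - u) \<le> F v - F u \<and> F v - F u \<le> (D + r / 2) * (v - u)"
      using quot[of "r / 2"] by auto
    have "dist ((F y - F x) / (y - x)) D < r" if y: "y \<noteq> x \<and> dist y x < d" for y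
    proof -
      have "D - r / 2 \<le> (F y - F x) / (y - x) \<and> (F y - F x) / (y - x) \<le> D + r / 2"
      proof (cases "y > x")
        case True
        then show ?thesis using d(2)[of x y] y by (simp add: dist_real_def field_simps)
      next
        case False
        then have "y < x" using y by simp
        moreover have "(F y - F x) / (y - x) = (F x - F y) / (x - y)"
          by (metis minus_diff_eq minus_divide_divide)
        ultimately show ?thesis using d(2)[of y x] y by (simp add: dist_real_def field_simps)
      qed
      then show ?thesis using \<open>r > 0\<close> unfolding dist_real_def by linarith
    qed
    then show "\<exists>s>0. \<forall>y. y \<noteq> x \<and> dist y x < s \<longrightarrow> dist ((F y - F x) / (y - x)) D < r" using d(1) by blast
  qed
  then show ?thesis using that[of D] by (simp add: has_field_derivative_iff)
qed

text \<open>The bound is known only at points where \<open>F\<close> happens to be differentiable.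
  Such points fill the interval up to a negligible set, and near each of them there are small
  intervals of slope above any \<open>r < l\<close>; a Vitali cover by these gives the estimate. A
  singular part of \<open>F\<close> only adds to the right-hand side.\<close>

lemma derivative_lower_bound:
  assumes ab: "a \<le> b" and l: "0 < l"
    and deriv: "\<And>x D. a < x \<Longrightarrow> x < b \<Longrightarrow> (F has_real_derivative D) (at x) \<Longrightarrow> l \<le> D"
  shows "l * (b - a) \<le> F b - F a"
proof (cases "a = b")
  case False
  then have ab: "a < b" using ab by simp
  define bad where "bad = ((\<Inter>n. slope_above (real (Suc n))) \<inter> {a<..<b}) \<union>
    (\<Union>(p, q)\<in>{(p, q). p \<in> \<rat> \<and> q \<in> \<rat> \<and> 0 < p \<and> p < q}. slope_below p \<inter> slope_above q \<inter> {a<..<b})"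
  have "countable {(p, q::real). p \<in> \<rat> \<and> q \<in> \<rat> \<and> 0 < p \<and> p < q}"
    by (rule countable_subset[of _ "\<rat> \<times> \<rat>"]) (auto simp: countable_rat)
  then have "negligible (\<Union>(p, q)\<in>{(p, q). p \<in> \<rat> \<and> q \<in> \<rat> \<and> 0 < p \<and> p < q}. slope_below p \<inter> slope_above q \<inter> {a<..<b})"
    by (intro negligible_countable_Union countable_image) (auto intro: negligible_slope_gap)
  then have bad: "negligible bad"
    unfolding bad_def by (intro negligible_Un negligible_infinite_slope ab)
  have good: "x \<in> slope_above r" if x: "x \<in> {a<..<b} - bad" and r: "r < l" for x r
  proof -
    obtain n where "x \<notin> slope_above (real (Suc n))" using x by (auto simp: bad_def)
    moreover have "x \<notin> slope_below p \<inter> slope_above q" if "p \<in> \<rat>" "q \<in> \<rat>" "0 < p" "p < q" for p q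
      using x that by (auto simp: bad_def)
    ultimately obtain D where D: "(F has_real_derivative D) (at x)"
      using differentiable_at_regular_point by blast
    then have "r < D" using deriv[of x D] x r by auto
    moreover have "((\<lambda>y. (F y - F x) / (y - x)) \<longlongrightarrow> D) (at x)" using D by (simp add: has_field_derivative_iff)
    ultimately have "\<forall>\<^sub>F y in at x. r < (F y - F x) / (y - x)" by (rule order_tendstoD(1)[rotated])
    then obtain s where s: "s > 0" "\<And>y. y \<noteq> x \<Longrightarrow> dist y x < s \<Longrightarrow> r < (F y - F x) / (y - x)"
      unfolding eventually_at by auto
    show ?thesis
      unfolding slope_above_def
    proof (intro CollectI allI impI)
      fix d :: real assume d: "d > 0"
      define y where "y = x + min d s / 2"
      have y: "x < y" "y - x < d" "dist y x < s" using d s(1) by (auto simp: y_def dist_real_def)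
      then have "r * (y - x) < F y - F x" using s(2)[of y] by (simp add: field_simps)
      then show "\<exists>u v. u < v \<and> u \<le> x \<and> x \<le> v \<and> v - u < d \<and> r * (v - u) < F v - F u"
        using y by (intro exI[of _ x] exI[of _ y]) auto
    qed
  qed
  have V: "0 \<le> F b - F a" using mono[of a b] ab by simp
  have main: "r * (b - a) \<le> F b - F a" if r: "0 < r" "r < l" for r
  proof -
    obtain U where U: "U \<in> sets borel" "U \<subseteq> {a<..<b}" "negligible (({a<..<b} - bad) - U)"
      "ennreal r * emeasure lborel U \<le> emeasure M {a<..<b}"
    proof -
      have "{a<..<b} - bad \<subseteq> {a<..<b}" "{a<..<b} - bad \<subseteq> slope_above r" using good r by blast+
      then show ?thesis using slope_above_cover[OF open_greaterThanLessThan _ _ r(1)] that by metis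
    qed
    have "negligible ((({a<..<b} - bad) - U) \<union> bad)" using U(3) bad by (rule negligible_Un)
    then have "negligible ({a<..<b} - U)" by (rule negligible_subset) auto
    then have "{a<..<b} - U \<in> null_sets lborel"
      using U(1) by (simp add: negligible_iff_null_sets null_sets_def)
    then have "emeasure lborel (U \<union> ({a<..<b} - U)) = emeasure lborel U"
      using U(1) by (intro emeasure_Un_null_set) simp_all
    moreover have "U \<union> ({a<..<b} - U) = {a<..<b}" using U(2) by blast
    ultimately have "emeasure lborel {a<..<b} = emeasure lborel U" by simp
    then have "ennreal r * ennreal (b - a) \<le> emeasure M {a<..<b}" using U(4) ab by simp
    also have "\<dots> \<le> emeasure M {a..b}" by (intro emeasure_mono) auto
    also have "\<dots> = ennreal (F b - F a)" using ab by (simp add: emeasure_M)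
    finally show ?thesis using r ab V by (simp flip: ennreal_mult)
  qed
  show ?thesis
  proof (rule field_le_epsilon)
    fix e :: real assume e: "e > 0"
    \<comment> \<open>Close enough to \<open>l\<close> that at most \<open>e\<close> is lost over
      the whole interval; the maximum with \<open>l / 2\<close> keeps \<open>r\<close>
      positive.\<close>
    define r where "r = max (l / 2) (l - e / (b - a))"
    have "0 < r" "r < l" using l e ab by (auto simp: r_def)
    then have "r * (b - a) \<le> F b - F a" by (rule main)
    moreover have "(l - e / (b - a)) * (b - a) \<le> r * (b - a)"
      using ab by (intro mult_right_mono) (auto simp: r_def)
    moreover have "(l - e / (b - a)) * (b - a) = l * (b - a) - e" using ab by (simp add: left_diff_distrib)
    ultimately show "l * (b - a) \<le> F b - F a + e" by linarith
  qed
qed simp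

end

section \<open>Criteria for flatness\<close>

text \<open>Converts a gain in length into a gain in its \<open>\<alpha>\<close>-th power, by the
  mean value theorem. One factor 1/2 is in the assumed gain; the other bounds the derivative at a
  point below \<open>2 * l\<close>, where \<open>2 powr (\<alpha> - 1) \<ge> 1/2\<close>.\<close>

lemma powr_increment:
  fixes l X \<eta> \<alpha> :: real
  assumes l: "0 < l" and \<eta>: "0 \<le> \<eta>" "\<eta> \<le> 1" and X: "l + l / 2 * \<eta> \<le> X" and \<alpha>: "0 < \<alpha>" "\<alpha> \<le> 1"
  shows "\<alpha> / 4 * l powr \<alpha> * \<eta> \<le> X powr \<alpha> - l powr \<alpha>"
proof (cases "\<eta> = 0")
  case True
  then show ?thesis using X l \<alpha> by (simp add: powr_mono2)
next
  case False
  define Y where "Y = l + l / 2 * \<eta>"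
  have Y: "l < Y" "Y \<le> 2 * l" using l \<eta> False by (auto simp: Y_def mult_left_le)
  have "((\<lambda>x. x powr \<alpha>) has_real_derivative \<alpha> * x powr (\<alpha> - 1)) (at x)" if "l \<le> x" for x
    using has_real_derivative_powr[of x \<alpha>] that l by simp
  then obtain z where z: "l < z" "z < Y" "Y powr \<alpha> - l powr \<alpha> = (Y - l) * (\<alpha> * z powr (\<alpha> - 1))"
    using MVT2[OF Y(1), of "\<lambda>x. x powr \<alpha>" "\<lambda>x. \<alpha> * x powr (\<alpha> - 1)"] by auto
  have "1/2 * l powr (\<alpha> - 1) \<le> z powr (\<alpha> - 1)"
  proof -
    have "1/2 * l powr (\<alpha> - 1) = 2 powr (- 1) * l powr (\<alpha> - 1)" by (simp add: powr_minus)
    also have "\<dots> \<le> 2 powr (\<alpha> - 1) * l powr (\<alpha> - 1)"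
      using \<alpha> by (intro mult_right_mono powr_mono) auto
    also have "\<dots> = (2 * l) powr (\<alpha> - 1)" using l by (simp add: powr_mult)
    also have "\<dots> \<le> z powr (\<alpha> - 1)" using z Y l \<alpha> by (intro powr_mono2') auto
    finally show ?thesis .
  qed
  then have "(l / 2 * \<eta>) * (\<alpha> * (1/2 * l powr (\<alpha> - 1))) \<le> Y powr \<alpha> - l powr \<alpha>"
    unfolding z(3) using l \<eta> \<alpha> by (intro mult_mono) (auto simp: Y_def)
  moreover have "l * l powr (\<alpha> - 1) = l powr \<alpha>"
    using powr_add[of l 1 "\<alpha> - 1"] l by simp
  then have "(l / 2 * \<eta>) * (\<alpha> * (1/2 * l powr (\<alpha> - 1))) = \<alpha> / 4 * l powr \<alpha> * \<eta>" by (simp add: algebra_simps)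
  moreover have "Y powr \<alpha> \<le> X powr \<alpha>" using X Y l \<alpha> unfolding Y_def[symmetric] by (intro powr_mono2) auto
  ultimately show ?thesis by linarith
qed

lemma dist_to_circle_eq:
  assumes "\<bar>s - t\<bar> \<le> 1/2"
  shows "dist (to_circle s) (to_circle t) = \<bar>s - t\<bar>"
proof -
  obtain t' where t': "to_circle t' = to_circle t" "\<bar>s - t'\<bar> = dist (to_circle s) (to_circle t)"
    by (rule lift_near)
  then obtain i :: int where i: "t' = t + of_int i"
    unfolding to_circle_eq_iff by (metis Ints_cases add.commute diff_eq_eq)
  show ?thesis
  proof (cases "i = 0")
    case True
    then show ?thesis using i t'(2) by simp
  next
    case False
    then have "\<bar>i\<bar> \<ge> 1" by linarith
    then have "\<bar>of_int i :: real\<bar> \<ge> 1" by linarith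
    then have "\<bar>s - t'\<bar> \<ge> 1 - \<bar>s - t\<bar>" using i by linarith
    then have "\<bar>s - t\<bar> \<le> dist (to_circle s) (to_circle t)" using assms t'(2) by linarith
    then show ?thesis using dist_to_circle_le[of s t] by linarith
  qed
qed

text \<open>Flatness seen from the side of \<open>F\<close>: putting \<open>s = G t\<close> turns
  the loss along an inverse branch into the gain under \<open>F\<close>, which can be computed for
  concrete maps.\<close>

lemma (in circle_lift) flat_potentialI:
  assumes "0 < \<alpha>" "\<alpha> \<le> 1" "0 \<le> C" "A \<in> holder_space \<alpha>"
    and flat: "\<And>s s'. s < s' \<Longrightarrow> \<bar>F s' - F s\<bar> \<le> 1/2 \<Longrightarrow>
      \<bar>A (to_circle s') - A (to_circle s)\<bar> \<le> C * (\<bar>F s' - F s\<bar> powr \<alpha> - (s' - s) powr \<alpha>)"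
  shows "flat_potential T F m A \<alpha> C"
proof (intro flat_potential.intro flat_potential_axioms.intro assms(1-4))
  show "circle_lift T F m" by (rule circle_lift_axioms)
  fix t s :: real assume ts: "\<bar>t - s\<bar> \<le> 1/2"
  consider "G t = G s" | "G s < G t" | "G t < G s" by linarith
  then show "\<bar>A (to_circle (circle_lift.G F t)) - A (to_circle (circle_lift.G F s))\<bar>
    \<le> C * (\<bar>t - s\<bar> powr \<alpha> - \<bar>circle_lift.G F t - circle_lift.G F s\<bar> powr \<alpha>)"
  proof cases
    case 1
    then show ?thesis using assms(3) by simp
  next
    case 2
    then show ?thesis using flat[OF 2] ts by simp
  next
    case 3
    then show ?thesis using flat[OF 3] ts by (simp add: abs_minus_commute)
  qed
qed

section \<open>Maps with an affine and a tangential branch\<close>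

text \<open>A normal form for both explicit families: on the unit interval the lift is
  \<open>x * (1 + u x)\<close>. The function \<open>u\<close> measures the deviation from the
  identity at the neutral point, and the affine branch is the part where
  \<open>u = 1\<close>.\<close>

locale tangential_lift =
  fixes u :: "real \<Rightarrow> real"
  assumes u_mono: "0 \<le> x \<Longrightarrow> x \<le> y \<Longrightarrow> y \<le> 1 \<Longrightarrow> u x \<le> u y"
    and u_cont: "continuous_on {0..1} u" and u_0: "u 0 = 0" and u_1: "u 1 = 1"
    and u_pos: "0 < x \<Longrightarrow> x \<le> 1 \<Longrightarrow> 0 < u x"
begin

definition F :: "real \<Rightarrow> real" where
  "F t = 2 * of_int \<lfloor>t\<rfloor> + frac t * (1 + u (frac t))"

lemma u_bounds: "0 \<le> x \<Longrightarrow> x \<le> 1 \<Longrightarrow> 0 \<le> u x \<and> u x \<le> 1"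
  using u_mono[of 0 x] u_mono[of x 1] u_0 u_1 by auto

lemma F_unit:
  assumes "of_int n \<le> t" "t \<le> of_int n + 1"
  shows "F t = 2 * of_int n + (t - of_int n) * (1 + u (t - of_int n))"
proof (cases "t = of_int n + 1")
  case True
  then have "\<lfloor>t\<rfloor> = n + 1" by simp
  then show ?thesis using True u_1 by (simp add: F_def frac_def)
next
  case False
  then have "\<lfloor>t\<rfloor> = n" using assms by (simp add: floor_eq_iff)
  then show ?thesis by (simp add: F_def frac_def)
qed

lemma F_int: "F (of_int n) = 2 * of_int n"
  using F_unit[of n "of_int n"] by simp

text \<open>The excess over the identity is \<open>x * u x\<close>; as \<open>u\<close> increases,
  an increment of it is at least the increment of \<open>x\<close> times the value of
  \<open>u\<close> at the right end.\<close>

lemma gain_unit: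
  assumes "of_int n \<le> s" "s \<le> s'" "s' \<le> of_int n + 1"
  shows "(s' - s) + (s' - s) * u (s' - of_int n) \<le> F s' - F s"
proof -
  have "(s - of_int n) * u (s - of_int n) \<le> (s - of_int n) * u (s' - of_int n)"
    using assms by (intro mult_left_mono u_mono) auto
  then show ?thesis using assms F_unit[of n s] F_unit[of n s'] by (simp add: algebra_simps)
qed

text \<open>The part to the left of the integer belongs to the end of a branch, where
  \<open>u 1 = 1\<close>, so it gains its full length; the part to the right starts at the neutral
  point.\<close>

lemma gain_across:
  assumes "of_int n - 1 \<le> s" "s \<le> of_int n" "of_int n \<le> s'" "s' \<le> of_int n + 1"
  shows "(s' - s) + ((of_int n - s) + (s' - of_int n) * u (s' - of_int n)) \<le> F s' - F s"
  using gain_unit[of n "of_int n" s'] gain_unit[of "n - 1" s "of_int n"] assms u_1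
  by (simp add: algebra_simps)

lemma F_expand:
  assumes "s < s'"
  shows "s' - s < F s' - F s"
proof -
  have unit: "y - x < F y - F x" if "of_int n \<le> x" "x < y" "y \<le> of_int n + 1" for n x y
  proof -
    have "0 < (y - x) * u (y - of_int n)" using that by (intro mult_pos_pos u_pos) auto
    then show ?thesis using gain_unit[of n x y] that by simp
  qed
  define n where "n = \<lfloor>s\<rfloor>"
  define n' where "n' = \<lfloor>s'\<rfloor>"
  have n: "of_int n \<le> s" "s < of_int n + 1" and n': "of_int n' \<le> s'" "s' < of_int n' + 1"
    unfolding n_def n'_def by linarith+
  show ?thesis
  proof (cases "n = n'")
    case True
    then show ?thesis using unit[of n s s'] n n' assms by simp
  next
    case False
    then have "n + 1 \<le> n'" using assms n n' by linarith
    then have "of_int (n + 1) \<le> (of_int n' :: real)" by (simp only: of_int_le_iff)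
    moreover have "of_int (n + 1) - s < F (of_int (n + 1)) - F s" using unit[of n s "of_int (n + 1)"] n by simp
    moreover have "s' - of_int n' \<le> F s' - F (of_int n')"
      using unit[of n' "of_int n'" s'] n' by (cases "s' = of_int n'") auto
    moreover note F_int[of "n + 1"] F_int[of n']
    ultimately show ?thesis by argo
  qed
qed

lemma F_shift: "F (t + 1) = F t + 2"
proof -
  have "\<lfloor>t + 1\<rfloor> = \<lfloor>t\<rfloor> + 1" "frac (t + 1) = frac t" by (auto simp: frac_def)
  then show ?thesis by (simp add: F_def)
qed

lemma F_continuous: "continuous_on UNIV F"
proof -
  have unit: "continuous_on {of_int n..of_int n + 1} F" for n
  proof -
    have "continuous_on {of_int n..of_int n + 1} (\<lambda>t. 2 * of_int n + (t - of_int n) * (1 + u (t - of_int n)))"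
      by (intro continuous_intros continuous_on_compose2[OF u_cont]) auto
    then show ?thesis by (rule continuous_on_eq) (use F_unit in auto)
  qed
  have "isCont F t" for t
  proof -
    define n where "n = \<lfloor>t\<rfloor>"
    have "continuous_on ({of_int (n - 1)..of_int (n - 1) + 1} \<union> {of_int n..of_int n + 1}) F"
      by (intro continuous_on_closed_Un unit closed_atLeastAtMost)
    moreover have "{of_int n - 1<..<of_int n + 1} \<subseteq> {of_int (n - 1)..of_int (n - 1) + 1} \<union> {of_int n..of_int n + (1::real)}"
      by auto
    ultimately have "continuous_on {of_int n - 1<..<of_int n + 1} F" by (rule continuous_on_subset)
    moreover have "t \<in> {of_int n - 1<..<of_int n + 1}" unfolding n_def by (simp add: less_le_trans[of _ "of_int \<lfloor>t\<rfloor>"])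
    ultimately show ?thesis by (simp add: continuous_on_eq_continuous_at)
  qed
  then show ?thesis by (simp add: continuous_on_eq_continuous_at)
qed

lemma F_bij: "bij F"
proof (rule bijI)
  show "inj F"
  proof (rule injI)
    show "s = s'" if "F s = F s'" for s s'
      using F_expand[of s s'] F_expand[of s' s] that by (cases s s' rule: linorder_cases) auto
  qed
  have "\<exists>t. F t = y" for y
  proof -
    define n where "n = \<lfloor>y / 2\<rfloor>"
    have n: "of_int n \<le> y / 2" "y / 2 \<le> of_int n + 1" unfolding n_def by linarith+
    have "F (of_int n) \<le> y" "y \<le> F (of_int n + 1)"
      using F_int[of n] F_int[of "n + 1"] n by simp_all
    then show ?thesis
      using IVT'[of F "of_int n" y "of_int n + 1"] continuous_on_subset[OF F_continuous] by auto
  qed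
  then show "surj F" by (metis surjI)
qed

lemma circle_liftI:
  assumes "\<And>t. T (to_circle t) = to_circle (F t)"
  shows "circle_lift T F 2"
proof
  show "\<bar>s - t\<bar> < \<bar>F s - F t\<bar>" if "s \<noteq> t" for s t
    using F_expand[of s t] F_expand[of t s] that by (cases s t rule: linorder_cases) auto
qed (use F_bij F_continuous assms F_shift in auto)

text \<open>The worst case is an interval that straddles an integer. If at least half of it lies to
  the right, that part reaches a place where \<open>u\<close> is at least \<open>u (l / 2)\<close>;
  otherwise at least half lies to the left and gains its full length.\<close>

lemma gain_half:
  assumes "s < s'" "s' \<le> s + 1"
  shows "(s' - s) + (s' - s) / 2 * u ((s' - s) / 2) \<le> F s' - F s"
proof -
  define n where "n = \<lfloor>s'\<rfloor>"
  define l where "l = s' - s"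
  have n: "of_int n \<le> s'" "s' \<le> of_int n + 1" unfolding n_def by linarith+
  have l: "0 < l" "l \<le> 1" using assms by (auto simp: l_def)
  have ul: "0 \<le> u (l / 2)" "u (l / 2) \<le> 1" using u_bounds[of "l / 2"] l by auto
  have big: "l / 2 * u (l / 2) \<le> x * u x" if "l / 2 \<le> x" "x \<le> 1" for x
    using that l ul by (intro mult_mono u_mono) auto
  show ?thesis
  proof (cases "of_int n \<le> s")
    case True
    have "l / 2 * u (l / 2) \<le> l * u (s' - of_int n)"
      using l ul True n by (intro mult_mono u_mono) (auto simp: l_def)
    moreover have "l + l * u (s' - of_int n) \<le> F s' - F s"
      using gain_unit[of n s s'] True n assms by (simp add: l_def)
    ultimately show ?thesis unfolding l_def[symmetric] by linarith
  next
    case False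
    define x where "x = s' - of_int n"
    define y where "y = of_int n - s"
    have xy: "0 \<le> x" "x \<le> 1" "0 < y" "x + y = l" using n False by (auto simp: x_def y_def l_def)
    have "l / 2 * u (l / 2) \<le> y + x * u x"
    proof (cases "l / 2 \<le> x")
      case True
      then show ?thesis using big[OF True xy(2)] xy by simp
    next
      case False
      have "l / 2 * u (l / 2) \<le> l / 2 * 1" using ul l by (intro mult_left_mono) auto
      moreover have "0 \<le> x * u x" using xy u_bounds[of x] by simp
      ultimately show ?thesis using False xy by linarith
    qed
    moreover have "l + (y + x * u x) \<le> F s' - F s"
      using gain_across[of n s s'] False n assms by (simp add: x_def y_def l_def)
    ultimately show ?thesis unfolding l_def[symmetric] by linarith
  qed
qed

text \<open>The assumed oscillation of \<open>A\<close> is exactly what \<open>gain_half\<close> and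
  \<open>powr_increment\<close> return, which explains the half distance in the argument of
  \<open>u\<close>; the factor \<open>4 / \<alpha>\<close> cancels their constant.\<close>

lemma flat_potential_modulus:
  assumes T: "\<And>t. T (to_circle t) = to_circle (F t)" and \<alpha>: "0 < \<alpha>" "\<alpha> \<le> 1" and B: "0 \<le> B"
    and A: "A \<in> holder_space \<alpha>" "\<And>x y. \<bar>A x - A y\<bar> \<le> B * dist x y powr \<alpha> * u (dist x y / 2)"
  shows "flat_potential T F 2 A \<alpha> (4 * B / \<alpha>)"
proof -
  interpret circle_lift T F 2 by (rule circle_liftI[OF T])
  show ?thesis
  proof (rule flat_potentialI[OF \<alpha> _ A(1)])
    show "0 \<le> 4 * B / \<alpha>" using B \<alpha> by simp
    fix s s' :: real assume s: "s < s'" and X: "\<bar>F s' - F s\<bar> \<le> 1/2"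
    define l where "l = s' - s"
    have FX: "\<bar>F s' - F s\<bar> = F s' - F s" using F_expand[OF s] s by simp
    have l: "0 < l" "l \<le> 1/2" using F_expand[OF s] s X by (auto simp: l_def)
    have d: "dist (to_circle s') (to_circle s) = l"
      using dist_to_circle_eq[of s' s] l by (simp add: l_def)
    have ul: "0 \<le> u (l / 2)" "u (l / 2) \<le> 1" using u_bounds[of "l / 2"] l by auto
    have "l + l / 2 * u (l / 2) \<le> F s' - F s" unfolding l_def by (rule gain_half) (use s l in \<open>auto simp: l_def\<close>)
    then have inc: "\<alpha> / 4 * l powr \<alpha> * u (l / 2) \<le> (F s' - F s) powr \<alpha> - l powr \<alpha>"
      by (rule powr_increment[OF l(1) ul _ \<alpha>])
    have "\<bar>A (to_circle s') - A (to_circle s)\<bar> \<le> B * l powr \<alpha> * u (l / 2)"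
      using A(2)[of "to_circle s'" "to_circle s"] d by simp
    also have "\<dots> = 4 * B / \<alpha> * (\<alpha> / 4 * l powr \<alpha> * u (l / 2))" using \<alpha> by simp
    also have "\<dots> \<le> 4 * B / \<alpha> * ((F s' - F s) powr \<alpha> - l powr \<alpha>)"
      using inc B \<alpha> by (intro mult_left_mono) auto
    finally show "\<bar>A (to_circle s') - A (to_circle s)\<bar> \<le> 4 * B / \<alpha> * (\<bar>F s' - F s\<bar> powr \<alpha> - (s' - s) powr \<alpha>)"
      unfolding FX l_def .
  qed
qed

end

context tangential_lift
begin

text \<open>Close to the neutral point the expansion of an interval is governed by its endpoint
  farther from 0, hence the maximum in \<open>near\<close>. Elsewhere the map gains a definite
  proportion \<open>u \<epsilon>\<close>, so plain Holder continuity is enough. The two summands of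
  \<open>C\<close> serve these two cases.\<close>

lemma flat_potential_near_zero:
  assumes T: "\<And>t. T (to_circle t) = to_circle (F t)" and \<alpha>: "0 < \<alpha>" "\<alpha> \<le> 1" and B: "0 \<le> B"
    and \<epsilon>: "0 < \<epsilon>" "\<epsilon> \<le> 1/4" and A: "A \<in> holder_space \<alpha>"
    and near: "\<And>x y. - \<epsilon> < x \<Longrightarrow> x < y \<Longrightarrow> y < \<epsilon> \<Longrightarrow>
      \<bar>A (to_circle y) - A (to_circle x)\<bar> \<le> B * (y - x) powr \<alpha> * u (max \<bar>x\<bar> \<bar>y\<bar>)"
  obtains C where "flat_potential T F 2 A \<alpha> C"
proof -
  interpret circle_lift T F 2 by (rule circle_liftI[OF T])
  obtain H where H: "H \<ge> 0" "\<And>x y. \<bar>A x - A y\<bar> \<le> H * dist x y powr \<alpha>"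
    by (rule holder_spaceE[OF A]) auto
  have u\<epsilon>: "0 < u \<epsilon>" "u \<epsilon> \<le> 1" using u_pos[of \<epsilon>] u_bounds[of \<epsilon>] \<epsilon> by auto
  define C where "C = 4 * B / \<alpha> + 4 * H / (\<alpha> * u \<epsilon>)"
  have C: "4 * B / \<alpha> \<le> C" "4 * H / (\<alpha> * u \<epsilon>) \<le> C" "0 \<le> C"
    using B H \<alpha> u\<epsilon> by (auto simp: C_def)
  have "flat_potential T F 2 A \<alpha> C"
  proof (rule flat_potentialI[OF \<alpha> C(3) A])
    fix s s' :: real assume s: "s < s'" and X: "\<bar>F s' - F s\<bar> \<le> 1/2"
    define l where "l = s' - s"
    have FX: "\<bar>F s' - F s\<bar> = F s' - F s" using F_expand[OF s] s by simp
    have l: "0 < l" "l \<le> 1/2" using F_expand[OF s] s X by (auto simp: l_def)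
    have conclude: "\<bar>A (to_circle s') - A (to_circle s)\<bar> \<le> C * ((F s' - F s) powr \<alpha> - l powr \<alpha>)"
      if \<eta>: "0 \<le> \<eta>" "\<eta> \<le> 1" and gain: "l + l / 2 * \<eta> \<le> F s' - F s"
        and K: "0 \<le> K" "4 * K / \<alpha> \<le> C" and bound: "\<bar>A (to_circle s') - A (to_circle s)\<bar> \<le> K * l powr \<alpha> * \<eta>" for \<eta> K
    proof -
      have inc: "\<alpha> / 4 * l powr \<alpha> * \<eta> \<le> (F s' - F s) powr \<alpha> - l powr \<alpha>"
        by (rule powr_increment[OF l(1) \<eta> gain \<alpha>])
      then have "0 \<le> (F s' - F s) powr \<alpha> - l powr \<alpha>"
        using \<alpha> \<eta> by (meson divide_nonneg_nonneg less_imp_le mult_nonneg_nonneg order_trans powr_ge_zero zero_le_numeral)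
      then have "4 * K / \<alpha> * ((F s' - F s) powr \<alpha> - l powr \<alpha>) \<le> C * ((F s' - F s) powr \<alpha> - l powr \<alpha>)"
        using K(2) by (intro mult_right_mono)
      moreover have "4 * K / \<alpha> * (\<alpha> / 4 * l powr \<alpha> * \<eta>) \<le> 4 * K / \<alpha> * ((F s' - F s) powr \<alpha> - l powr \<alpha>)"
        using inc K \<alpha> by (intro mult_left_mono) auto
      moreover have "4 * K / \<alpha> * (\<alpha> / 4 * l powr \<alpha> * \<eta>) = K * l powr \<alpha> * \<eta>" using \<alpha> by simp
      ultimately show ?thesis using bound by linarith
    qed
    have "\<bar>A (to_circle s') - A (to_circle s)\<bar> \<le> C * ((F s' - F s) powr \<alpha> - l powr \<alpha>)"
    proof (cases "\<exists>n::int. \<bar>s - of_int n\<bar> < \<epsilon> \<and> \<bar>s' - of_int n\<bar> < \<epsilon>")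
      case True
      then obtain n :: int where n: "\<bar>s - of_int n\<bar> < \<epsilon>" "\<bar>s' - of_int n\<bar> < \<epsilon>" by blast
      define x where "x = s - of_int n"
      define y where "y = s' - of_int n"
      define r where "r = max \<bar>x\<bar> \<bar>y\<bar>"
      have xy: "- \<epsilon> < x" "x < y" "y < \<epsilon>" "y - x = l" using n s by (auto simp: x_def y_def l_def abs_less_iff)
      have "0 \<le> r" "r < \<epsilon>" using n \<epsilon> by (auto simp: r_def x_def y_def)
      then have r: "0 \<le> r" "r < \<epsilon>" "r \<le> 1/4" using \<epsilon> by auto
      have ur: "0 \<le> u r" "u r \<le> 1" using u_bounds[of r] r by auto
      have "l / 2 * u r + l \<le> F s' - F s"
      proof -
        consider "0 \<le> x" | "y \<le> 0" | "x < 0" "0 < y" by linarith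
        then show ?thesis
        proof cases
          case 1
          then have "r = y" using xy by (simp add: r_def)
          moreover have "l + l * u y \<le> F s' - F s"
            using gain_unit[of n s s'] 1 xy \<epsilon> s by (simp add: x_def y_def l_def)
          moreover have "l / 2 * u r \<le> l * u r" using l ur by (intro mult_right_mono) auto
          ultimately show ?thesis by simp
        next
          case 2
          \<comment> \<open>To the left of the integer the argument of \<open>u\<close> is at least
            3/4, while \<open>r \<le> 1/4\<close>.\<close>
          have "u r \<le> u (y + 1)" using r xy \<epsilon> 2 by (intro u_mono) auto
          then have "l / 2 * u r \<le> l * u (y + 1)" using l ur by (intro mult_mono) auto
          moreover have "l + l * u (y + 1) \<le> F s' - F s"
            using gain_unit[of "n - 1" s s'] 2 xy \<epsilon> s by (simp add: x_def y_def l_def algebra_simps)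
          ultimately show ?thesis by simp
        next
          case 3
          have "l + (- x + y * u y) \<le> F s' - F s"
            using gain_across[of n s s'] 3 xy \<epsilon> by (simp add: x_def y_def l_def)
          moreover have "l / 2 * u r \<le> - x + y * u y"
          proof (cases "- x \<le> y")
            case True
            then have ry: "r = y" using 3 by (simp add: r_def)
            have "l / 2 \<le> y" using True xy by linarith
            then have "l / 2 * u r \<le> y * u y" unfolding ry using ur ry by (intro mult_right_mono) auto
            then show ?thesis using 3 by linarith
          next
            case False
            have "l / 2 * u r \<le> l / 2 * 1" using ur l by (intro mult_left_mono) auto
            moreover have "0 \<le> y * u y" using 3 xy \<epsilon> u_bounds[of y] by simp
            moreover have "l / 2 \<le> - x" using False xy by linarith
            ultimately show ?thesis by linarith
          qed
          ultimately show ?thesis by simp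
        qed
      qed
      then have gain: "l + l / 2 * u r \<le> F s' - F s" by simp
      have "to_circle s = to_circle x" "to_circle s' = to_circle y"
        using to_circle_add_int[of x n] to_circle_add_int[of y n] by (simp_all add: x_def y_def)
      then have "\<bar>A (to_circle s') - A (to_circle s)\<bar> \<le> B * l powr \<alpha> * u r"
        using near[OF xy(1-3)] xy(4) by (simp add: r_def)
      then show ?thesis by (rule conclude[OF ur gain B C(1)])
    next
      case False
      define n where "n = \<lfloor>s'\<rfloor>"
      have n: "of_int n \<le> s'" "s' < of_int n + 1" unfolding n_def by linarith+
      \<comment> \<open>Only the last integer before \<open>s'\<close> matters: either the interval
        lies to its right and \<open>s'\<close> has gone at least \<open>\<epsilon>\<close> beyond
        it, or the interval straddles it and one of its two parts has length at least
        \<open>\<epsilon>\<close>.\<close>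
      have far: "\<not> (\<bar>s - of_int n\<bar> < \<epsilon> \<and> \<bar>s' - of_int n\<bar> < \<epsilon>)" using False by blast
      have lu: "l / 2 * u \<epsilon> \<le> l * u \<epsilon>" using l u\<epsilon> by (intro mult_right_mono) auto
      have gain: "l + l / 2 * u \<epsilon> \<le> F s' - F s"
      proof (cases "of_int n \<le> s")
        case True
        then have "\<epsilon> \<le> s' - of_int n" using far s \<epsilon> by linarith
        then have "l * u \<epsilon> \<le> l * u (s' - of_int n)"
          using l \<epsilon> n by (intro mult_left_mono u_mono) auto
        moreover have "l + l * u (s' - of_int n) \<le> F s' - F s"
          using gain_unit[of n s s'] True n s by (simp add: l_def)
        ultimately show ?thesis using lu by linarith
      next
        case nle: False
        define x where "x = s' - of_int n"
        define y where "y = of_int n - s"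
        have xy: "0 \<le> x" "x \<le> 1" "0 < y" "x + y = l" using n nle by (auto simp: x_def y_def l_def)
        have "l / 2 * u \<epsilon> \<le> y + x * u x"
        proof (cases "\<epsilon> \<le> x")
          case True
          have "y * u \<epsilon> \<le> y * 1" using xy u\<epsilon> by (intro mult_left_mono) auto
          moreover have "x * u \<epsilon> \<le> x * u x" using xy True \<epsilon> by (intro mult_left_mono u_mono) auto
          moreover have "l * u \<epsilon> = y * u \<epsilon> + x * u \<epsilon>" using xy(4) by (simp flip: distrib_right add: add.commute)
          ultimately show ?thesis using lu by linarith
        next
          case nx: False
          then have "\<epsilon> \<le> y" using far xy unfolding x_def y_def by linarith
          then have "l / 2 \<le> y" using nx xy by linarith
          moreover have "l / 2 * u \<epsilon> \<le> l / 2 * 1" using u\<epsilon> l by (intro mult_left_mono) auto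
          moreover have "0 \<le> x * u x" using xy u_bounds[of x] by simp
          ultimately show ?thesis by linarith
        qed
        moreover have "l + (y + x * u x) \<le> F s' - F s"
          using gain_across[of n s s'] nle n s l by (simp add: x_def y_def l_def)
        ultimately show ?thesis by linarith
      qed
      have "dist (to_circle s') (to_circle s) = l" using dist_to_circle_eq[of s' s] l by (simp add: l_def)
      then have "\<bar>A (to_circle s') - A (to_circle s)\<bar> \<le> H / u \<epsilon> * l powr \<alpha> * u \<epsilon>"
        using H(2)[of "to_circle s'" "to_circle s"] u\<epsilon> by simp
      moreover have "4 * (H / u \<epsilon>) / \<alpha> \<le> C" using C(2) by (simp add: mult.commute)
      moreover have "0 \<le> H / u \<epsilon>" using H(1) u\<epsilon> by simp
      ultimately show ?thesis using conclude[OF less_imp_le[OF u\<epsilon>(1)] u\<epsilon>(2) gain] by blast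
    qed
    then show "\<bar>A (to_circle s') - A (to_circle s)\<bar> \<le> C * (\<bar>F s' - F s\<bar> powr \<alpha> - (s' - s) powr \<alpha>)"
      unfolding FX l_def .
  qed
  then show ?thesis by (rule that)
qed

end

section \<open>The maps \<open>T\<^sub>q\<close> and \<open>T\<^sub>q\<^sub>l\<^sub>o\<^sub>g\<close>\<close>

text \<open>The cap at 1 produces the affine branch: for \<open>x \<ge> 1/2\<close> the lift
  \<open>x * (1 + u x)\<close> becomes \<open>2 * x\<close>.\<close>

definition pow_slope :: "real \<Rightarrow> real \<Rightarrow> real" where
  "pow_slope q x = min 1 ((2 * x) powr q)"

text \<open>The value at 0 is set by hand: \<open>ln 0 = 0\<close> would give 1 there instead of the
  limit 0.\<close>

definition log_slope :: "real \<Rightarrow> real \<Rightarrow> real" where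
  "log_slope q x = (if x \<le> 0 then 0 else (1 - ln (min 1 (2 * x))) powr (- q))"

lemma tangential_lift_pow:
  assumes "q > 0"
  shows "tangential_lift (pow_slope q)"
proof
  fix x y :: real
  show "pow_slope q x \<le> pow_slope q y" if "0 \<le> x" "x \<le> y"
  proof -
    have "(2 * x) powr q \<le> (2 * y) powr q" using that assms by (intro powr_mono2) auto
    then show ?thesis by (auto simp: pow_slope_def)
  qed
  show "continuous_on {0..1} (pow_slope q)"
    unfolding pow_slope_def using assms by (intro continuous_intros continuous_on_powr') auto
  show "pow_slope q 1 = 1" using assms ge_one_powr_ge_zero[of 2 q] by (simp add: pow_slope_def)
qed (simp_all add: pow_slope_def)

lemma tangential_lift_log:
  assumes "q > 0"
  shows "tangential_lift (log_slope q)"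
proof
  have base: "1 \<le> 1 - ln (min 1 (2 * x))" if "0 < x" for x :: real
    using that by simp
  fix x y :: real
  show "log_slope q x \<le> log_slope q y" if "0 \<le> x" "x \<le> y"
  proof (cases "x = 0")
    case False
    have "ln (min 1 (2 * x)) \<le> ln (min 1 (2 * y))" using False that by (subst ln_le_cancel_iff) auto
    then have "(1 - ln (min 1 (2 * x))) powr (- q) \<le> (1 - ln (min 1 (2 * y))) powr (- q)"
    proof (intro powr_mono2')
      have "0 < y" using False that by linarith
      then show "0 < 1 - ln (min 1 (2 * y))" using base[of y] by linarith
    qed (use assms in auto)
    then show ?thesis using False that by (simp add: log_slope_def)
  qed (simp add: log_slope_def)
  show "continuous_on {0..1} (log_slope q)"
    unfolding continuous_on_eq_continuous_within
  proof
    fix x :: real assume x: "x \<in> {0..1}"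
    show "continuous (at x within {0..1}) (log_slope q)"
    proof (cases "x = 0")
      case True
      have "((\<lambda>s. (1 - ln (2 * s)) powr (- q)) \<longlongrightarrow> 0) (at_right 0)" using assms by real_asymp
      moreover have "\<forall>\<^sub>F s in at_right 0. (1 - ln (2 * s)) powr (- q) = log_slope q s"
        unfolding eventually_at_right_field
        by (intro exI[of _ "1/2"]) (auto simp: log_slope_def)
      ultimately have "(log_slope q \<longlongrightarrow> 0) (at_right 0)" by (rule Lim_transform_eventually)
      then show ?thesis using True by (simp add: continuous_within at_within_Icc_at_right log_slope_def)
    next
      case False
      have "continuous_on {0<..} (\<lambda>x. (1 - ln (min 1 (2 * x))) powr (- q))"
      proof (intro continuous_intros ballI)
        show "min 1 (2 * x) \<noteq> 0" if "x \<in> {0<..}" for x :: real using that by (simp add: min_def)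
        show "1 - ln (min 1 (2 * x)) \<noteq> 0" if "x \<in> {0<..}" for x :: real
        proof -
          have "0 < x" using that by simp
          then show ?thesis using base[of x] by linarith
        qed
      qed
      then have "continuous_on {0<..} (log_slope q)"
        by (rule continuous_on_eq) (simp add: log_slope_def)
      then have "isCont (log_slope q) x"
        using False x by (simp add: continuous_on_eq_continuous_at)
      then show ?thesis by (rule continuous_at_imp_continuous_at_within)
    qed
  qed
  show "0 < log_slope q x" if "0 < x"
  proof -
    have "0 < 1 - ln (min 1 (2 * x))" using base[OF that] by linarith
    then show ?thesis using that by (simp add: log_slope_def)
  qed
qed (simp_all add: log_slope_def)

lemma T_pow_lift:
  assumes "q > 0"
  shows "T_pow q (to_circle t) = to_circle (tangential_lift.F (pow_slope q) t)"
proof -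
  interpret tangential_lift "pow_slope q" by (rule tangential_lift_pow[OF assms])
  define x where "x = frac t"
  have x: "0 \<le> x" "x < 1" by (auto simp: x_def frac_lt_1)
  show ?thesis
  proof (cases "x \<le> 1/2")
    case True
    then have "(2 * x) powr q \<le> 1" using x assms by (intro powr_le1) auto
    then have "F t - (1 + (2 * x) powr q) * x = of_int (2 * \<lfloor>t\<rfloor>)"
      by (simp add: F_def pow_slope_def x_def mult.commute)
    then have "to_circle (F t) = to_circle ((1 + (2 * x) powr q) * x)"
      unfolding to_circle_eq_iff by (metis Ints_of_int)
    then show ?thesis using True by (simp add: T_pow_def x_def)
  next
    case False
    then have "1 \<le> (2 * x) powr q" using assms by (intro ge_one_powr_ge_zero) auto
    then have "F t - (2 * x - 1) = of_int (2 * \<lfloor>t\<rfloor> + 1)"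
      by (simp add: F_def pow_slope_def x_def)
    then have "to_circle (F t) = to_circle (2 * x - 1)"
      unfolding to_circle_eq_iff by (metis Ints_of_int)
    then show ?thesis using False by (simp add: T_pow_def x_def)
  qed
qed

lemma T_log_lift:
  assumes "q > 0"
  shows "T_log q (to_circle t) = to_circle (tangential_lift.F (log_slope q) t)"
proof -
  interpret tangential_lift "log_slope q" by (rule tangential_lift_log[OF assms])
  define x where "x = frac t"
  have x: "0 \<le> x" "x < 1" by (auto simp: x_def frac_lt_1)
  consider "x = 0" | "0 < x" "x \<le> 1/2" | "1/2 < x" using x by linarith
  then show ?thesis
  proof cases
    case 1
    then have "F t - 0 = of_int (2 * \<lfloor>t\<rfloor>)" by (simp add: F_def x_def)
    then have "to_circle (F t) = to_circle 0"
      unfolding to_circle_eq_iff by (metis Ints_of_int)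
    then show ?thesis using 1 by (simp add: T_log_def x_def)
  next
    case 2
    then have "log_slope q x = (1 - ln (2 * x)) powr (- q)" by (simp add: log_slope_def)
    moreover have "F t = 2 * of_int \<lfloor>t\<rfloor> + x * (1 + log_slope q x)" by (simp add: F_def x_def)
    ultimately have "F t - (1 + (1 - ln (2 * x)) powr (- q)) * x = of_int (2 * \<lfloor>t\<rfloor>)"
      by (simp add: mult.commute)
    then have "to_circle (F t) = to_circle ((1 + (1 - ln (2 * x)) powr (- q)) * x)"
      unfolding to_circle_eq_iff by (metis Ints_of_int)
    then show ?thesis using 2 by (simp add: T_log_def x_def)
  next
    case 3
    then have "F t - (2 * x - 1) = of_int (2 * \<lfloor>t\<rfloor> + 1)"
      by (simp add: F_def log_slope_def x_def)
    then have "to_circle (F t) = to_circle (2 * x - 1)"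
      unfolding to_circle_eq_iff by (metis Ints_of_int)
    moreover have "frac t \<noteq> 0" using 3 unfolding x_def by linarith
    then have "t \<notin> \<int>" using frac_eq_0_iff[of t] by blast
    ultimately show ?thesis using 3 by (simp add: T_log_def x_def)
  qed
qed

text \<open>\<open>gain_half\<close> evaluates the slope at half the distance, and
  \<open>pow_slope q (d / 2)\<close> is just \<open>d powr q\<close> for \<open>d \<le> 1\<close>;
  so \<open>\<gamma> \<ge> \<alpha> + q\<close> is what the modulus criterion requires.\<close>

lemma flat_potential_pow_holder:
  assumes q: "q > 0" and \<alpha>: "0 < \<alpha>" "\<alpha> \<le> 1" and \<gamma>: "q \<le> \<gamma> - \<alpha>" and A: "A \<in> holder_space \<gamma>"
  obtains C where "flat_potential (T_pow q) (tangential_lift.F (pow_slope q)) 2 A \<alpha> C"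
proof -
  interpret tangential_lift "pow_slope q" by (rule tangential_lift_pow[OF q])
  obtain B where B: "B \<ge> 0" "\<And>x y. \<bar>A x - A y\<bar> \<le> B * dist x y powr \<gamma>"
    by (rule holder_spaceE[OF A]) auto
  have le: "dist x y powr \<gamma> \<le> dist x y powr \<alpha> * pow_slope q (dist x y / 2)" for x y :: circle
  proof -
    have d: "dist x y \<le> 1" using dist_circle_le_half[of x y] by simp
    then have "dist x y powr \<gamma> \<le> dist x y powr (\<alpha> + q)" using \<gamma> by (intro powr_mono') auto
    moreover have "dist x y powr q \<le> 1" using d q by (intro powr_le1) auto
    ultimately show ?thesis by (simp add: pow_slope_def powr_add)
  qed
  have bound: "\<bar>A x - A y\<bar> \<le> B * dist x y powr \<alpha> * pow_slope q (dist x y / 2)" for x y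
    using B(2)[of x y] mult_left_mono[OF le[of x y] B(1)] by (simp add: mult.assoc)
  have "A \<in> holder_space \<alpha>"
  proof (rule holder_spaceI)
    fix x y :: circle
    have "B * dist x y powr \<alpha> * pow_slope q (dist x y / 2) \<le> B * dist x y powr \<alpha> * 1"
      using B(1) by (intro mult_left_mono) (auto simp: pow_slope_def)
    then show "\<bar>A x - A y\<bar> \<le> B * dist x y powr \<alpha>" using bound[of x y] by simp
  qed
  then show ?thesis
    using flat_potential_modulus[OF T_pow_lift[OF q] \<alpha> B(1) _ bound] that by blast
qed

lemma flat_potential_log:
  assumes q: "q > 0" and \<alpha>: "0 < \<alpha>" "\<alpha> \<le> 1" and \<omega>: "log_holder_modulus \<alpha> q \<omega>" and A: "A \<in> modulus_space \<omega>"
  obtains C where "flat_potential (T_log q) (tangential_lift.F (log_slope q)) 2 A \<alpha> C"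
proof -
  interpret tangential_lift "log_slope q" by (rule tangential_lift_log[OF q])
  obtain D where D: "\<And>x y. \<bar>A x - A y\<bar> \<le> D * \<omega> (dist x y)" using A by (auto simp: modulus_space_def)
  obtain r0 where r0: "r0 > 1" "\<And>r. r \<in> {0<..1} \<Longrightarrow> \<omega> r = r powr \<alpha> / (ln (r0 / r)) powr q"
    using \<omega> by (auto simp: log_holder_modulus_def)
  \<comment> \<open>Compares the logarithm with constant \<open>r0\<close> in the modulus to the one
    with constant 1 in the slope: \<open>ln (r0 / d) \<ge> \<kappa> * (1 - ln d)\<close> on
    \<open>(0, 1]\<close>.\<close>
  define \<kappa> where "\<kappa> = min 1 (ln r0)"
  have \<kappa>: "0 < \<kappa>" "\<kappa> \<le> 1" "\<kappa> \<le> ln r0" using r0(1) by (auto simp: \<kappa>_def)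
  define B where "B = \<bar>D\<bar> * \<kappa> powr (- q)"
  have B: "0 \<le> B" by (simp add: B_def)
  have bound: "\<bar>A x - A y\<bar> \<le> B * dist x y powr \<alpha> * log_slope q (dist x y / 2)" for x y
  proof (cases "x = y")
    case False
    define d where "d = dist x y"
    have d: "0 < d" "d \<le> 1" using False dist_circle_le_half[of x y] by (auto simp: d_def)
    have lnd: "ln d \<le> 0" using d by simp
    have "\<kappa> * (1 - ln d) \<le> ln r0 - ln d"
    proof -
      have "(- ln d) * \<kappa> \<le> (- ln d) * 1" using \<kappa> lnd by (intro mult_left_mono) auto
      then show ?thesis using \<kappa>(3) by (simp add: algebra_simps)
    qed
    also have "\<dots> = ln (r0 / d)" using r0(1) d by (simp add: ln_div)
    finally have "(ln (r0 / d)) powr (- q) \<le> (\<kappa> * (1 - ln d)) powr (- q)"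
      using \<kappa> lnd q by (intro powr_mono2') auto
    also have "\<dots> = \<kappa> powr (- q) * log_slope q (d / 2)"
      using \<kappa> lnd d by (simp add: powr_mult log_slope_def)
    finally have 1: "(ln (r0 / d)) powr (- q) \<le> \<kappa> powr (- q) * log_slope q (d / 2)" .
    have "\<bar>A x - A y\<bar> \<le> D * \<omega> d" using D[of x y] by (simp add: d_def)
    also have "D * \<omega> d = D * (d powr \<alpha> * (ln (r0 / d)) powr (- q))"
      using r0(2)[of d] d by (simp add: powr_minus divide_inverse)
    also have "\<dots> \<le> \<bar>D\<bar> * (d powr \<alpha> * (ln (r0 / d)) powr (- q))"
      by (intro mult_right_mono) auto
    also have "\<dots> \<le> \<bar>D\<bar> * (d powr \<alpha> * (\<kappa> powr (- q) * log_slope q (d / 2)))"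
      by (intro mult_left_mono 1) auto
    finally show ?thesis by (simp add: B_def d_def mult_ac)
  qed simp
  have "A \<in> holder_space \<alpha>"
  proof (rule holder_spaceI)
    fix x y :: circle
    have "log_slope q (dist x y / 2) \<le> 1" using u_bounds[of "dist x y / 2"] dist_circle_le_half[of x y] by simp
    then have "B * dist x y powr \<alpha> * log_slope q (dist x y / 2) \<le> B * dist x y powr \<alpha> * 1"
      using B by (intro mult_left_mono) auto
    then show "\<bar>A x - A y\<bar> \<le> B * dist x y powr \<alpha>" using bound[of x y] by simp
  qed
  then show ?thesis
    using flat_potential_modulus[OF T_log_lift[OF q] \<alpha> B _ bound] that by blast
qed

lemma flat_at_zero_bound:
  assumes "flat_at_zero \<gamma> A" "\<gamma> > 0"
  obtains \<epsilon> B where "0 < \<epsilon>" "\<epsilon> \<le> 1/4" "0 \<le> B" "\<And>x y. - \<epsilon> < x \<Longrightarrow> x < y \<Longrightarrow> y < \<epsilon> \<Longrightarrow>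
      \<bar>A (to_circle y) - A (to_circle x)\<bar> \<le> B * (y - x) * max \<bar>x\<bar> \<bar>y\<bar> powr \<gamma>"
proof -
  obtain \<epsilon>0 A' where \<epsilon>0: "\<epsilon>0 > 0"
    and deriv: "\<And>r. r \<in> {-\<epsilon>0<..<\<epsilon>0} \<Longrightarrow> ((\<lambda>s. A (to_circle s)) has_real_derivative A' r) (at r)"
    and cont: "continuous_on {-\<epsilon>0<..<\<epsilon>0} A'" and big: "A' \<in> O[at 0](\<lambda>r. \<bar>r\<bar> powr \<gamma>)"
    using assms(1) unfolding flat_at_zero_def by blast
  obtain B where B: "B > 0" "\<forall>\<^sub>F r in at 0. norm (A' r) \<le> B * norm (\<bar>r\<bar> powr \<gamma>)"
    using landau_o.bigE[OF big] by blast
  then obtain d where d: "d > 0" "\<And>r. r \<noteq> 0 \<Longrightarrow> \<bar>r\<bar> < d \<Longrightarrow> \<bar>A' r\<bar> \<le> B * \<bar>r\<bar> powr \<gamma>"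
    unfolding eventually_at by (auto simp: dist_real_def)
  \<comment> \<open>The estimate at 0 given by Landau's symbol leaves out the point 0 itself;
    continuity of \<open>A'\<close> supplies it, and the mean value theorem may then land
    there.\<close>
  have A'0: "A' 0 = 0"
  proof -
    have "isCont A' 0" using cont \<epsilon>0 by (simp add: continuous_on_eq_continuous_at)
    then have lim1: "(\<lambda>r. \<bar>A' r\<bar>) \<midarrow>0\<rightarrow> \<bar>A' 0\<bar>" unfolding isCont_def by (rule tendsto_rabs)
    have lim2: "(\<lambda>r. B * \<bar>r\<bar> powr \<gamma>) \<midarrow>0\<rightarrow> B * 0"
    proof (intro tendsto_mult tendsto_const)
      have "(\<lambda>r::real. \<bar>r\<bar> powr \<gamma>) \<midarrow>0\<rightarrow> \<bar>0\<bar> powr \<gamma>"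
        using assms(2) by (intro tendsto_powr' tendsto_rabs tendsto_ident_at tendsto_const) auto
      then show "(\<lambda>r::real. \<bar>r\<bar> powr \<gamma>) \<midarrow>0\<rightarrow> 0" using assms(2) by simp
    qed
    have "\<bar>A' 0\<bar> \<le> B * 0"
      by (rule tendsto_le[OF _ lim2 lim1]) (use B(2) in simp_all)
    then show ?thesis by simp
  qed
  define \<epsilon> where "\<epsilon> = min (min \<epsilon>0 d) (1/4)"
  have \<epsilon>: "0 < \<epsilon>" "\<epsilon> \<le> 1/4" "\<epsilon> \<le> \<epsilon>0" "\<epsilon> \<le> d" using \<epsilon>0 d by (auto simp: \<epsilon>_def)
  have "\<bar>A (to_circle y) - A (to_circle x)\<bar> \<le> B * (y - x) * max \<bar>x\<bar> \<bar>y\<bar> powr \<gamma>"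
    if xy: "- \<epsilon> < x" "x < y" "y < \<epsilon>" for x y
  proof -
    have der: "((\<lambda>s. A (to_circle s)) has_real_derivative A' r) (at r)" if "x \<le> r" "r \<le> y" for r
      using that xy \<epsilon> by (intro deriv) auto
    obtain z where z: "x < z" "z < y" "A (to_circle y) - A (to_circle x) = (y - x) * A' z"
      using MVT2[OF xy(2) der] by blast
    have "\<bar>z\<bar> \<le> max \<bar>x\<bar> \<bar>y\<bar>" using z by (auto simp: abs_if max_def)
    then have "\<bar>z\<bar> powr \<gamma> \<le> max \<bar>x\<bar> \<bar>y\<bar> powr \<gamma>" using assms(2) by (intro powr_mono2) auto
    then have "B * \<bar>z\<bar> powr \<gamma> \<le> B * max \<bar>x\<bar> \<bar>y\<bar> powr \<gamma>" using B(1) by simp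
    moreover have "\<bar>A' z\<bar> \<le> B * \<bar>z\<bar> powr \<gamma>"
    proof (cases "z = 0")
      case False
      then show ?thesis using d(2)[OF False] z xy \<epsilon> by simp
    qed (simp add: A'0)
    ultimately have "(y - x) * \<bar>A' z\<bar> \<le> (y - x) * (B * max \<bar>x\<bar> \<bar>y\<bar> powr \<gamma>)"
      using xy by (intro mult_left_mono) auto
    then show ?thesis using xy by (simp add: z(3) abs_mult mult_ac)
  qed
  then show ?thesis using that[of \<epsilon> B] \<epsilon> B(1) by simp
qed

text \<open>With \<open>l = y - x \<le> 2 * r\<close>, the factor \<open>l\<close> splits as
  \<open>l powr \<alpha>\<close> times at most \<open>2 * r powr (1 - \<alpha>)\<close>. The
  remaining exponent of \<open>r\<close> is \<open>\<gamma> + 1 - \<alpha> \<ge> q\<close>, as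
  required for comparison with the slope.\<close>

lemma flat_potential_pow_flat:
  assumes q: "q > 0" and \<alpha>: "0 < \<alpha>" "\<alpha> \<le> 1" and \<gamma>: "q < \<gamma>" "q \<le> \<gamma> + 1 - \<alpha>"
    and A: "A \<in> holder_space \<alpha>" "flat_at_zero \<gamma> A"
  obtains C where "flat_potential (T_pow q) (tangential_lift.F (pow_slope q)) 2 A \<alpha> C"
proof -
  interpret tangential_lift "pow_slope q" by (rule tangential_lift_pow[OF q])
  obtain \<epsilon> B where \<epsilon>: "0 < \<epsilon>" "\<epsilon> \<le> 1/4" and B: "0 \<le> B"
    and near: "\<And>x y. - \<epsilon> < x \<Longrightarrow> x < y \<Longrightarrow> y < \<epsilon> \<Longrightarrow>
      \<bar>A (to_circle y) - A (to_circle x)\<bar> \<le> B * (y - x) * max \<bar>x\<bar> \<bar>y\<bar> powr \<gamma>"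
    using flat_at_zero_bound[OF A(2)] q \<gamma> by (metis less_trans)
  have near': "\<bar>A (to_circle y) - A (to_circle x)\<bar> \<le> 2 * B * (y - x) powr \<alpha> * pow_slope q (max \<bar>x\<bar> \<bar>y\<bar>)"
    if xy: "- \<epsilon> < x" "x < y" "y < \<epsilon>" for x y
  proof -
    define r where "r = max \<bar>x\<bar> \<bar>y\<bar>"
    define l where "l = y - x"
    have r: "0 < r" "r \<le> 1/4" using xy \<epsilon> by (auto simp: r_def abs_if max_def)
    have l: "0 < l" "l \<le> 2 * r" using xy by (auto simp: l_def r_def)
    have "l = l powr \<alpha> * l powr (1 - \<alpha>)" using l by (simp flip: powr_add)
    also have "\<dots> \<le> l powr \<alpha> * (2 * r) powr (1 - \<alpha>)"
      using l \<alpha> by (intro mult_left_mono powr_mono2) auto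
    also have "(2 * r) powr (1 - \<alpha>) = 2 powr (1 - \<alpha>) * r powr (1 - \<alpha>)" using r by (simp add: powr_mult)
    also have "l powr \<alpha> * (2 powr (1 - \<alpha>) * r powr (1 - \<alpha>)) \<le> l powr \<alpha> * (2 * r powr (1 - \<alpha>))"
      using \<alpha> powr_mono[of "1 - \<alpha>" 1 2] by (intro mult_left_mono mult_right_mono) auto
    finally have "l * r powr \<gamma> \<le> l powr \<alpha> * (2 * r powr (1 - \<alpha>)) * r powr \<gamma>"
      by (intro mult_right_mono) auto
    also have "\<dots> = 2 * l powr \<alpha> * r powr (1 - \<alpha> + \<gamma>)" by (simp add: powr_add)
    also have "\<dots> \<le> 2 * l powr \<alpha> * r powr q"
      using \<gamma> r by (intro mult_left_mono powr_mono') auto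
    also have "\<dots> \<le> 2 * l powr \<alpha> * pow_slope q r"
    proof (intro mult_left_mono)
      have "r powr q \<le> (2 * r) powr q" "r powr q \<le> 1" using r q by (auto intro!: powr_mono2 powr_le1)
      then show "r powr q \<le> pow_slope q r" by (simp add: pow_slope_def)
    qed simp
    finally have "B * (l * r powr \<gamma>) \<le> B * (2 * l powr \<alpha> * pow_slope q r)"
      using B by (intro mult_left_mono)
    then show ?thesis using near[OF xy] by (simp add: l_def r_def mult_ac)
  qed
  show ?thesis
    by (rule flat_potential_near_zero[OF T_pow_lift[OF q] \<alpha> _ \<epsilon> A(1) near']) (use B that in auto)
qed

section \<open>Self-coverings\<close>

text \<open>Of the two values at distance \<open>e\<close> on either side of a maximum, the larger
  one is attained again on the opposite side, by the intermediate value theorem, against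
  injectivity.\<close>

lemma locally_injective_no_maximum:
  fixes F :: "real \<Rightarrow> real"
  assumes cont: "continuous_on UNIV F" and x: "a < x" "x < b"
    and max: "\<And>y. a \<le> y \<Longrightarrow> y \<le> b \<Longrightarrow> F y \<le> F x"
    and inj: "d > 0" "inj_on F (ball x d)"
  shows False
proof -
  define e where "e = min (d / 2) (min (x - a) (b - x))"
  have e: "0 < e" "e < d" "a \<le> x - e" "x + e \<le> b" using x inj(1) by (auto simp: e_def)
  have cont': "continuous_on S F" for S using continuous_on_subset[OF cont] by auto
  have in_ball: "y \<in> ball x d" if "x - e \<le> y" "y \<le> x + e" for y
    using that e by (auto simp: dist_real_def abs_if)
  show False
  proof (cases "F (x - e) \<le> F (x + e)")
    case True
    have "F (x + e) \<le> F x" using max e by simp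
    then obtain z where z: "x - e \<le> z" "z \<le> x" "F z = F (x + e)"
      using IVT'[of F "x - e" "F (x + e)" x] True e cont' by auto
    have "z \<in> ball x d" "x + e \<in> ball x d" using z(1,2) e by (intro in_ball; linarith)+
    then have "z = x + e" using inj_onD[OF inj(2) z(3)] by blast
    then show False using z e by simp
  next
    case False
    have "F (x - e) \<le> F x" using max e by simp
    then obtain z where z: "x \<le> z" "z \<le> x + e" "F z = F (x - e)"
      using IVT2'[of F "x + e" "F (x - e)" x] False e cont' by auto
    have "z \<in> ball x d" "x - e \<in> ball x d" using z(1,2) e by (intro in_ball; linarith)+
    then have "z = x - e" using inj_onD[OF inj(2) z(3)] by blast
    then show False using z e by simp
  qed
qed

text \<open>An argument as in Rolle's theorem: equal values at \<open>a\<close> and \<open>b\<close>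
  force an extremum strictly between them.\<close>

lemma locally_injective_imp_injective:
  fixes F :: "real \<Rightarrow> real"
  assumes cont: "continuous_on UNIV F" and inj: "\<And>x. \<exists>d>0. inj_on F (ball x d)"
  shows "inj F"
proof -
  have False if ab: "a < b" "F a = F b" for a b
  proof -
    have cont': "continuous_on {a..b} F" by (rule continuous_on_subset[OF cont]) simp
    obtain p where p: "p \<in> {a..b}" "\<And>y. y \<in> {a..b} \<Longrightarrow> F y \<le> F p"
      using continuous_attains_sup[of "{a..b}" F] cont' ab by auto
    obtain r where r: "r \<in> {a..b}" "\<And>y. y \<in> {a..b} \<Longrightarrow> F r \<le> F y"
      using continuous_attains_inf[of "{a..b}" F] cont' ab by auto
    show False
    proof (cases "F p = F a")
      case False
      then have "a < p" "p < b" using p(1) ab by (auto simp: less_le)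
      moreover obtain d where "d > 0" "inj_on F (ball p d)" using inj by blast
      ultimately show False using p(2) by (intro locally_injective_no_maximum[OF cont, of a p b d]) auto
    next
      case Fp: True
      \<comment> \<open>If the minimum equals the value at the endpoints as well, the function is
        constant on the interval and any interior point will do.\<close>
      define x where "x = (if F r = F a then (a + b) / 2 else r)"
      have x: "a < x" "x < b" using r(1) ab by (auto simp: x_def less_le)
      have min: "F x \<le> F y" if "y \<in> {a..b}" for y
      proof (cases "F r = F a")
        case True
        have "F x \<le> F p" using p(2)[of x] x by simp
        then show ?thesis using r(2)[OF that] Fp True by simp
      next
        case False
        then show ?thesis using r(2)[OF that] by (simp add: x_def)
      qed
      obtain d where d: "d > 0" "inj_on F (ball x d)" using inj by blast
      have "inj_on (\<lambda>y. - F y) (ball x d)" using d(2) by (simp add: inj_on_def)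
      then show False
        using x min d(1) by (intro locally_injective_no_maximum[of "\<lambda>y. - F y" a x b d] continuous_on_minus cont) auto
    qed
  qed
  then show ?thesis by (intro injI) (metis linorder_neqE_linordered_idom)
qed

text \<open>The circle is embedded in the nonzero complex numbers by \<open>E\<close>; on the
  contractible line the composite has a continuous logarithm, whose imaginary part divided by
  \<open>2 * pi\<close> is the lift.\<close>

lemma circle_map_lift_exists:
  assumes "continuous_on UNIV T"
  obtains F where "continuous_on UNIV F" "\<And>t. T (to_circle t) = to_circle (F t)"
proof -
  define E :: "circle \<Rightarrow> complex" where "E y = exp (\<i> * of_real (2 * pi * coord y))" for y
  have "E (to_circle t) = exp (\<i> * of_real (2 * pi * t))" for t
  proof -
    have "\<i> * of_real (2 * pi * frac t) = \<i> * of_real (2 * pi * t) + (of_int (2 * (- \<lfloor>t\<rfloor>)) * pi) * \<i>"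
      by (simp add: frac_def algebra_simps)
    then show ?thesis unfolding E_def coord_to_circle exp_eq by blast
  qed
  then have "continuous_on UNIV E"
    by (intro continuous_on_circleI) (auto intro!: continuous_intros)
  moreover have "continuous_on UNIV (\<lambda>t. T (to_circle t))"
    by (rule continuous_on_compose2[OF assms]) (auto intro!: continuous_intros)
  ultimately have "continuous_on UNIV (\<lambda>t. E (T (to_circle t)))"
    by (rule continuous_on_compose2) auto
  then obtain g where g: "continuous_on UNIV g" "\<And>t::real. E (T (to_circle t)) = exp (g t)"
    using continuous_logarithm_on_contractible[of UNIV "\<lambda>t::real. E (T (to_circle t))"]
    by (auto simp: E_def convex_imp_contractible)
  define F where "F t = Im (g t) / (2 * pi)" for t
  have "T (to_circle t) = to_circle (F t)" for t
  proof -
    have "exp (g t) = exp (\<i> * of_real (2 * pi * coord (T (to_circle t))))"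
      using g(2)[of t] by (simp add: E_def)
    then obtain n :: int where "g t = \<i> * of_real (2 * pi * coord (T (to_circle t))) + (of_int (2 * n) * pi) * \<i>"
      unfolding exp_eq by blast
    then have "F t = coord (T (to_circle t)) + of_int n"
      by (simp add: F_def field_simps)
    then have "to_circle (F t) = to_circle (coord (T (to_circle t)))" by (metis to_circle_add_int)
    then show ?thesis by simp
  qed
  moreover have "continuous_on UNIV F" unfolding F_def using g(1) by (intro continuous_intros) auto
  ultimately show ?thesis using that by blast
qed

lemma covering_space_locally_injective:
  assumes "covering_space UNIV T UNIV"
  obtains U where "open U" "x \<in> U" "inj_on T U"
proof -
  obtain V v where V: "T x \<in> V" "\<Union>v = UNIV \<inter> T -` V" "\<forall>u\<in>v. openin (top_of_set UNIV) u"
    "\<forall>u\<in>v. \<exists>q. homeomorphism u V T q"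
    using assms unfolding covering_space_def by (metis UNIV_I)
  then obtain u where u: "u \<in> v" "x \<in> u" by blast
  then obtain q where "homeomorphism u V T q" using V(4) by blast
  then have "inj_on T u" by (metis homeomorphism_apply1 inj_on_inverseI)
  moreover have "open u" using V(3) u(1) by simp
  ultimately show ?thesis using that u(2) by blast
qed

lemma integer_valued_constant:
  fixes f :: "real \<Rightarrow> real"
  assumes "continuous_on UNIV f" "\<And>t. f t \<in> \<int>"
  obtains m :: int where "\<And>t. f t = of_int m"
proof -
  have "f constant_on UNIV"
  proof (rule continuous_discrete_range_constant[OF connected_UNIV assms(1)])
    show "\<exists>e>0. \<forall>y. y \<in> UNIV \<and> f y \<noteq> f x \<longrightarrow> e \<le> norm (f y - f x)" for x
      using Ints_nonzero_abs_ge1[OF Ints_diff[OF assms(2) assms(2)]] by (intro exI[of _ 1]) auto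
  qed
  then show ?thesis using that assms(2) unfolding constant_on_def by (metis Ints_cases UNIV_I)
qed

text \<open>Local injectivity of a covering makes the lift injective. Hence
  \<open>m \<noteq> 0\<close>, and \<open>\<bar>m\<bar> = 1\<close> would make \<open>T\<close>
  itself injective, against fibres with \<open>k \<ge> 2\<close> points.\<close>

lemma self_covering_lift:
  assumes cov: "self_covering k T" and k: "2 \<le> k"
  obtains F m where "continuous_on UNIV F" "inj F" "surj F" "\<And>t. T (to_circle t) = to_circle (F t)"
    "\<And>t. F (t + 1) = F t + of_int m" "2 \<le> \<bar>m\<bar>"
proof -
  have cs: "covering_space UNIV T UNIV" and card: "\<And>y. card (T -` {y}) = k"
    using cov by (auto simp: self_covering_def)
  obtain F where F: "continuous_on UNIV F" "\<And>t. T (to_circle t) = to_circle (F t)"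
    using circle_map_lift_exists covering_space_imp_continuous[OF cs] by blast
  have "\<exists>d>0. inj_on F (ball t d)" for t
  proof -
    obtain U where U: "open U" "to_circle t \<in> U" "inj_on T U"
      by (rule covering_space_locally_injective[OF cs])
    have "open (to_circle -` U)"
      using U(1) by (intro open_vimage continuous_intros) auto
    then obtain d where d: "d > 0" "ball t d \<subseteq> to_circle -` U"
      using U(2) open_contains_ball by blast
    have "inj_on F (ball t (min d (1/2)))"
    proof (rule inj_onI)
      fix s s' assume s: "s \<in> ball t (min d (1/2))" "s' \<in> ball t (min d (1/2))" "F s = F s'"
      have "to_circle s \<in> U" "to_circle s' \<in> U" using s d(2) by auto
      then have "to_circle s = to_circle s'" using inj_onD[OF U(3)] F(2) s(3) by metis
      then obtain i :: int where i: "s - s' = of_int i" unfolding to_circle_eq_iff by (auto elim: Ints_cases)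
      have "\<bar>s - s'\<bar> < 1" using s(1,2) by (auto simp: dist_real_def abs_if split: if_splits)
      then have "of_int \<bar>i\<bar> < (1::real)" using i by simp
      then have "\<bar>i\<bar> < 1" by (simp only: of_int_less_1_iff)
      then show "s = s'" using i by simp
    qed
    then show ?thesis using d(1) by (intro exI[of _ "min d (1/2)"]) auto
  qed
  then have inj: "inj F" by (rule locally_injective_imp_injective[OF F(1)])
  have Ints: "F (t + 1) - F t \<in> \<int>" for t
  proof -
    have "to_circle (t + 1) = to_circle t" using to_circle_add_int[of t 1] by simp
    then show ?thesis unfolding to_circle_eq_iff[symmetric] F(2)[symmetric] by simp
  qed
  have "continuous_on UNIV (\<lambda>t. F (t + 1) - F t)"
    by (intro continuous_intros F(1) continuous_on_compose2[OF F(1)]) auto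
  then obtain m :: int where "\<And>t. F (t + 1) - F t = of_int m"
    using integer_valued_constant[of "\<lambda>t. F (t + 1) - F t"] Ints by blast
  then have m: "F (t + 1) = F t + of_int m" for t by (metis add.commute diff_add_cancel)
  have "m \<noteq> 0" using m[of 0] injD[OF inj, of 1 0] by auto
  have shift: "F (t + of_int i) = F t + of_int m * of_int i" for t i
    by (rule shift_by_int[of F, OF m])
  have "\<exists>t. F t = y" for y
  proof -
    \<comment> \<open>Evaluation at \<open>m * N\<close> and \<open>- (m * N)\<close> produces
      multiples of \<open>m * m\<close>, whose sign is known whatever the orientation.\<close>
    define N where "N = \<lceil>\<bar>y - F 0\<bar>\<rceil>"
    have N: "\<bar>y - F 0\<bar> \<le> of_int N" unfolding N_def by linarith
    have "F (of_int (m * N)) = F 0 + of_int (m * m) * of_int N"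
      "F (of_int (- (m * N))) = F 0 - of_int (m * m) * of_int N"
      using shift[of 0 "m * N"] shift[of 0 "- (m * N)"] by simp_all
    moreover have "of_int N \<le> (of_int (m * m) * of_int N :: real)"
    proof -
      have "0 < m * m" using \<open>m \<noteq> 0\<close> by (auto simp: zero_less_mult_iff)
      then have "1 \<le> m * m" by linarith
      then have "(1::real) \<le> of_int (m * m)" by (simp only: of_int_1_le_iff)
      then show ?thesis using N mult_right_mono[of 1 "of_int (m * m)" "of_int N :: real"] by simp
    qed
    ultimately have "y \<in> {F (of_int (- (m * N)))..F (of_int (m * N))}" using N by auto
    moreover have "connected (range F)" by (rule connected_continuous_image[OF F(1) connected_UNIV])
    ultimately have "y \<in> range F"
      using connected_contains_Icc[of "range F" "F (of_int (- (m * N)))" "F (of_int (m * N))"] by auto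
    then show ?thesis by auto
  qed
  then have surj: "surj F" by (metis surjI)
  have "\<bar>m\<bar> \<noteq> 1"
  proof
    assume m1: "\<bar>m\<bar> = 1"
    then have mm: "m * m = 1" by (auto simp: abs_if split: if_splits)
    have "x = y" if "T x = T y" for x y
    proof -
      have "to_circle (F (coord x)) = to_circle (F (coord y))"
        using F(2)[of "coord x"] F(2)[of "coord y"] that by simp
      then obtain j :: int where j: "F (coord x) = F (coord y) + of_int j"
        unfolding to_circle_eq_iff by (metis Ints_cases add.commute diff_eq_eq)
      have "F (coord y + of_int (j * m)) = F (coord y) + of_int (m * m * j)"
        using shift[of "coord y" "j * m"] by (simp add: mult_ac)
      then have "F (coord y + of_int (j * m)) = F (coord x)" using j mm by simp
      then have "coord y + of_int (j * m) = coord x" by (rule injD[OF inj])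
      then show "x = y" by (metis to_circle_add_int to_circle_coord)
    qed
    then have "T -` {T x} = {x}" for x by auto
    then show False using card[of "T undefined"] k by simp
  qed
  then have "2 \<le> \<bar>m\<bar>" using \<open>m \<noteq> 0\<close> by linarith
  then show ?thesis using that F inj surj m by blast
qed

text \<open>\<open>F\<close> is increasing; \<open>e = \<plusminus>1\<close> is the orientation of the covering, whose lift is \<open>e F\<close>.\<close>

locale covering_lift = continuous_mono F for F :: "real \<Rightarrow> real" +
  fixes T :: "circle \<Rightarrow> circle" and e m :: int
  assumes bij_F: "bij F" and orientation: "\<bar>e\<bar> = 1"
    and lift: "T (to_circle t) = to_circle (of_int e * F t)"
    and shift: "F (t + 1) = F t + of_int m" and degree: "2 \<le> m"
    and expanding: "expanding_away_from T (to_circle 0)"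
begin

lemma e_cases: "e = 1 \<or> e = - 1"
  using orientation by linarith

lemma expanding_derivative:
  assumes "\<epsilon> > 0"
  obtains l where "l > 1" "\<And>t D. \<epsilon> \<le> dist (to_circle t) (to_circle 0) \<Longrightarrow>
    (F has_real_derivative D) (at t) \<Longrightarrow> l \<le> D"
proof -
  have "open (ball (to_circle 0) \<epsilon>)" "to_circle 0 \<in> ball (to_circle 0) \<epsilon>" using assms by auto
  then obtain l where l: "l > 1"
    "\<And>x D. x \<notin> ball (to_circle 0) \<epsilon> \<Longrightarrow> circle_deriv_within T x UNIV D \<Longrightarrow> l \<le> \<bar>D\<bar>"
    using expanding unfolding expanding_away_from_def by meson
  have "l \<le> D" if t: "\<epsilon> \<le> dist (to_circle t) (to_circle 0)" and D: "(F has_real_derivative D) (at t)" for t D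
  proof -
    have "circle_deriv_within T (to_circle t) UNIV (of_int e * D)"
      unfolding circle_deriv_within_def
    proof (intro exI[of _ "\<lambda>s. of_int e * F (t + s)"] conjI allI)
      fix s
      have "to_circle (coord (to_circle t) + s) = to_circle (t + s)"
        by (simp add: to_circle_eq_iff frac_def)
      then show "to_circle (of_int e * F (t + s)) = T (to_circle (coord (to_circle t) + s))"
        by (simp add: lift)
      have "((\<lambda>s. F (t + s)) has_real_derivative D) (at 0)"
        using D DERIV_shift[of F D 0 t] by (simp add: add.commute)
      then show "((\<lambda>s. of_int e * F (t + s)) has_real_derivative of_int e * D) (at 0 within UNIV)"
        by (intro DERIV_cmult) 
    qed
    moreover have "to_circle t \<notin> ball (to_circle 0) \<epsilon>" using t by (simp add: dist_commute)
    ultimately have "l \<le> \<bar>of_int e * D\<bar>" using l(2) by blast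
    also have "\<dots> = \<bar>D\<bar>" using e_cases by auto
    finally have lD: "l \<le> \<bar>D\<bar>" .
    \<comment> \<open>Expansion is given for the absolute value; monotonicity of \<open>F\<close>
      fixes the sign.\<close>
    moreover have "0 \<le> D"
    proof (rule ccontr)
      assume "\<not> 0 \<le> D"
      then obtain d where "d > 0" "\<And>h. 0 < h \<Longrightarrow> h < d \<Longrightarrow> F (t + h) < F t"
        using DERIV_neg_dec_right[OF D] by auto
      then have "F (t + d / 2) < F t" by simp
      then show False using mono[of t "t + d / 2"] \<open>d > 0\<close> by simp
    qed
    ultimately show ?thesis by simp
  qed
  then show ?thesis using that l(1) by blast
qed

lemma dist_zero:
  fixes n :: int
  assumes "of_int n + \<epsilon> \<le> t" "t \<le> of_int n + 1 - \<epsilon>"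
  shows "\<epsilon> \<le> dist (to_circle t) (to_circle 0)"
proof -
  obtain s where s: "to_circle s = to_circle 0" "\<bar>t - s\<bar> = dist (to_circle t) (to_circle 0)"
    by (rule lift_near)
  then obtain i :: int where i: "s = of_int i" by (auto simp: to_circle_eq_iff elim: Ints_cases)
  have "i \<le> n \<or> n + 1 \<le> i" by linarith
  then have "of_int i \<le> (of_int n :: real) \<or> of_int n + 1 \<le> (of_int i :: real)" by linarith
  then show ?thesis using s(2) i assms by linarith
qed

text \<open>Derivatives are controlled only where they exist; \<open>derivative_lower_bound\<close>
  for the monotone \<open>F\<close> integrates this to a bound for all slopes.\<close>

lemma expand_away:
  assumes "\<epsilon> > 0"
  obtains l where "l > 1" "\<And>n x y. of_int n + \<epsilon> \<le> x \<Longrightarrow> x \<le> y \<Longrightarrow> y \<le> of_int n + 1 - \<epsilon> \<Longrightarrow>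
    l * (y - x) \<le> F y - F x"
proof -
  obtain l where l: "l > 1" "\<And>t D. \<epsilon> \<le> dist (to_circle t) (to_circle 0) \<Longrightarrow>
    (F has_real_derivative D) (at t) \<Longrightarrow> l \<le> D"
    by (rule expanding_derivative[OF assms]) blast
  have "l * (y - x) \<le> F y - F x"
    if xy: "of_int n + \<epsilon> \<le> x" "x \<le> y" "y \<le> of_int n + 1 - \<epsilon>" for n x y
  proof (rule derivative_lower_bound[OF xy(2)])
    show "0 < l" using l(1) by simp
    fix t D assume t: "x < t" "t < y" and D: "(F has_real_derivative D) (at t)"
    have "of_int n + \<epsilon> \<le> t" "t \<le> of_int n + 1 - \<epsilon>" using t xy by linarith+
    then show "l \<le> D" by (rule l(2)[OF dist_zero D])
  qed
  then show ?thesis using that l(1) by blast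
qed

text \<open>About the derivative close to the neutral point nothing is known. Cutting off
  \<open>\<epsilon>\<close> at both ends of the unit interval loses at most
  \<open>2 * \<epsilon> = d\<close>, and on the rest the rate exceeds 1; then \<open>d\<close> tends
  to 0.\<close>

lemma expand_weak_unit:
  assumes "of_int n \<le> x" "x \<le> y" "y \<le> of_int n + 1"
  shows "y - x \<le> F y - F x"
proof (rule field_le_epsilon)
  fix d :: real assume "d > 0"
  define \<epsilon> where "\<epsilon> = d / 2"
  have \<epsilon>: "\<epsilon> > 0" using \<open>d > 0\<close> by (simp add: \<epsilon>_def)
  obtain l where l: "l > 1" "\<And>n x y. of_int n + \<epsilon> \<le> x \<Longrightarrow> x \<le> y \<Longrightarrow> y \<le> of_int n + 1 - \<epsilon> \<Longrightarrow>
    l * (y - x) \<le> F y - F x"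
    by (rule expand_away[OF \<epsilon>]) blast
  define a where "a = max x (of_int n + \<epsilon>)"
  define b where "b = min y (of_int n + 1 - \<epsilon>)"
  have ab: "a \<le> x + \<epsilon>" "y - \<epsilon> \<le> b" using assms \<epsilon> by (simp_all add: a_def b_def)
  show "y - x \<le> F y - F x + d"
  proof (cases "a \<le> b")
    case True
    have "b - a \<le> l * (b - a)" using True l(1) by (simp add: mult_le_cancel_right1)
    also have "\<dots> \<le> F b - F a" using True by (intro l(2)[of n]) (auto simp: a_def b_def)
    also have "\<dots> \<le> F y - F x" using mono[of x a] mono[of b y] by (simp add: a_def b_def)
    finally have "b - a \<le> F y - F x" .
    then show ?thesis using ab by (simp add: \<epsilon>_def)
  next
    case False
    then have "y - x \<le> d" using ab by (simp add: \<epsilon>_def)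
    then show ?thesis using mono[OF assms(2)] by simp
  qed
qed

lemma shift_int: "F (t + of_int i) = F t + of_int m * of_int i"
  by (rule shift_by_int[of F, OF shift])

lemma expand_weak:
  assumes "x \<le> y"
  shows "y - x \<le> F y - F x"
proof -
  define n where "n = \<lfloor>x\<rfloor>"
  define n' where "n' = \<lfloor>y\<rfloor>"
  have n: "of_int n \<le> x" "x \<le> of_int n + 1" and n': "of_int n' \<le> y" "y \<le> of_int n' + 1"
    unfolding n_def n'_def by linarith+
  show ?thesis
  proof (cases "n = n'")
    case True
    then show ?thesis using expand_weak_unit[of n x y] n n' assms by simp
  next
    case False
    then have nn: "n + 1 \<le> n'" using assms unfolding n_def n'_def by linarith
    define j where "j = n' - (n + 1)"
    have j: "0 \<le> j" "of_int n' = of_int n + 1 + (of_int j :: real)" using nn by (auto simp: j_def)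
    have "of_int j \<le> of_int m * (of_int j :: real)"
      using j(1) degree mult_right_mono[of 1 "of_int m" "of_int j :: real"] by simp
    then have "of_int n' - (of_int n + 1) \<le> F (of_int n') - F (of_int n + 1)"
      using shift_int[of "of_int n + 1" j] j(2) by simp
    moreover have "(of_int n + 1) - x \<le> F (of_int n + 1) - F x" using expand_weak_unit[of n x "of_int n + 1"] n by simp
    moreover have "y - of_int n' \<le> F y - F (of_int n')" using expand_weak_unit[of n' "of_int n'" y] n' by simp
    ultimately show ?thesis by linarith
  qed
qed

lemma expand_strict:
  assumes "x < y"
  shows "y - x < F y - F x"
proof -
  define n where "n = \<lfloor>x\<rfloor>"
  define b where "b = min y (of_int n + 1)"
  \<comment> \<open>The middle third of \<open>{x..b}\<close> stays at a positive distance from the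
    integers, so it alone gains strictly.\<close>
  define p where "p = (2 * x + b) / 3"
  define r where "r = (x + 2 * b) / 3"
  have n: "of_int n \<le> x" "x < of_int n + 1" unfolding n_def by linarith+
  have b: "x < b" "b \<le> y" "b \<le> of_int n + 1" using n assms by (auto simp: b_def)
  have pr: "x < p" "p < r" "r < b" using b by (auto simp: p_def r_def)
  define \<epsilon> where "\<epsilon> = min (p - of_int n) (of_int n + 1 - r)"
  have \<epsilon>: "\<epsilon> > 0" using pr b n by (simp add: \<epsilon>_def)
  obtain l where l: "l > 1" "\<And>n x y. of_int n + \<epsilon> \<le> x \<Longrightarrow> x \<le> y \<Longrightarrow> y \<le> of_int n + 1 - \<epsilon> \<Longrightarrow>
    l * (y - x) \<le> F y - F x"
    by (rule expand_away[OF \<epsilon>]) blast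
  have "r - p < l * (r - p)" using pr l(1) by simp
  also have "\<dots> \<le> F r - F p" using pr by (intro l(2)[of n]) (auto simp: \<epsilon>_def)
  finally have "r - p < F r - F p" .
  moreover have "p - x \<le> F p - F x" "y - r \<le> F y - F r" using pr b by (auto intro!: expand_weak)
  ultimately show ?thesis by linarith
qed

lemma circle_lift: "circle_lift T (\<lambda>t. of_int e * F t) (e * m)"
proof
  have abs: "\<bar>of_int e * x\<bar> = \<bar>x\<bar>" for x :: real using e_cases by auto
  show "bij (\<lambda>t. of_int e * F t)"
  proof -
    have "bij (\<lambda>x::real. of_int e * x)"
      by (rule o_bij[of "\<lambda>x. of_int e * x"]) (use e_cases in \<open>auto simp: fun_eq_iff\<close>)
    from bij_comp[OF bij_F this] show ?thesis by (simp add: o_def)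
  qed
  show "continuous_on UNIV (\<lambda>t. of_int e * F t)" by (intro continuous_intros cont)
  show "2 \<le> \<bar>e * m\<bar>" using degree orientation by (simp add: abs_mult)
  show "\<bar>s - t\<bar> < \<bar>of_int e * F s - of_int e * F t\<bar>" if "s \<noteq> t" for s t
    using expand_strict[of s t] expand_strict[of t s] that
    unfolding right_diff_distrib[symmetric] abs by (cases s t rule: linorder_cases) auto
qed (simp_all add: lift shift distrib_left)

text \<open>Two points in the region of constancy give the same value of \<open>A\<close>. Otherwise
  one endpoint is at least \<open>\<epsilon>\<close> away from the integers, and the adjacent piece
  of length \<open>w\<close>, being \<open>\<epsilon> / 2\<close> away from them, expands at the
  rate \<open>l0\<close>.\<close>

lemma flat_potential_constant_near_zero:
  assumes \<alpha>: "0 < \<alpha>" "\<alpha> \<le> 1" and A: "A \<in> holder_space \<alpha>"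
    and N: "open N" "to_circle 0 \<in> N" "A constant_on N"
  obtains C where "flat_potential T (\<lambda>t. of_int e * F t) (e * m) A \<alpha> C"
proof -
  interpret circle_lift T "\<lambda>t. of_int e * F t" "e * m" by (rule circle_lift)
  obtain H where H: "H \<ge> 0" "\<And>x y. \<bar>A x - A y\<bar> \<le> H * dist x y powr \<alpha>"
    by (rule holder_spaceE[OF A]) auto
  obtain a where a: "\<And>x. x \<in> N \<Longrightarrow> A x = a" using N(3) by (auto simp: constant_on_def)
  obtain \<epsilon>0 where \<epsilon>0: "\<epsilon>0 > 0" "ball (to_circle 0) \<epsilon>0 \<subseteq> N" using N(1,2) open_contains_ball by blast
  define \<epsilon> where "\<epsilon> = min \<epsilon>0 (1/4)"
  have \<epsilon>: "0 < \<epsilon>" "\<epsilon> \<le> 1/4" "\<epsilon> \<le> \<epsilon>0" using \<epsilon>0 by (auto simp: \<epsilon>_def)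
  have near: "A (to_circle s) = a" if "\<bar>s - of_int n\<bar> < \<epsilon>" for s n
  proof -
    have "dist (to_circle s) (to_circle 0) \<le> \<bar>s - of_int n\<bar>"
      using dist_to_circle_le[of s "of_int n"] to_circle_add_int[of 0 n] by simp
    then have "to_circle s \<in> ball (to_circle 0) \<epsilon>0" using that \<epsilon> by (simp add: dist_commute)
    then show ?thesis using a \<epsilon>0(2) by blast
  qed
  obtain l0 where l0: "l0 > 1" "\<And>n x y. of_int n + \<epsilon> / 2 \<le> x \<Longrightarrow> x \<le> y \<Longrightarrow> y \<le> of_int n + 1 - \<epsilon> / 2 \<Longrightarrow>
    l0 * (y - x) \<le> F y - F x"
    using expand_away[of "\<epsilon> / 2"] \<epsilon>(1) by (metis half_gt_zero)
  \<comment> \<open>A multiple of \<open>\<epsilon>\<close> because the expanding piece has length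
    at least \<open>\<epsilon> * l\<close>; capped at 1 as \<open>powr_increment\<close>
    demands.\<close>
  define \<eta> where "\<eta> = min 1 ((l0 - 1) * \<epsilon>)"
  have \<eta>: "0 < \<eta>" "\<eta> \<le> 1" "\<eta> \<le> (l0 - 1) * \<epsilon>" using l0(1) \<epsilon> by (auto simp: \<eta>_def)
  define C where "C = 4 * H / (\<alpha> * \<eta>)"
  have C: "0 \<le> C" using H \<alpha> \<eta> by (simp add: C_def)
  have absF: "\<bar>of_int e * F s' - of_int e * F s\<bar> = F s' - F s" if "s < s'" for s s'
    using e_cases mono[of s s'] that by auto
  have "flat_potential T (\<lambda>t. of_int e * F t) (e * m) A \<alpha> C"
  proof (rule flat_potentialI[OF \<alpha> C A])
    fix s s' :: real assume s: "s < s'" and X: "\<bar>of_int e * F s' - of_int e * F s\<bar> \<le> 1/2"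
    define l where "l = s' - s"
    have lX: "l < F s' - F s" unfolding l_def by (rule expand_strict[OF s])
    have l: "0 < l" "l < 1/2" using lX X s unfolding absF[OF s] by (auto simp: l_def)
    have "\<bar>A (to_circle s') - A (to_circle s)\<bar> \<le> C * ((F s' - F s) powr \<alpha> - l powr \<alpha>)"
    \<comment> \<open>With two independent integers the negation says that one of the two points has
      distance at least \<open>\<epsilon>\<close> from every integer.\<close>
    proof (cases "\<exists>n n'::int. \<bar>s - of_int n\<bar> < \<epsilon> \<and> \<bar>s' - of_int n'\<bar> < \<epsilon>")
      case True
      then have "A (to_circle s') = A (to_circle s)" using near by metis
      moreover have "l powr \<alpha> \<le> (F s' - F s) powr \<alpha>" using lX l \<alpha> by (intro powr_mono2) auto
      ultimately show ?thesis using C by simp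
    next
      case False
      define w where "w = min l (\<epsilon> / 2)"
      have w: "0 < w" "w \<le> l" "w \<le> \<epsilon> / 2" using l \<epsilon> by (auto simp: w_def)
      have \<epsilon>l: "\<epsilon> * l \<le> w"
      proof -
        have "\<epsilon> * l \<le> 1 * l" "\<epsilon> * l \<le> \<epsilon> * (1/2)" using \<epsilon> l by (auto intro!: mult_right_mono mult_left_mono)
        then show ?thesis by (simp add: w_def)
      qed
      have far: "\<exists>n::int. of_int n + \<epsilon> \<le> t \<and> t \<le> of_int n + 1 - \<epsilon>" if t: "\<And>n::int. \<not> \<bar>t - of_int n\<bar> < \<epsilon>" for t
      proof (intro exI[of _ "\<lfloor>t\<rfloor>"])
        have "of_int \<lfloor>t\<rfloor> \<le> t" "t < of_int \<lfloor>t\<rfloor> + 1" by linarith+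
        then show "of_int \<lfloor>t\<rfloor> + \<epsilon> \<le> t \<and> t \<le> of_int \<lfloor>t\<rfloor> + 1 - \<epsilon>"
          using t[of "\<lfloor>t\<rfloor>"] t[of "\<lfloor>t\<rfloor> + 1"] by (intro conjI; linarith)
      qed
      have "l + (l0 - 1) * w \<le> F s' - F s"
      proof (cases "\<exists>n::int. \<bar>s - of_int n\<bar> < \<epsilon>")
        case False
        then obtain n :: int where n: "of_int n + \<epsilon> \<le> s" "s \<le> of_int n + 1 - \<epsilon>" using far[of s] by blast
        have "l0 * ((s + w) - s) \<le> F (s + w) - F s"
          by (rule l0(2)[of n]) (use n w \<epsilon> in linarith)+
        moreover have "s' - (s + w) \<le> F s' - F (s + w)" using w by (intro expand_weak) (simp add: l_def)
        moreover have "l0 * ((s + w) - s) = (l0 - 1) * w + w" by (simp add: algebra_simps)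
        ultimately show ?thesis unfolding l_def by linarith
      next
        case True
        then have "\<And>n::int. \<not> \<bar>s' - of_int n\<bar> < \<epsilon>" using False by blast
        then obtain n :: int where n: "of_int n + \<epsilon> \<le> s'" "s' \<le> of_int n + 1 - \<epsilon>" using far[of s'] by blast
        have "l0 * (s' - (s' - w)) \<le> F s' - F (s' - w)"
          by (rule l0(2)[of n]) (use n w \<epsilon> in linarith)+
        moreover have "(s' - w) - s \<le> F (s' - w) - F s" using w by (intro expand_weak) (simp add: l_def)
        moreover have "l0 * (s' - (s' - w)) = (l0 - 1) * w + w" by (simp add: algebra_simps)
        ultimately show ?thesis unfolding l_def by linarith
      qed
      moreover have "l / 2 * \<eta> \<le> (l0 - 1) * w"
      proof -
        have "l / 2 * \<eta> \<le> l * ((l0 - 1) * \<epsilon>)" using l \<eta> by (intro mult_mono) auto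
        also have "\<dots> = (l0 - 1) * (\<epsilon> * l)" by simp
        also have "\<dots> \<le> (l0 - 1) * w" using \<epsilon>l l0(1) by (intro mult_left_mono) auto
        finally show ?thesis .
      qed
      ultimately have gain: "l + l / 2 * \<eta> \<le> F s' - F s" by linarith
      have inc: "\<alpha> / 4 * l powr \<alpha> * \<eta> \<le> (F s' - F s) powr \<alpha> - l powr \<alpha>"
        using \<eta> by (intro powr_increment[OF l(1) _ _ gain \<alpha>]) auto
      have "dist (to_circle s') (to_circle s) = l" using dist_to_circle_eq[of s' s] l by (simp add: l_def)
      then have "\<bar>A (to_circle s') - A (to_circle s)\<bar> \<le> H * l powr \<alpha>"
        using H(2)[of "to_circle s'" "to_circle s"] by simp
      also have "\<dots> = C * (\<alpha> / 4 * l powr \<alpha> * \<eta>)" using \<alpha> \<eta> by (simp add: C_def)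
      also have "\<dots> \<le> C * ((F s' - F s) powr \<alpha> - l powr \<alpha>)" using C inc by (intro mult_left_mono)
      finally show ?thesis .
    qed
    then show "\<bar>A (to_circle s') - A (to_circle s)\<bar>
      \<le> C * (\<bar>of_int e * F s' - of_int e * F s\<bar> powr \<alpha> - (s' - s) powr \<alpha>)"
      unfolding absF[OF s] l_def .
  qed
  then show ?thesis by (rule that)
qed

end

lemma covering_lift_exists:
  assumes "self_covering k T" "2 \<le> k" "expanding_away_from T (to_circle 0)"
  obtains F e m where "covering_lift F T e m"
proof -
  obtain F m where F: "continuous_on UNIV F" "inj F" "surj F" "\<And>t. T (to_circle t) = to_circle (F t)"
    "\<And>t. F (t + 1) = F t + of_int m" "2 \<le> \<bar>m\<bar>"
    using self_covering_lift[OF assms(1,2)] by blast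
  have "strict_mono F \<or> strict_antimono_on UNIV F"
    using injective_eq_monotone_map[of UNIV F] F(1,2) by auto
  then show ?thesis
  proof
    assume mono: "strict_mono F"
    have "0 < m" using strict_monoD[OF mono, of 0 1] F(5)[of 0] by simp
    then have "covering_lift F T 1 m"
      using F assms(3) mono by unfold_locales (auto simp: bij_def strict_mono_less_eq)
    then show ?thesis by (rule that)
  next
    assume anti: "strict_antimono_on UNIV F"
    have less: "F y < F x" if "x < y" for x y using anti that by (auto simp: monotone_on_def)
    have le: "F y \<le> F x" if "x \<le> y" for x y using less[of x y] that by (cases "x = y") auto
    have "m < 0" using less[of 0 1] F(5)[of 0] by simp
    moreover have "bij (\<lambda>t. - F t)"
    proof (rule bijI)
      show "inj (\<lambda>t. - F t)" using F(2) by (simp add: inj_def)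
      have "\<exists>t. - F t = y" for y using F(3) by (metis minus_minus surj_def)
      then show "surj (\<lambda>t. - F t)" by (metis surjI)
    qed
    ultimately have "covering_lift (\<lambda>t. - F t) T (- 1) (- m)"
      using F assms(3) le by unfold_locales (auto intro!: continuous_intros)
    then show ?thesis by (rule that)
  qed
qed

section \<open>Uniqueness of the equilibrium state\<close>

theorem corollary4:
  fixes T :: "circle \<Rightarrow> circle" and V :: "(circle \<Rightarrow> real) set" and \<alpha> :: real
  assumes situation:
    "(\<exists>q>0. T = T_pow q \<and>
        ((q < 1 \<and> (\<exists>\<gamma>. \<alpha> \<in> {0<..<1} \<and> \<gamma> \<in> {0<..<1} \<and> \<gamma> - \<alpha> \<ge> q \<and> V = holder_space \<gamma>)) \<or>
         (q \<ge> 1 \<and> (\<exists>\<gamma>>q. \<alpha> \<in> {0<..1} \<and> \<gamma> + 1 - \<alpha> \<ge> q \<and>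
                      V = {A \<in> holder_space \<alpha>. flat_at_zero \<gamma> A})))) \<or>
     (\<exists>q>0. T = T_log q \<and> \<alpha> \<in> {0<..<1} \<and>
        (\<exists>\<omega>. log_holder_modulus \<alpha> q \<omega> \<and> V = modulus_space \<omega>)) \<or>
     ((\<exists>k\<ge>2. self_covering k T) \<and> neutral_fixed_point T (to_circle 0) \<and>
        expanding_away_from T (to_circle 0) \<and> \<alpha> \<in> {0<..1} \<and>
        V = {A \<in> holder_space \<alpha>. \<exists>N. open N \<and> to_circle 0 \<in> N \<and> A constant_on N})"
  shows "\<forall>A\<in>V. (\<exists>\<mu>. RPF_measure \<alpha> T A \<mu>) \<and>
           (\<forall>\<mu>. RPF_measure \<alpha> T A \<mu> \<longrightarrow>
              equilibrium_state T A \<mu> \<and> (\<forall>\<nu>. equilibrium_state T A \<nu> \<longrightarrow> \<nu> = \<mu>))"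
proof
  fix A assume A: "A \<in> V"
  \<comment> \<open>Each situation is reduced to a lift along whose inverse branches
    \<open>A\<close> is flat; everything after that is common to all three.\<close>
  have "\<exists>F m C. flat_potential T F m A \<alpha> C"
    using situation
  proof (elim disjE exE conjE)
    fix q \<gamma> assume q: "0 < q" and T: "T = T_pow q"
      and "\<alpha> \<in> {0<..<1}" "\<gamma> - \<alpha> \<ge> q" "V = holder_space \<gamma>"
    then have *: "0 < \<alpha>" "\<alpha> \<le> 1" "q \<le> \<gamma> - \<alpha>" "A \<in> holder_space \<gamma>" using A by auto
    show ?thesis unfolding T by (rule flat_potential_pow_holder[OF q *]) blast
  next
    fix q \<gamma> assume q: "0 < q" and T: "T = T_pow q"
      and "\<gamma> > q" "\<alpha> \<in> {0<..1}" "\<gamma> + 1 - \<alpha> \<ge> q" "V = {A \<in> holder_space \<alpha>. flat_at_zero \<gamma> A}"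
    then have *: "0 < \<alpha>" "\<alpha> \<le> 1" "q < \<gamma>" "q \<le> \<gamma> + 1 - \<alpha>" "A \<in> holder_space \<alpha>" "flat_at_zero \<gamma> A"
      using A by auto
    show ?thesis unfolding T by (rule flat_potential_pow_flat[OF q *]) blast
  next
    fix q \<omega> assume q: "0 < q" and T: "T = T_log q"
      and "\<alpha> \<in> {0<..<1}" "log_holder_modulus \<alpha> q \<omega>" "V = modulus_space \<omega>"
    then have *: "0 < \<alpha>" "\<alpha> \<le> 1" "log_holder_modulus \<alpha> q \<omega>" "A \<in> modulus_space \<omega>" using A by auto
    show ?thesis unfolding T by (rule flat_potential_log[OF q *]) blast
  next
    fix k :: nat
    assume k: "2 \<le> k" "self_covering k T" and ex: "expanding_away_from T (to_circle 0)"
      and \<alpha>: "\<alpha> \<in> {0<..1}"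
      and V: "V = {A \<in> holder_space \<alpha>. \<exists>N. open N \<and> to_circle 0 \<in> N \<and> A constant_on N}"
    obtain F e m where "covering_lift F T e m" by (rule covering_lift_exists[OF k(2,1) ex])
    then interpret covering_lift F T e m .
    obtain N where *: "A \<in> holder_space \<alpha>" "open N" "to_circle 0 \<in> N" "A constant_on N"
      using A V by auto
    have "0 < \<alpha>" "\<alpha> \<le> 1" using \<alpha> by auto
    from this * show ?thesis by (rule flat_potential_constant_near_zero) blast
  qed
  then obtain F m C where "flat_potential T F m A \<alpha> C" by blast
  then show "(\<exists>\<mu>. RPF_measure \<alpha> T A \<mu>) \<and>
     (\<forall>\<mu>. RPF_measure \<alpha> T A \<mu> \<longrightarrow>
        equilibrium_state T A \<mu> \<and> (\<forall>\<nu>. equilibrium_state T A \<nu> \<longrightarrow> \<nu> = \<mu>))"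
    by (rule flat_potential.RPF_measure_unique_equilibrium)
qed

end
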